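(* Assume the low-order non-resonance condition $$\mathrm{Re}\,\lambda_i^y\neq m_1\mathrm{Re}\,\lambda_1^x+m_2\mathrm{Re}\,\lambda_2^x,\qquad i=1,\dots,2n,\quad 2\le m_1+m_2\le\Sigma,\quad m_1,m_2\in\mathbb{N}.$$ Then the single-degree-of-freedom, third-order SSM-reduced model of the system $$m\ddot x+c\dot x+kx+P(x,\dot x,\mathbf{y},\dot{\mathbf{y}})=\varepsilon F_1\sin(\phi),\qquad \mathbf{M}\ddot{\mathbf{y}}+\mathbf{C}\dot{\mathbf{y}}+\mathbf{K}\mathbf{y}+\mathbf{Q}(x,\dot x,\mathbf{y},\dot{\mathbf{y}})=\varepsilon\mathbf{F}_2\sin(\phi),$$ with $\phi=\Omega t$ and $0<\varepsilon\ll1$, is of the form $$\begin{aligned}m\ddot x&+c\dot x+kx+p_{20\mathbf{0}\mathbf{0}}x^2+p_{11\mathbf{0}\mathbf{0}}x\dot x+p_{02\mathbf{0}\mathbf{0}}\dot x^2+p_{30\mathbf{0}\mathbf{0}}x^3+p_{21\mathbf{0}\mathbf{0}}x^2\dot x+p_{12\mathbf{0}\mathbf{0}}x\dot x^2+p_{03\mathbf{0}\mathbf{0}}\dot x^3\\&+\left\langle(\boldsymbol{\Phi}_2\mathbf{W})^\top\left(x\,\mathbf{p}_{10\mathbf{I}\mathbf{0}}+\dot x\,\mathbf{p}_{01\mathbf{I}\mathbf{0}}\right),\mathbf{z}^{\otimes2}\right\rangle+\left\langle(\boldsymbol{\Phi}_2\tilde{\mathbf{W}})^\top\left(x\,\mathbf{p}_{10\mathbf{0}\mathbf{I}}+\dot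 x\,\mathbf{p}_{01\mathbf{0}\mathbf{I}}\right),\mathbf{z}^{\otimes2}\right\rangle\\&+\mathcal{O}\left(|(x,\dot x)|^4,\varepsilon|(x,\dot x)|,\varepsilon^2\right)=\varepsilon F_1\sin(\phi),\end{aligned}$$ where $\mathbf{z}^{\otimes2}=[x^2,x\dot x,\dot xx,\dot x^2]^\top$ and the $n\times4$ matrices $$\mathbf{W}=[\mathbf{w}_{11}\ \mathbf{w}_{12}\ \mathbf{w}_{12}\ \mathbf{w}_{22}],\qquad\tilde{\mathbf{W}}=[\tilde{\mathbf{w}}_{11}\ \tilde{\mathbf{w}}_{12}\ \tilde{\mathbf{w}}_{12}\ \tilde{\mathbf{w}}_{22}]$$ have columns whose components are, for $i=1,\dots,n$, $$\begin{bmatrix} w_{11,i} \\ {w}_{12,i} \\ {w}_{22,i}\end{bmatrix}=\mathbf{L}_i^{-1}\begin{bmatrix} s_{20\mathbf{0}\mathbf{0},i} \\ {s}_{11\mathbf{0}\mathbf{0},i} \\ {s}_{02\mathbf{0}\mathbf{0},i}\end{bmatrix},$$ $$\mathbf{L}_i=\begin{bmatrix}2\omega^2-\omega_i^2&4\omega^2(\zeta_i\omega_i-\zeta\omega)&-2\omega^4\\2(\zeta\omega-\zeta_i\omega_i)&4\zeta_i\omega_i\zeta\omega-4\omega^2(\zeta^2-1)-\omega_i^2&2\zeta_i\omega_i\omega^2-6\zeta\omega^3\\-2&4(3\zeta\omega-\zeta_i\omega_i)&2\omega^2-\omega_i^2+8\zeta_i\omega_i\zeta\omega-16(\zeta\omega)^2\end{bmatrix},$$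 $$\tilde w_{11,i}=-2\omega^2w_{12,i},\qquad\tilde w_{12,i}=w_{11,i}-2\zeta\omega w_{12,i}-\omega^2w_{22,i},\qquad\tilde w_{22,i}=2w_{12,i}-4\zeta\omega w_{22,i}.$$
   Context: Setting: an $(n+1)$-degree-of-freedom, periodically forced, damped mechanical system; $x\in\mathbb{R}$, $\mathbf{y}\in\mathbb{R}^n$, forcing frequency $\Omega$, $F_1\in\mathbb{R}$ and $\mathbf{F}_2\in\mathbb{R}^n$ constant. $\mathbf{M},\mathbf{C},\mathbf{K}$ are the $n\times n$ mass, damping and stiffness matrices, and $m,c,k$ are the modal mass, damping and stiffness of the $x$-mode. Rayleigh damping is assumed, so the modal matrix simultaneously diagonalizes mass, damping and stiffness. $P$ and $\mathbf{Q}$ are polynomials with terms of orders $2$ to $l$, $2\le l\le3$: $P=\sum_{j+k+|\mathbf{u}|+|\mathbf{v}|=2}^{l}p_{jk\mathbf{u}\mathbf{v}}x^j\dot x^ky_1^{u_1}\cdots y_n^{u_n}\dot y_1^{v_1}\cdots\dot y_n^{v_n}$ and $\mathbf{Q}=\sum_{j+k+|\mathbf{u}|+|\mathbf{v}|=2}^{l}\mathbf{q}_{jk\mathbf{u}\mathbf{v}}x^j\dot x^ky_1^{u_1}\cdots y_n^{u_n}\dot y_1^{v_1}\cdots\dot y_n^{v_n}$, with $p_{jk\mathbf{u}\mathbf{v}}\in\mathbb{R}$, $\mathbf{q}_{jk\mathbf{u}\mathbf{v}}\in\mathbb{R}^n$, $\mathbf{u},\mathbf{v}\in\mathbb{N}^n$,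 $0\in\mathbb{N}$ (coefficients of order higher than $l$ are zero). With $\mathbf{e}_j$ the $j$-th unit index and $\mathbf{0}$ the zero index, $\mathbf{p}_{jk\mathbf{I}\mathbf{0}}:=[p_{jk\mathbf{e}_1\mathbf{0}},\dots,p_{jk\mathbf{e}_n\mathbf{0}}]^\top$ and $\mathbf{p}_{jk\mathbf{0}\mathbf{I}}:=[p_{jk\mathbf{0}\mathbf{e}_1},\dots,p_{jk\mathbf{0}\mathbf{e}_n}]^\top$. Eigenvalues: $\lambda_1^x=\bar\lambda_2^x$ are the roots of $m\lambda^2+c\lambda+k=0$ (underdamped), and $\lambda_i^y$, $i=1,\dots,2n$, are the roots of $\det(\lambda^2\mathbf{M}+\lambda\mathbf{C}+\mathbf{K})=0$, ordered so that $\mathrm{Re}\,\lambda_{2n}^y\le\dots\le\mathrm{Re}\,\lambda_1^y<\mathrm{Re}\,\lambda_2^x=\mathrm{Re}\,\lambda_1^x<0$ (the $x$-mode is the slowest decaying mode). $\Sigma:=\mathrm{Int}\left(\mathrm{Re}\,\lambda_{2n}^y/\mathrm{Re}\,\lambda_1^x\right)$, with $\mathrm{Int}$ the integer part. The modal parameters $\omega,\zeta$ of $x$ are defined by $\omega^2=k/m$, $2\zeta\omega=c/m$. Modal coordinates: $\mathbf{y}=\boldsymbol{\Phi}_2\boldsymbol{\eta}$, with $\boldsymbol{\Phi}_2$ the real $n\times n$ (mass-normalized) modal matrix; after left multiplication by $\boldsymbol{\Phi}_2^\top$ the second equation becomes, for $i=1,\dots,n$, $\ddot\eta_i+2\zeta_i\omega_i\dot\eta_i+\omega_i^2\eta_i+S_i(x,\dot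 x,\boldsymbol{\eta},\dot{\boldsymbol{\eta}})=\varepsilon\hat F_{2,i}\sin(\phi)$, with $\mathbf{S}=\boldsymbol{\Phi}_2^\top\mathbf{Q}(x,\dot x,\boldsymbol{\Phi}_2\boldsymbol{\eta},\boldsymbol{\Phi}_2\dot{\boldsymbol{\eta}})$ and $\hat{\mathbf{F}}_2=\boldsymbol{\Phi}_2^\top\mathbf{F}_2$. The numbers $s_{20\mathbf{0}\mathbf{0},i},s_{11\mathbf{0}\mathbf{0},i},s_{02\mathbf{0}\mathbf{0},i}$ are the entries of the symmetric matrix representing the part of $S_i$ that is quadratic in $(x,\dot x)$ alone, i.e. this part equals $s_{20\mathbf{0}\mathbf{0},i}x^2+2s_{11\mathbf{0}\mathbf{0},i}x\dot x+s_{02\mathbf{0}\mathbf{0},i}\dot x^2$. Spectral submanifold (SSM): it is known (Haller and Ponsioen) that under the low-order non-resonance condition $\mathrm{Re}\,\lambda_i^y\neq m_1\mathrm{Re}\,\lambda_1^x+m_2\mathrm{Re}\,\lambda_2^x$ for all $i=1,\dots,2n$ and all $m_1,m_2\in\mathbb{N}$ with $2\le m_1+m_2\le\Sigma$, there is, for small $\varepsilon$, a two-dimensional, analytic, invariant, attracting SSM, time-periodic in $\phi$ and unique in the class $C^{\Sigma+1}$, which perturbs smoothly from the slow spectral subspace $\mathbf{y}=\dot{\mathbf{y}}=\mathbf{0}$ of the linear unforced system. Near the origin it is a graph $\mathbf{y}=\mathbf{y}(x,\dot x,\phi;\varepsilon)$, $\dot{\mathbf{y}}=\dot{\mathbf{y}}(x,\dot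 x,\phi;\varepsilon)$. The SSM-reduced model is the equation for $x$ obtained by substituting this graph into the first equation of motion, $m\ddot x+c\dot x+kx+P(x,\dot x,\mathbf{y},\dot{\mathbf{y}})=\varepsilon F_1\sin(\phi)$. $\mathcal{O}(a,b,c)$ denotes a sum of terms of orders $\mathcal{O}(a)$, $\mathcal{O}(b)$, $\mathcal{O}(c)$. *)

theory Defs
  imports "HOL-Analysis.Analysis" "HOL-Library.Landau_Symbols"
    "HOL-Computational_Algebra.Polynomial"
begin

section \<open>Polynomial nonlinearities\<close>

definition mdeg :: "nat^'n \<Rightarrow> nat" where
  "mdeg u = (\<Sum>i\<in>UNIV. u $ i)"

definition mpow :: "real^'n \<Rightarrow> nat^'n \<Rightarrow> real" where
  "mpow y u = (\<Prod>i\<in>UNIV. (y $ i) ^ (u $ i))"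

definition orders :: "nat \<Rightarrow> (nat \<times> nat \<times> (nat^'n) \<times> (nat^'n)) set" where
  "orders l = {(j, k, u, w). 2 \<le> j + k + mdeg u + mdeg w \<and> j + k + mdeg u + mdeg w \<le> l}"

text \<open>Arguments are position and velocity of the first mode (\<open>x\<close>, \<open>v\<close>) and of the remaining
  modes (\<open>y\<close>, \<open>y'\<close>).  Coefficients are real numbers for the first equation of motion and
  vectors for the second.\<close>

definition mech_poly ::
  "nat \<Rightarrow> (nat \<Rightarrow> nat \<Rightarrow> nat^'n \<Rightarrow> nat^'n \<Rightarrow> 'b::real_vector) \<Rightarrow>
    real \<Rightarrow> real \<Rightarrow> real^'n \<Rightarrow> real^'n \<Rightarrow> 'b" where
  "mech_poly l p x v y y' =
     (\<Sum>(j, k, u, w)\<in>orders l. (x ^ j * v ^ k * mpow y u * mpow y' w) *\<^sub>R p j k u w)"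

text \<open>The sum in \<open>mech_poly\<close> is over a finite set, so it is not trivially zero.\<close>

lemma finite_orders: "finite (orders l :: (nat \<times> nat \<times> (nat^'n) \<times> (nat^'n)) set)"
proof -
  have "finite {u :: nat^'n. \<forall>i. u $ i \<in> {..l}}"
  proof (rule finite_subset)
    show "{u :: nat^'n. \<forall>i. u $ i \<in> {..l}} \<subseteq> vec_lambda ` (UNIV \<rightarrow>\<^sub>E {..l})"
      by (force simp: image_iff intro!: bexI[of _ "vec_nth _"])
  qed (intro finite_imageI finite_PiE; simp)
  moreover have "u $ i \<le> mdeg u" for u :: "nat^'n" and i
    unfolding mdeg_def by (rule member_le_sum) auto
  hence "mdeg u \<le> l \<Longrightarrow> u \<in> {u :: nat^'n. \<forall>i. u $ i \<in> {..l}}" for u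
    by (auto intro: order_trans)
  hence "(orders l :: (nat \<times> nat \<times> (nat^'n) \<times> (nat^'n)) set) \<subseteq>
      {..l} \<times> {..l} \<times> {u. \<forall>i. u $ i \<in> {..l}} \<times> {u. \<forall>i. u $ i \<in> {..l}}"
    unfolding orders_def by fastforce
  ultimately show ?thesis
    by (meson finite_SigmaI finite_atMost finite_subset)
qed

definition coeffs_y ::
  "(nat \<Rightarrow> nat \<Rightarrow> nat^'n \<Rightarrow> nat^'n \<Rightarrow> real) \<Rightarrow> nat \<Rightarrow> nat \<Rightarrow> real^'n" where
  "coeffs_y p j k = (\<chi> i. p j k (axis i 1) 0)"

definition coeffs_y' ::
  "(nat \<Rightarrow> nat \<Rightarrow> nat^'n \<Rightarrow> nat^'n \<Rightarrow> real) \<Rightarrow> nat \<Rightarrow> nat \<Rightarrow> real^'n" where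
  "coeffs_y' p j k = (\<chi> i. p j k 0 (axis i 1))"

section \<open>Linear part\<close>

text \<open>The polynomial \<open>det (\<lambda>\<^sup>2 M + \<lambda> C + K)\<close> in the indeterminate \<open>\<lambda>\<close>; the determinant is
  taken over the ring of complex polynomials.\<close>

definition quad_charpoly :: "real^'n^'n \<Rightarrow> real^'n^'n \<Rightarrow> real^'n^'n \<Rightarrow> complex poly" where
  "quad_charpoly M C K =
     det (\<chi> i j. [: of_real (K $ i $ j), of_real (C $ i $ j), of_real (M $ i $ j) :])"

definition diag_matrix :: "('n \<Rightarrow> real) \<Rightarrow> real^'n^'n" where
  "diag_matrix d = (\<chi> i j. if i = j then d i else 0)"

text \<open>\<open>\<Phi>\<close> is a mass-normalized modal matrix, with modal frequencies \<open>\<omega>s\<close> and damping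
  ratios \<open>\<zeta>s\<close>.\<close>

definition modal_matrix ::
  "real^'n^'n \<Rightarrow> real^'n^'n \<Rightarrow> real^'n^'n \<Rightarrow> real^'n^'n \<Rightarrow> ('n \<Rightarrow> real) \<Rightarrow> ('n \<Rightarrow> real) \<Rightarrow> bool" where
  "modal_matrix M C K \<Phi> \<omega>s \<zeta>s \<longleftrightarrow>
     transpose \<Phi> ** M ** \<Phi> = mat 1 \<and>
     transpose \<Phi> ** C ** \<Phi> = diag_matrix (\<lambda>i. 2 * \<zeta>s i * \<omega>s i) \<and>
     transpose \<Phi> ** K ** \<Phi> = diag_matrix (\<lambda>i. (\<omega>s i)\<^sup>2)"

definition modal_force ::
  "real^'n^'n \<Rightarrow> (real \<Rightarrow> real \<Rightarrow> real^'n \<Rightarrow> real^'n \<Rightarrow> real^'n) \<Rightarrow>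
    real \<Rightarrow> real \<Rightarrow> real^'n \<Rightarrow> real^'n \<Rightarrow> real^'n" where
  "modal_force \<Phi> Q x v \<eta> \<eta>' = transpose \<Phi> *v Q x v (\<Phi> *v \<eta>) (\<Phi> *v \<eta>')"

text \<open>The polynomial \<open>f\<close>, which has terms of orders 2 and 3 only, has quadratic part
  \<open>a x\<^sup>2 + 2 b x v + c v\<^sup>2\<close>, represented by the symmetric matrix with entries \<open>a\<close>, \<open>b\<close>, \<open>c\<close>;
  note the factor 2.\<close>

definition has_quadratic_part :: "(real \<Rightarrow> real \<Rightarrow> real) \<Rightarrow> real \<Rightarrow> real \<Rightarrow> real \<Rightarrow> bool" where
  "has_quadratic_part f a b c \<longleftrightarrow>
     (\<exists>r30 r21 r12 r03. \<forall>x v. f x v =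
        (a * x\<^sup>2 + 2 * b * x * v + c * v\<^sup>2) +
        (r30 * x ^ 3 + r21 * x\<^sup>2 * v + r12 * x * v\<^sup>2 + r03 * v ^ 3))"

section \<open>Spectral submanifold and reduced model\<close>

definition forced_solution ::
  "real \<Rightarrow> real \<Rightarrow> real \<Rightarrow> (real \<Rightarrow> real \<Rightarrow> real^'n \<Rightarrow> real^'n \<Rightarrow> real) \<Rightarrow> real \<Rightarrow>
   real^'n^'n \<Rightarrow> real^'n^'n \<Rightarrow> real^'n^'n \<Rightarrow>
   (real \<Rightarrow> real \<Rightarrow> real^'n \<Rightarrow> real^'n \<Rightarrow> real^'n) \<Rightarrow> real^'n \<Rightarrow>
   real \<Rightarrow> real \<Rightarrow> real set \<Rightarrow>
   (real \<Rightarrow> real) \<Rightarrow> (real \<Rightarrow> real) \<Rightarrow> (real \<Rightarrow> real^'n) \<Rightarrow> (real \<Rightarrow> real^'n) \<Rightarrow> bool" where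
  "forced_solution m c k P F1 M C K Q F2 \<Omega> \<epsilon> T x x' y y' \<longleftrightarrow>
     (\<forall>t\<in>T. \<exists>x'' y''.
        (x has_real_derivative x' t) (at t) \<and> (x' has_real_derivative x'') (at t) \<and>
        (y has_vector_derivative y' t) (at t) \<and> (y' has_vector_derivative y'') (at t) \<and>
        m * x'' + c * x' t + k * x t + P (x t) (x' t) (y t) (y' t) = \<epsilon> * F1 * sin (\<Omega> * t) \<and>
        M *v y'' + C *v y' t + K *v y t + Q (x t) (x' t) (y t) (y' t)
          = (\<epsilon> * sin (\<Omega> * t)) *\<^sub>R F2)"

text \<open>Real analyticity of a function of four real variables at a point: near the point it is
  the sum of an (unconditionally convergent) power series.\<close>

definition real_analytic4_at ::
  "(real \<Rightarrow> real \<Rightarrow> real \<Rightarrow> real \<Rightarrow> 'b::real_normed_vector) \<Rightarrow>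
    real \<Rightarrow> real \<Rightarrow> real \<Rightarrow> real \<Rightarrow> bool" where
  "real_analytic4_at f x0 v0 \<phi>0 \<epsilon>0 \<longleftrightarrow>
     (\<exists>r>0. \<exists>a :: nat \<Rightarrow> nat \<Rightarrow> nat \<Rightarrow> nat \<Rightarrow> 'b. \<forall>x v \<phi> \<epsilon>.
        \<bar>x - x0\<bar> < r \<and> \<bar>v - v0\<bar> < r \<and> \<bar>\<phi> - \<phi>0\<bar> < r \<and> \<bar>\<epsilon> - \<epsilon>0\<bar> < r \<longrightarrow>
        ((\<lambda>(i, j, k, l). ((x - x0) ^ i * (v - v0) ^ j * (\<phi> - \<phi>0) ^ k * (\<epsilon> - \<epsilon>0) ^ l) *\<^sub>R a i j k l)
          has_sum f x v \<phi> \<epsilon>) UNIV)"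

text \<open>The slow spectral submanifold near the origin, as the graph \<open>y = h x v \<phi> \<epsilon>\<close>,
  \<open>y' = h' x v \<phi> \<epsilon>\<close> over the slow modal coordinates: analytic in all variables,
  time-periodic, emanating at \<open>\<epsilon> = 0\<close> from the slow spectral subspace \<open>y = y' = 0\<close> (to which it is
  tangent at the origin), and locally invariant, i.e. the trajectory of the full system through
  any of its points stays on it for times close to the initial one.  Only the germ of \<open>(h, h')\<close>
  along \<open>x = v = \<epsilon> = 0\<close> is meaningful.  Phase and time are related by \<open>\<phi> = \<Omega> t\<close>; as the initial
  time \<open>t0\<close> is arbitrary, all phases are covered.\<close>

definition slow_SSM ::
  "real \<Rightarrow> real \<Rightarrow> real \<Rightarrow> (real \<Rightarrow> real \<Rightarrow> real^'n \<Rightarrow> real^'n \<Rightarrow> real) \<Rightarrow> real \<Rightarrow>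
   real^'n^'n \<Rightarrow> real^'n^'n \<Rightarrow> real^'n^'n \<Rightarrow>
   (real \<Rightarrow> real \<Rightarrow> real^'n \<Rightarrow> real^'n \<Rightarrow> real^'n) \<Rightarrow> real^'n \<Rightarrow> real \<Rightarrow>
   (real \<Rightarrow> real \<Rightarrow> real \<Rightarrow> real \<Rightarrow> real^'n) \<Rightarrow> (real \<Rightarrow> real \<Rightarrow> real \<Rightarrow> real \<Rightarrow> real^'n) \<Rightarrow> bool" where
  "slow_SSM m c k P F1 M C K Q F2 \<Omega> h h' \<longleftrightarrow>
     (\<exists>\<delta>>0. \<exists>\<epsilon>0>0.
        (\<forall>x v \<phi> \<epsilon>. norm (x, v) < \<delta> \<and> \<bar>\<epsilon>\<bar> < \<epsilon>0 \<longrightarrow>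
           real_analytic4_at h x v \<phi> \<epsilon> \<and> real_analytic4_at h' x v \<phi> \<epsilon> \<and>
           h x v (\<phi> + 2 * pi) \<epsilon> = h x v \<phi> \<epsilon> \<and> h' x v (\<phi> + 2 * pi) \<epsilon> = h' x v \<phi> \<epsilon>) \<and>
        (\<forall>\<phi>. h 0 0 \<phi> 0 = 0 \<and> h' 0 0 \<phi> 0 = 0 \<and>
           ((\<lambda>(x, v). h x v \<phi> 0) has_derivative (\<lambda>_. 0)) (at (0, 0)) \<and>
           ((\<lambda>(x, v). h' x v \<phi> 0) has_derivative (\<lambda>_. 0)) (at (0, 0))) \<and>
        (\<forall>\<epsilon> t0 x0 v0. 0 \<le> \<epsilon> \<and> \<epsilon> < \<epsilon>0 \<and> norm (x0, v0) < \<delta> \<longrightarrow>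
           (\<exists>\<tau>>0. \<exists>x x' y y'.
              forced_solution m c k P F1 M C K Q F2 \<Omega> \<epsilon> {t0 - \<tau><..<t0 + \<tau>} x x' y y' \<and>
              x t0 = x0 \<and> x' t0 = v0 \<and>
              (\<forall>t\<in>{t0 - \<tau><..<t0 + \<tau>}. norm (x t, x' t) < \<delta> \<and>
                 y t = h (x t) (x' t) (\<Omega> * t) \<epsilon> \<and> y' t = h' (x t) (x' t) (\<Omega> * t) \<epsilon>))))"

text \<open>The first equation of motion with the graph substituted, as a relation between
  \<open>x\<close>, its velocity \<open>v\<close>, its acceleration \<open>a\<close> and the phase.\<close>

definition ssm_reduced_model ::
  "real \<Rightarrow> real \<Rightarrow> real \<Rightarrow> (real \<Rightarrow> real \<Rightarrow> real^'n \<Rightarrow> real^'n \<Rightarrow> real) \<Rightarrow> real \<Rightarrow>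
   (real \<Rightarrow> real \<Rightarrow> real \<Rightarrow> real \<Rightarrow> real^'n) \<Rightarrow> (real \<Rightarrow> real \<Rightarrow> real \<Rightarrow> real \<Rightarrow> real^'n) \<Rightarrow>
   real \<Rightarrow> real \<Rightarrow> real \<Rightarrow> real \<Rightarrow> real \<Rightarrow> bool" where
  "ssm_reduced_model m c k P F1 h h' x v a \<phi> \<epsilon> \<longleftrightarrow>
     m * a + c * v + k * x + P x v (h x v \<phi> \<epsilon>) (h' x v \<phi> \<epsilon>) = \<epsilon> * F1 * sin \<phi>"

text \<open>Limit \<open>(x, v) \<rightarrow> 0\<close> and \<open>\<epsilon> \<rightarrow> 0+\<close> independently, uniformly in the phase.\<close>

definition small_filter :: "((real \<times> real) \<times> real \<times> real) filter" where
  "small_filter = nhds (0, 0) \<times>\<^sub>F (principal UNIV \<times>\<^sub>F at_right 0)"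

definition ssm_remainder :: "(real \<Rightarrow> real \<Rightarrow> real \<Rightarrow> real \<Rightarrow> real) \<Rightarrow> bool" where
  "ssm_remainder R \<longleftrightarrow>
     (\<exists>R1 R2 R3.
        (\<forall>x v \<phi> \<epsilon>. R x v \<phi> \<epsilon> = R1 ((x, v), \<phi>, \<epsilon>) + R2 ((x, v), \<phi>, \<epsilon>) + R3 ((x, v), \<phi>, \<epsilon>)) \<and>
        R1 \<in> O[small_filter](\<lambda>(z, \<phi>, \<epsilon>). norm z ^ 4) \<and>
        R2 \<in> O[small_filter](\<lambda>(z, \<phi>, \<epsilon>). \<epsilon> * norm z) \<and>
        R3 \<in> O[small_filter](\<lambda>(z, \<phi>, \<epsilon>). \<epsilon>\<^sup>2))"

section \<open>Coefficients of the reduced model\<close>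

definition L_matrix :: "real \<Rightarrow> real \<Rightarrow> real \<Rightarrow> real \<Rightarrow> real^3^3" where
  "L_matrix \<omega> \<zeta> \<omega>i \<zeta>i = vector [
     vector [2 * \<omega>\<^sup>2 - \<omega>i\<^sup>2,
             4 * \<omega>\<^sup>2 * (\<zeta>i * \<omega>i - \<zeta> * \<omega>),
             - 2 * \<omega> ^ 4],
     vector [2 * (\<zeta> * \<omega> - \<zeta>i * \<omega>i),
             4 * \<zeta>i * \<omega>i * \<zeta> * \<omega> - 4 * \<omega>\<^sup>2 * (\<zeta>\<^sup>2 - 1) - \<omega>i\<^sup>2,
             2 * \<zeta>i * \<omega>i * \<omega>\<^sup>2 - 6 * \<zeta> * \<omega> ^ 3],
     vector [- 2,
             4 * (3 * \<zeta> * \<omega> - \<zeta>i * \<omega>i),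
             2 * \<omega>\<^sup>2 - \<omega>i\<^sup>2 + 8 * \<zeta>i * \<omega>i * \<zeta> * \<omega> - 16 * (\<zeta> * \<omega>)\<^sup>2]]"

definition W_matrix :: "real^'n \<Rightarrow> real^'n \<Rightarrow> real^'n \<Rightarrow> real^4^'n" where
  "W_matrix a b c = transpose (vector [a, b, b, c])"

definition tensor_square :: "real \<Rightarrow> real \<Rightarrow> real^4" where
  "tensor_square x v = vector [x\<^sup>2, x * v, v * x, v\<^sup>2]"

end

theory Submission
  imports Defs
begin

text \<open>At \<open>\<epsilon> = 0\<close> the graph \<open>(h, h')\<close> has an expansion in \<open>(x, v)\<close> that starts with a quadratic form
  whose coefficients may a priori depend on the phase \<open>\<phi>\<close>.  Everything rests on showing that
  invariance forces this form to be the one given by \<open>W\<close> and \<open>W~\<close>, independently of \<open>\<phi>\<close>; analyticity in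
  \<open>\<epsilon>\<close> then costs an error \<open>O(\<epsilon>)\<close> in the graph, and substituting the graph into \<open>P\<close>, where it occurs
  with at least one further small factor, turns the errors \<open>O(|(x, v)|\<^sup>3) + O(\<epsilon>)\<close> into the remainder of
  the reduced model.

  Let \<open>\<eta>\<close> and \<open>\<eta>~\<close> be the \<open>i\<close>-th modal coordinates of \<open>h\<close> and \<open>h'\<close>, and let \<open>r1, r2\<close> be the roots of
  \<open>r\<^sup>2 + 2 \<zeta>i \<omega>i r + \<omega>i\<^sup>2\<close>.  The second order modal equation splits into
  two scalar equations of first order along trajectories: \<open>\<gamma> = \<eta>~ - r1 \<eta>\<close> satisfies \<open>\<gamma>' = r2 \<gamma> - S\<close>, and
  \<open>\<eta>' = r1 \<eta> + \<gamma>\<close>.  With \<open>S\<close> replaced by its quadratic part, both are solved along the linear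
  slow flow by the quadratic forms \<open>B\<close> that the formulas for \<open>W\<close> predict (\<open>modal_factorization\<close>).
  If \<open>D\<close> denotes the difference between the actual quadratic part and \<open>B\<close>, then \<open>exp (- r t) D\<close> is constant along the linear slow flow
  with advancing phase.  Since \<open>D\<close> is bounded by a multiple of the squared amplitude, uniformly in the phase, and
  the amplitude behaves like \<open>exp (\<alpha> t)\<close> with \<open>\<alpha> = Re lx1\<close>, letting \<open>t\<close> tend to \<open>\<infinity>\<close> or
  \<open>- \<infinity>\<close> gives \<open>D = 0\<close> unless \<open>Re r = 2 \<alpha>\<close> (\<open>resonance_free_form_eq_0\<close>).  The excluded case is a
  resonance of order two, which the hypotheses forbid (\<open>no_low_order_resonance\<close>); the same condition makes the matrices
  \<open>L\<close> invertible, because a kernel vector would give a nonzero quadratic form that the linear slow flow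
  multiplies by \<open>exp (r t)\<close> (\<open>L_matrix_invertible\<close>).

  The nonlinear flow is not studied.  The graph is followed along the linear flow
  instead, which separates from the true trajectory through the same point at a rate of second order in the amplitude; as the
  graph has a Lipschitz constant of first order in the amplitude (it is tangent to the slow subspace),
  the error made is of third order (\<open>graph_closeness\<close>).  The scaling \<open>(x, v) \<mapsto> (s x, s v)\<close> with \<open>s \<rightarrow> 0\<close>
  removes it from the quadratic part (\<open>invariant_quadratic_part\<close>).\<close>

section \<open>Uniform quadratic jets of analytic periodic functions\<close>

text \<open>The sum norm is equivalent to the Euclidean one and bounds monomials of degree \<open>n\<close> directly by
  its \<open>n\<close>-th power.\<close>

abbreviation amp :: "real \<Rightarrow> real \<Rightarrow> real" where
  "amp x v \<equiv> \<bar>x\<bar> + \<bar>v\<bar>"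

text \<open>Vector coefficients cover both the real forms of the model and the complex ones that arise when a
  modal equation is factorized.\<close>

definition qform :: "'b::real_vector \<Rightarrow> 'b \<Rightarrow> 'b \<Rightarrow> real \<Rightarrow> real \<Rightarrow> 'b" where
  "qform a b c x v = x\<^sup>2 *\<^sub>R a + (x * v) *\<^sub>R b + v\<^sup>2 *\<^sub>R c"

lemma power_diff_bound:
  fixes x y s :: real
  assumes "\<bar>x\<bar> \<le> s" "\<bar>y\<bar> \<le> s"
  shows "s * \<bar>x ^ n - y ^ n\<bar> \<le> real n * s ^ n * \<bar>x - y\<bar>"
proof (induction n)
  case (Suc n)
  have s: "0 \<le> s" using assms(1) by linarith
  have "x ^ Suc n - y ^ Suc n = x * (x ^ n - y ^ n) + (x - y) * y ^ n"
    by (simp add: algebra_simps)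
  hence "s * \<bar>x ^ Suc n - y ^ Suc n\<bar> \<le> s * (\<bar>x\<bar> * \<bar>x ^ n - y ^ n\<bar> + \<bar>x - y\<bar> * \<bar>y\<bar> ^ n)"
    using s abs_triangle_ineq[of "x * (x ^ n - y ^ n)" "(x - y) * y ^ n"]
    by (intro mult_left_mono) (auto simp: abs_mult power_abs)
  also have "\<dots> = \<bar>x\<bar> * (s * \<bar>x ^ n - y ^ n\<bar>) + s * \<bar>x - y\<bar> * \<bar>y\<bar> ^ n"
    by (simp add: algebra_simps)
  also have "\<dots> \<le> s * (real n * s ^ n * \<bar>x - y\<bar>) + s * \<bar>x - y\<bar> * s ^ n"
    using s power_mono[OF assms(2), of n]
    by (intro add_mono mult_mono[OF assms(1) Suc.IH] mult_left_mono) auto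
  finally show ?case by (simp add: algebra_simps)
qed simp

lemma monomial_diff_bound:
  fixes x v x' v' s :: real
  assumes "\<bar>x\<bar> \<le> s" "\<bar>v\<bar> \<le> s" "\<bar>x'\<bar> \<le> s" "\<bar>v'\<bar> \<le> s"
  shows "s * \<bar>x ^ i * v ^ j - x' ^ i * v' ^ j\<bar> \<le> real (i + j) * s ^ (i + j) * amp (x - x') (v - v')"
proof -
  have s: "0 \<le> s" using assms(1) by linarith
  have "x ^ i * v ^ j - x' ^ i * v' ^ j = (x ^ i - x' ^ i) * v ^ j + x' ^ i * (v ^ j - v' ^ j)"
    by (simp add: algebra_simps)
  hence "s * \<bar>x ^ i * v ^ j - x' ^ i * v' ^ j\<bar>
      \<le> s * (\<bar>x ^ i - x' ^ i\<bar> * \<bar>v\<bar> ^ j + \<bar>x'\<bar> ^ i * \<bar>v ^ j - v' ^ j\<bar>)"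
    using s abs_triangle_ineq[of "(x ^ i - x' ^ i) * v ^ j" "x' ^ i * (v ^ j - v' ^ j)"]
    by (intro mult_left_mono) (auto simp: abs_mult power_abs)
  also have "\<dots> = (s * \<bar>x ^ i - x' ^ i\<bar>) * \<bar>v\<bar> ^ j + \<bar>x'\<bar> ^ i * (s * \<bar>v ^ j - v' ^ j\<bar>)"
    by (simp add: algebra_simps)
  also have "\<dots> \<le> (real i * s ^ i * \<bar>x - x'\<bar>) * s ^ j + s ^ i * (real j * s ^ j * \<bar>v - v'\<bar>)"
    using assms s by (intro add_mono mult_mono power_mono power_diff_bound) auto
  also have "\<dots> = s ^ (i + j) * (real i * \<bar>x - x'\<bar> + real j * \<bar>v - v'\<bar>)"
    by (simp add: algebra_simps power_add)
  also have "\<dots> \<le> s ^ (i + j) * (real (i + j) * \<bar>x - x'\<bar> + real (i + j) * \<bar>v - v'\<bar>)"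
    using s by (intro mult_left_mono add_mono mult_right_mono) auto
  finally show ?thesis by (simp add: algebra_simps)
qed

text \<open>Halving the radius absorbs the factor \<open>n\<close> that differentiation of \<open>s\<^sup>n\<close> produces, as \<open>n \<le> 2\<^sup>n\<close>.\<close>

lemma real_times_power_bound:
  fixes s \<rho> :: real
  assumes "0 \<le> s" "s \<le> \<rho> / 2" "0 < \<rho>" "3 \<le> n"
  shows "real n * s ^ n \<le> s ^ 3 * (8 / \<rho> ^ 3) * \<rho> ^ n"
proof -
  obtain d where n: "n = d + 3" using assms(4) by (metis add.commute le_Suc_ex)
  have "real n \<le> 2 ^ n" using of_nat_less_two_power[of n, where 'a = real] by linarith
  hence "real n * s ^ n \<le> 2 ^ n * s ^ n" using assms by (intro mult_right_mono) auto
  also have "\<dots> = s ^ 3 * 8 * (2 * s) ^ d"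
    by (simp add: n power_add power_mult_distrib)
  also have "\<dots> \<le> s ^ 3 * 8 * \<rho> ^ d"
    using assms by (intro mult_left_mono power_mono) auto
  also have "\<dots> = s ^ 3 * (8 / \<rho> ^ 3) * \<rho> ^ n"
    using assms by (simp add: n power_add)
  finally show ?thesis .
qed

lemma infsum_dominated:
  fixes g M :: "'a \<Rightarrow> real"
  assumes "M summable_on UNIV" "\<And>\<alpha>. 0 \<le> M \<alpha>" "0 \<le> \<kappa>" "\<And>\<alpha>. \<alpha> \<in> A \<Longrightarrow> \<bar>g \<alpha>\<bar> \<le> \<kappa> * M \<alpha>"
  shows "g summable_on A" "\<bar>infsum g A\<bar> \<le> \<kappa> * infsum M UNIV"
proof -
  have M: "M summable_on A" using assms(1) summable_on_subset_banach by blast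
  hence \<kappa>M: "(\<lambda>\<alpha>. \<kappa> * M \<alpha>) summable_on A" by (rule summable_on_cmult_right)
  have "(\<lambda>\<alpha>. norm (\<kappa> * M \<alpha>)) = (\<lambda>\<alpha>. \<kappa> * M \<alpha>)" using assms(2,3) by (simp add: fun_eq_iff)
  hence "(\<lambda>\<alpha>. norm (\<kappa> * M \<alpha>)) summable_on A" using \<kappa>M by simp
  hence ga: "(\<lambda>\<alpha>. norm (g \<alpha>)) summable_on A"
    by (rule Infinite_Sum.abs_summable_on_comparison_test)
      (use assms order_trans[OF assms(4) abs_ge_self] in auto)
  thus g: "g summable_on A" by (rule summable_on_iff_abs_summable_on_real[THEN iffD2])
  have "\<bar>infsum g A\<bar> \<le> infsum (\<lambda>\<alpha>. \<bar>g \<alpha>\<bar>) A"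
    using norm_infsum_bound[OF ga] by simp
  also have "\<dots> \<le> infsum (\<lambda>\<alpha>. \<kappa> * M \<alpha>) A"
    using ga \<kappa>M assms(4) by (intro infsum_mono) auto
  also have "\<dots> = \<kappa> * infsum M A" by (rule infsum_cmult_right')
  also have "\<dots> \<le> \<kappa> * infsum M UNIV"
    using assms M by (intro mult_left_mono infsum_mono2) auto
  finally show "\<bar>infsum g A\<bar> \<le> \<kappa> * infsum M UNIV" .
qed

lemma has_sum_difference:
  fixes f g :: "'a \<Rightarrow> real"
  assumes "(f has_sum a) X" "(g has_sum b) X"
  shows "((\<lambda>\<alpha>. f \<alpha> - g \<alpha>) has_sum (a - b)) X"
  using has_sum_add[OF assms(1) has_sum_cmult_right[OF assms(2), of "-1"]] by simp

lemma power_zero_diff_bound: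
  fixes e \<rho> :: real
  assumes "\<bar>e\<bar> \<le> \<rho>" "0 < \<rho>"
  shows "\<bar>e ^ l - 0 ^ l\<bar> \<le> \<bar>e\<bar> / \<rho> * \<rho> ^ l"
proof (cases l)
  case (Suc d)
  have "\<bar>e\<bar> * \<bar>e\<bar> ^ d \<le> \<bar>e\<bar> * \<rho> ^ d" using assms by (intro mult_left_mono power_mono) auto
  thus ?thesis using Suc assms by (simp add: abs_mult power_abs)
qed (use assms in simp)

text \<open>The increment form of a cubic estimate.  For functions that vanish at the origin it contains the size
  estimate, and it also provides the small Lipschitz constant that is needed to compare nearby trajectories; this is
  how derivatives of power series are avoided.\<close>

definition cubic_remainder :: "(real \<Rightarrow> real \<Rightarrow> real) \<Rightarrow> real \<Rightarrow> real \<Rightarrow> bool" where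
  "cubic_remainder g C \<rho> \<longleftrightarrow> (\<forall>s x v x' v'. amp x v \<le> s \<longrightarrow> amp x' v' \<le> s \<longrightarrow> s \<le> \<rho> \<longrightarrow>
     \<bar>g x v - g x' v'\<bar> \<le> C * s\<^sup>2 * amp (x - x') (v - v'))"

definition forcing_lipschitz :: "(real \<Rightarrow> real \<Rightarrow> real \<Rightarrow> real \<Rightarrow> real) \<Rightarrow> real \<Rightarrow> real \<Rightarrow> real \<Rightarrow> bool" where
  "forcing_lipschitz f \<phi> C \<rho> \<longleftrightarrow> (\<forall>x v \<epsilon>. amp x v \<le> \<rho> \<longrightarrow> \<bar>\<epsilon>\<bar> \<le> \<rho> \<longrightarrow>
     \<bar>f x v \<phi> \<epsilon> - f x v \<phi> 0\<bar> \<le> C * \<bar>\<epsilon>\<bar>)"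

text \<open>Split the power series by the degree in \<open>(x, v)\<close>: the terms of degree at most 2 give a
  polynomial with coefficients depending on \<open>\<phi>\<close>, and the increment of each remaining monomial is dominated by a
  multiple of its value on the diagonal point \<open>\<rho>\<close>, where the series converges
  absolutely.\<close>

lemma analytic_local_jet:
  fixes f :: "real \<Rightarrow> real \<Rightarrow> real \<Rightarrow> real \<Rightarrow> real"
  assumes "real_analytic4_at f 0 0 \<phi>0 0"
  shows "\<exists>C \<rho>. 0 \<le> C \<and> 0 < \<rho> \<and> (\<forall>\<phi>. \<bar>\<phi> - \<phi>0\<bar> \<le> \<rho> \<longrightarrow> forcing_lipschitz f \<phi> C \<rho> \<and>
    (\<exists>c1 c2 a b c. \<bar>a\<bar> \<le> C \<and> \<bar>b\<bar> \<le> C \<and> \<bar>c\<bar> \<le> C \<and>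
      cubic_remainder (\<lambda>x v. f x v \<phi> 0 - (f 0 0 \<phi> 0 + c1 * x + c2 * v + qform a b c x v)) C \<rho>))"
proof -
  obtain r A where r: "r > 0" and A0: "\<And>x v \<phi> \<epsilon>. \<bar>x\<bar> < r \<Longrightarrow> \<bar>v\<bar> < r \<Longrightarrow> \<bar>\<phi> - \<phi>0\<bar> < r \<Longrightarrow> \<bar>\<epsilon>\<bar> < r \<Longrightarrow>
        ((\<lambda>(i, j, k, l). (x ^ i * v ^ j * (\<phi> - \<phi>0) ^ k * \<epsilon> ^ l) *\<^sub>R A i j k l)
          has_sum f x v \<phi> \<epsilon>) UNIV"
    using assms unfolding real_analytic4_at_def by (fastforce simp: diff_0_right)
  (* The series is only known to converge inside radius r, so majorants are taken at half of it. *)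
  define \<rho> where "\<rho> = r / 2"
  have \<rho>: "0 < \<rho>" "\<rho> < r" using r by (auto simp: \<rho>_def)
  define T where "T x v \<psi> \<epsilon> = (\<lambda>(i, j, k, l). x ^ i * v ^ j * \<psi> ^ k * \<epsilon> ^ l * A i j k l)"
    for x v \<psi> \<epsilon> :: real
  (* Summable majorant: the absolute series at the point with all coordinates equal to \<rho>. *)
  define M where "M = (\<lambda>(i, j, k, l). \<rho> ^ (i + j + k + l) * \<bar>A i j k l\<bar>)"
  have A: "(T x v (\<phi> - \<phi>0) \<epsilon> has_sum f x v \<phi> \<epsilon>) UNIV"
    if "\<bar>x\<bar> \<le> \<rho>" "\<bar>v\<bar> \<le> \<rho>" "\<bar>\<phi> - \<phi>0\<bar> \<le> \<rho>" "\<bar>\<epsilon>\<bar> \<le> \<rho>" for x v \<phi> \<epsilon>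
    using A0[of x v \<phi> \<epsilon>] that \<rho> by (simp add: T_def case_prod_unfold)
  have M0: "0 \<le> M \<alpha>" for \<alpha> using \<rho> by (auto simp: M_def split: prod.splits)
  have Msum: "M summable_on UNIV"
  proof -
    have "(\<lambda>\<alpha>. norm (T \<rho> \<rho> \<rho> \<rho> \<alpha>)) summable_on UNIV"
      using A[of \<rho> \<rho> "\<phi>0 + \<rho>" \<rho>] \<rho> has_sum_imp_summable summable_on_iff_abs_summable_on_real
      by fastforce
    moreover have "(\<lambda>\<alpha>. norm (T \<rho> \<rho> \<rho> \<rho> \<alpha>)) = M"
      using \<rho> by (auto simp: T_def M_def abs_mult power_add)
    ultimately show ?thesis by simp
  qed
  define S where "S = infsum M UNIV"
  have S: "0 \<le> S" unfolding S_def using M0 by (simp add: infsum_nonneg)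
  note dom = infsum_dominated[OF Msum M0, folded S_def]
  (* Indices of the monomials x^i v^j, with all powers of phase and forcing amplitude. *)
  define B where "B i j = {\<alpha> :: nat \<times> nat \<times> nat \<times> nat. fst \<alpha> = i \<and> fst (snd \<alpha>) = j}" for i j
  define H where "H = {\<alpha> :: nat \<times> nat \<times> nat \<times> nat. 3 \<le> fst \<alpha> + fst (snd \<alpha>)}"
  define C where "C = max (S / \<rho>\<^sup>2) (max (8 / \<rho> ^ 3 * S) (S / \<rho>))"
  have C: "S / \<rho>\<^sup>2 \<le> C" "8 / \<rho> ^ 3 * S \<le> C" "S / \<rho> \<le> C" "0 \<le> C"
    using S \<rho> by (auto simp: C_def le_max_iff_disj)
  have *: "forcing_lipschitz f \<phi> C (\<rho> / 2) \<and>
    (\<exists>c1 c2 a b c. \<bar>a\<bar> \<le> C \<and> \<bar>b\<bar> \<le> C \<and> \<bar>c\<bar> \<le> C \<and>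
      cubic_remainder (\<lambda>x v. f x v \<phi> 0 - (f 0 0 \<phi> 0 + c1 * x + c2 * v + qform a b c x v)) C (\<rho> / 2))"
    if \<phi>: "\<bar>\<phi> - \<phi>0\<bar> \<le> \<rho> / 2" for \<phi>
  proof -
    define \<psi> where "\<psi> = \<phi> - \<phi>0"
    have \<psi>: "\<bar>\<psi>\<bar> \<le> \<rho>" using \<phi> \<rho> by (simp add: \<psi>_def)
    define N where "N = (\<lambda>(i :: nat, j :: nat, k, l). \<psi> ^ k * 0 ^ l * A i j k l)"
    define cf where "cf i j = infsum N (B i j)" for i j
    have Nb: "\<bar>N (i, j, k, l)\<bar> \<le> 1 / \<rho> ^ (i + j) * M (i, j, k, l)" for i j k l
    proof -
      have "\<bar>\<psi>\<bar> ^ k * 0 ^ l * \<bar>A i j k l\<bar> \<le> \<rho> ^ k * \<rho> ^ l * \<bar>A i j k l\<bar>"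
        using \<psi> \<rho> by (intro mult_mono power_mono) auto
      thus ?thesis using \<rho> by (simp add: N_def M_def abs_mult power_abs power_add)
    qed
    have cfb: "\<bar>cf i j\<bar> \<le> 1 / \<rho> ^ (i + j) * S" for i j
      unfolding cf_def using Nb \<rho> by (intro dom(2)) (auto simp: B_def)
    have TN: "T x v \<psi> 0 (i, j, k, l) = x ^ i * v ^ j * N (i, j, k, l)" for x v i j k l
      by (simp add: T_def N_def)
    have fsum: "f x v \<phi> 0 = (cf 0 0 + cf 1 0 * x + cf 0 1 * v + qform (cf 2 0) (cf 1 1) (cf 0 2) x v)
        + infsum (T x v \<psi> 0) H" and Tsum: "T x v \<psi> 0 summable_on UNIV"
      if "amp x v \<le> \<rho> / 2" for x v
    proof -
      let ?I = "infsum (T x v \<psi> 0)"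
      have hs: "(T x v \<psi> 0 has_sum f x v \<phi> 0) UNIV"
        unfolding \<psi>_def using that \<phi> \<rho> by (intro A) auto
      thus s: "T x v \<psi> 0 summable_on UNIV" by (rule has_sum_imp_summable)
      hence sA: "T x v \<psi> 0 summable_on X" for X using summable_on_subset_banach by blast
      have "?I (B i j) = infsum (\<lambda>\<alpha>. (x ^ i * v ^ j) * N \<alpha>) (B i j)" for i j
        by (rule infsum_cong) (auto simp: B_def TN)
      hence b: "?I (B i j) = x ^ i * v ^ j * cf i j" for i j
        by (simp add: cf_def infsum_cmult_right')
      have U: "UNIV = B 0 0 \<union> (B 1 0 \<union> (B 0 1 \<union> (B 2 0 \<union> (B 1 1 \<union> (B 0 2 \<union> H)))))"
        (is "_ = _ \<union> ?R1") by (auto simp: B_def H_def)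
      have split: "?I (X \<union> Y) = ?I X + ?I Y"
        if "X \<inter> Y = {}" for X Y by (rule infsum_Un_disjoint[OF sA sA that])
      have BB: "B i j \<inter> B i' j' = {}" if "i \<noteq> i' \<or> j \<noteq> j'" for i j i' j'
        using that by (auto simp: B_def)
      have BH: "B i j \<inter> H = {}" if "i + j \<le> 2" for i j using that by (auto simp: B_def H_def)
      have "f x v \<phi> 0 = ?I UNIV" using hs by (simp add: infsumI)
      also have "\<dots> = ?I (B 0 0) + (?I (B 1 0) +
          (?I (B 0 1) + (?I (B 2 0) +
          (?I (B 1 1) + (?I (B 0 2) + ?I H)))))"
        by (simp add: U split BB BH Int_Un_distrib)
      finally show "f x v \<phi> 0 = (cf 0 0 + cf 1 0 * x + cf 0 1 * v
          + qform (cf 2 0) (cf 1 1) (cf 0 2) x v) + ?I H"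
        by (simp add: b qform_def algebra_simps)
    qed
    have high: "\<bar>infsum (T x v \<psi> 0) H - infsum (T x' v' \<psi> 0) H\<bar> \<le> C * s\<^sup>2 * amp (x - x') (v - v')"
      if le: "amp x v \<le> s" "amp x' v' \<le> s" "s \<le> \<rho> / 2" for s x v x' v'
    proof (cases "s = 0")
      case True
      hence "x = 0" "v = 0" "x' = 0" "v' = 0" using le by linarith+
      thus ?thesis by simp
    next
      case False
      hence s: "0 < s" using le by linarith
      define \<kappa> where "\<kappa> = s\<^sup>2 * (8 / \<rho> ^ 3) * amp (x - x') (v - v')"
      have "\<bar>T x v \<psi> 0 (i, j, k, l) - T x' v' \<psi> 0 (i, j, k, l)\<bar> \<le> \<kappa> * M (i, j, k, l)"
        if ij: "3 \<le> i + j" for i j k l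
      proof -
        have "s * \<bar>x ^ i * v ^ j - x' ^ i * v' ^ j\<bar>
            \<le> real (i + j) * s ^ (i + j) * amp (x - x') (v - v')"
          using le by (intro monomial_diff_bound) auto
        also have "\<dots> \<le> (s ^ 3 * (8 / \<rho> ^ 3) * \<rho> ^ (i + j)) * amp (x - x') (v - v')"
          using le s \<rho> ij by (intro mult_right_mono real_times_power_bound) auto
        also have "\<dots> = s * (\<kappa> * \<rho> ^ (i + j))"
          by (simp add: \<kappa>_def power3_eq_cube power2_eq_square)
        finally have d: "\<bar>x ^ i * v ^ j - x' ^ i * v' ^ j\<bar> \<le> \<kappa> * \<rho> ^ (i + j)"
          using s by simp
        have "T x v \<psi> 0 (i, j, k, l) - T x' v' \<psi> 0 (i, j, k, l)
            = (x ^ i * v ^ j - x' ^ i * v' ^ j) * N (i, j, k, l)"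
          by (simp add: TN left_diff_distrib)
        hence "\<bar>T x v \<psi> 0 (i, j, k, l) - T x' v' \<psi> 0 (i, j, k, l)\<bar>
            = \<bar>x ^ i * v ^ j - x' ^ i * v' ^ j\<bar> * \<bar>N (i, j, k, l)\<bar>"
          by (simp add: abs_mult)
        also have "\<dots> \<le> (\<kappa> * \<rho> ^ (i + j)) * (1 / \<rho> ^ (i + j) * M (i, j, k, l))"
          by (rule mult_mono[OF d Nb order_trans[OF abs_ge_zero d] abs_ge_zero])
        finally show ?thesis using \<rho> by simp
      qed
      hence "\<bar>infsum (\<lambda>\<alpha>. T x v \<psi> 0 \<alpha> - T x' v' \<psi> 0 \<alpha>) H\<bar> \<le> \<kappa> * S"
        by (intro dom(2)) (use \<rho> in \<open>auto simp: H_def \<kappa>_def\<close>)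
      also have "infsum (\<lambda>\<alpha>. T x v \<psi> 0 \<alpha> - T x' v' \<psi> 0 \<alpha>) H
          = infsum (T x v \<psi> 0) H - infsum (T x' v' \<psi> 0) H"
        using le by (intro infsumI has_sum_difference has_sum_infsum summable_on_subset_banach[OF Tsum]) auto
      also have "\<kappa> * S = (8 / \<rho> ^ 3 * S) * s\<^sup>2 * amp (x - x') (v - v')"
        by (simp add: \<kappa>_def)
      also have "\<dots> \<le> C * s\<^sup>2 * amp (x - x') (v - v')"
        using C by (intro mult_right_mono) auto
      finally show ?thesis .
    qed
    have eps: "\<bar>f x v \<phi> \<epsilon> - f x v \<phi> 0\<bar> \<le> C * \<bar>\<epsilon>\<bar>" if le: "amp x v \<le> \<rho> / 2" "\<bar>\<epsilon>\<bar> \<le> \<rho> / 2" for x v \<epsilon>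
    proof -
      have hs: "(T x v \<psi> \<epsilon> has_sum f x v \<phi> \<epsilon>) UNIV" "(T x v \<psi> 0 has_sum f x v \<phi> 0) UNIV"
        unfolding \<psi>_def using le \<phi> \<rho> by (auto intro!: A)
      have "\<bar>T x v \<psi> \<epsilon> (i, j, k, l) - T x v \<psi> 0 (i, j, k, l)\<bar> \<le> \<bar>\<epsilon>\<bar> / \<rho> * M (i, j, k, l)" for i j k l
      proof -
        have "T x v \<psi> \<epsilon> (i, j, k, l) - T x v \<psi> 0 (i, j, k, l)
            = (x ^ i * v ^ j * \<psi> ^ k) * ((\<epsilon> ^ l - 0 ^ l) * A i j k l)"
          by (simp add: T_def algebra_simps)
        hence "\<bar>T x v \<psi> \<epsilon> (i, j, k, l) - T x v \<psi> 0 (i, j, k, l)\<bar>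
            = (\<bar>x\<bar> ^ i * \<bar>v\<bar> ^ j * \<bar>\<psi>\<bar> ^ k) * (\<bar>\<epsilon> ^ l - 0 ^ l\<bar> * \<bar>A i j k l\<bar>)"
          by (simp add: abs_mult power_abs)
        also have "\<dots> \<le> (\<rho> ^ i * \<rho> ^ j * \<rho> ^ k) * ((\<bar>\<epsilon>\<bar> / \<rho> * \<rho> ^ l) * \<bar>A i j k l\<bar>)"
          using le \<rho> \<psi> by (intro mult_mono power_mono power_zero_diff_bound) auto
        finally show ?thesis by (simp add: M_def power_add mult_ac)
      qed
      hence "\<bar>infsum (\<lambda>\<alpha>. T x v \<psi> \<epsilon> \<alpha> - T x v \<psi> 0 \<alpha>) UNIV\<bar> \<le> \<bar>\<epsilon>\<bar> / \<rho> * S"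
        using \<rho> by (intro dom(2)) auto
      also have "infsum (\<lambda>\<alpha>. T x v \<psi> \<epsilon> \<alpha> - T x v \<psi> 0 \<alpha>) UNIV = f x v \<phi> \<epsilon> - f x v \<phi> 0"
        using has_sum_difference[OF hs] by (rule infsumI)
      also have "\<bar>\<epsilon>\<bar> / \<rho> * S = (S / \<rho>) * \<bar>\<epsilon>\<bar>" by simp
      also have "\<dots> \<le> C * \<bar>\<epsilon>\<bar>" using C by (intro mult_right_mono) auto
      finally show ?thesis .
    qed
    have z: "f 0 0 \<phi> 0 = cf 0 0"
    proof -
      have "infsum (T 0 0 \<psi> 0) H = 0"
        by (rule infsum_0) (auto simp: H_def T_def power_0_left)
      thus ?thesis using fsum[of 0 0] \<rho> by (simp add: qform_def)
    qed
    have "S / \<rho>\<^sup>2 = 1 / \<rho> ^ 2 * S" by simp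
    hence c2: "\<bar>cf i j\<bar> \<le> C" if "i + j = 2" for i j
      using cfb[of i j] C(1) that by simp
    show ?thesis
    proof (intro conjI exI)
      show "forcing_lipschitz f \<phi> C (\<rho> / 2)" using eps by (simp add: forcing_lipschitz_def)
      show "cubic_remainder (\<lambda>x v. f x v \<phi> 0
          - (f 0 0 \<phi> 0 + cf 1 0 * x + cf 0 1 * v + qform (cf 2 0) (cf 1 1) (cf 0 2) x v)) C (\<rho> / 2)"
        unfolding cubic_remainder_def
      proof (intro allI impI)
        fix s x v x' v' assume le: "amp x v \<le> s" "amp x' v' \<le> s" "s \<le> \<rho> / 2"
        show "\<bar>f x v \<phi> 0 - (f 0 0 \<phi> 0 + cf 1 0 * x + cf 0 1 * v + qform (cf 2 0) (cf 1 1) (cf 0 2) x v) -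
            (f x' v' \<phi> 0 - (f 0 0 \<phi> 0 + cf 1 0 * x' + cf 0 1 * v' + qform (cf 2 0) (cf 1 1) (cf 0 2) x' v'))\<bar>
            \<le> C * s\<^sup>2 * amp (x - x') (v - v')"
          using high[OF le] fsum[of x v] fsum[of x' v'] le by (simp add: z)
      qed
    qed (use c2 in auto)
  qed
  show ?thesis
    by (rule exI[of _ C], rule exI[of _ "\<rho> / 2"]) (use * C(4) \<rho> in auto)
qed

text \<open>What tangency to the slow subspace leaves of the expansion at a fixed phase; the constants \<open>C\<close> and \<open>\<rho>\<close>
  are parameters so that uniformity in \<open>\<phi>\<close> can be expressed.\<close>

definition quad_jet :: "(real \<Rightarrow> real \<Rightarrow> real \<Rightarrow> real \<Rightarrow> real) \<Rightarrow> real \<Rightarrow> real \<Rightarrow> real \<Rightarrow> bool" where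
  "quad_jet f \<phi> C \<rho> \<longleftrightarrow> f 0 0 \<phi> 0 = 0 \<and> forcing_lipschitz f \<phi> C \<rho> \<and>
     (\<exists>a b c. \<bar>a\<bar> \<le> C \<and> \<bar>b\<bar> \<le> C \<and> \<bar>c\<bar> \<le> C \<and> cubic_remainder (\<lambda>x v. f x v \<phi> 0 - qform a b c x v) C \<rho>)"

lemma quad_jet_mono:
  assumes "quad_jet f \<phi> C \<rho>" "C \<le> C'" "\<rho>' \<le> \<rho>"
  shows "quad_jet f \<phi> C' \<rho>'"
proof -
  have C: "C * s\<^sup>2 * amp (x - x') (v - v') \<le> C' * s\<^sup>2 * amp (x - x') (v - v')" "C * \<bar>\<epsilon>\<bar> \<le> C' * \<bar>\<epsilon>\<bar>"
    for s x v x' v' \<epsilon> :: real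
    using assms(2) by (auto intro!: mult_right_mono)
  have "cubic_remainder g C' \<rho>'" if "cubic_remainder g C \<rho>" for g
    using that assms(3) order_trans[OF _ C(1)] unfolding cubic_remainder_def by (meson order_trans)
  moreover have "forcing_lipschitz f \<phi> C' \<rho>'" if "forcing_lipschitz f \<phi> C \<rho>"
    using that assms(3) order_trans[OF _ C(2)] unfolding forcing_lipschitz_def by (meson order_trans)
  ultimately show ?thesis using assms unfolding quad_jet_def by (meson order_trans)
qed

lemma linear_coefficient_eq_0:
  fixes g :: "real \<Rightarrow> real"
  assumes g: "(g has_real_derivative 0) (at 0)" "g 0 = 0"
    and \<rho>: "0 < \<rho>" and le: "\<And>x. \<bar>x\<bar> \<le> \<rho> \<Longrightarrow> \<bar>g x - c * x\<bar> \<le> K * x\<^sup>2"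
  shows "c = 0"
proof -
  have "((\<lambda>h. g h / h - c) \<longlongrightarrow> 0) (at 0)"
  proof (rule Lim_null_comparison[where g = "\<lambda>h. K * \<bar>h\<bar>"])
    have "\<forall>\<^sub>F h in at 0. h \<noteq> 0 \<and> \<bar>h\<bar> \<le> \<rho>"
      unfolding eventually_at using \<rho> by (intro exI[of _ \<rho>]) auto
    thus "\<forall>\<^sub>F h in at 0. norm (g h / h - c) \<le> K * \<bar>h\<bar>"
    proof eventually_elim
      case (elim h)
      have "norm (g h / h - c) = \<bar>g h - c * h\<bar> / \<bar>h\<bar>"
        using elim by (simp add: abs_divide[symmetric] diff_divide_distrib)
      also have "\<dots> \<le> K * h\<^sup>2 / \<bar>h\<bar>" using le elim by (intro divide_right_mono) auto
      also have "\<dots> = K * \<bar>h\<bar>"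
        using elim by (simp add: power2_eq_square field_simps abs_mult_self_eq)
      finally show ?case .
    qed
    show "((\<lambda>h. K * \<bar>h\<bar>) \<longlongrightarrow> 0) (at 0)" by (auto intro!: tendsto_eq_intros)
  qed
  hence "((\<lambda>h. g h / h) \<longlongrightarrow> c) (at 0)" by (simp add: LIM_zero_iff)
  hence "(g has_real_derivative c) (at 0)" using g(2) by (simp add: DERIV_def)
  thus ?thesis using g(1) DERIV_unique by blast
qed

lemma local_quad_jet:
  fixes f :: "real \<Rightarrow> real \<Rightarrow> real \<Rightarrow> real \<Rightarrow> real"
  assumes an: "real_analytic4_at f 0 0 \<phi>0 0"
    and zero: "\<And>\<phi>. f 0 0 \<phi> 0 = 0"
    and tangent: "\<And>\<phi>. ((\<lambda>(x, v). f x v \<phi> 0) has_derivative (\<lambda>_. 0)) (at (0, 0))"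
  shows "\<exists>C \<rho>. 0 \<le> C \<and> 0 < \<rho> \<and> (\<forall>\<phi>. \<bar>\<phi> - \<phi>0\<bar> \<le> \<rho> \<longrightarrow> quad_jet f \<phi> C \<rho>)"
proof -
  obtain C \<rho> where C: "0 \<le> C" and \<rho>: "0 < \<rho>"
    and *: "\<And>\<phi>. \<bar>\<phi> - \<phi>0\<bar> \<le> \<rho> \<Longrightarrow> forcing_lipschitz f \<phi> C \<rho> \<and>
      (\<exists>c1 c2 a b c. \<bar>a\<bar> \<le> C \<and> \<bar>b\<bar> \<le> C \<and> \<bar>c\<bar> \<le> C \<and>
      cubic_remainder (\<lambda>x v. f x v \<phi> 0 - (f 0 0 \<phi> 0 + c1 * x + c2 * v + qform a b c x v)) C \<rho>)"
    using analytic_local_jet[OF an] by blast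
  have "quad_jet f \<phi> C \<rho>" if \<phi>: "\<bar>\<phi> - \<phi>0\<bar> \<le> \<rho>" for \<phi>
  proof -
    obtain c1 c2 a b c where abc: "\<bar>a\<bar> \<le> C" "\<bar>b\<bar> \<le> C" "\<bar>c\<bar> \<le> C"
      and L: "cubic_remainder (\<lambda>x v. f x v \<phi> 0 - (f 0 0 \<phi> 0 + c1 * x + c2 * v + qform a b c x v)) C \<rho>"
      using *[OF \<phi>] by blast
    have T: "\<bar>f x v \<phi> 0 - (c1 * x + c2 * v + qform a b c x v)\<bar> \<le> C * (amp x v)\<^sup>2 * amp x v"
      if "amp x v \<le> \<rho>" for x v
      using L[unfolded cubic_remainder_def, rule_format, of x v "amp x v" 0 0] that
      by (simp add: zero qform_def)
    have cube: "C * \<bar>h\<bar>\<^sup>2 * \<bar>h\<bar> \<le> C * \<rho> * h\<^sup>2" if "\<bar>h\<bar> \<le> \<rho>" for h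
      using mult_left_mono[OF that, of "C * h\<^sup>2"] C by (simp add: mult_ac)
    have sq: "\<bar>h\<^sup>2 * y\<bar> \<le> C * h\<^sup>2" if "\<bar>y\<bar> \<le> C" for h y :: real
      using mult_left_mono[OF that, of "h\<^sup>2"] by (simp add: abs_mult mult_ac)
    have "c1 = 0"
    proof (rule linear_coefficient_eq_0[where g = "\<lambda>x. f x 0 \<phi> 0" and K = "C * \<rho> + C" and \<rho> = \<rho>])
      have "((\<lambda>x. case (x, 0) of (x, v) \<Rightarrow> f x v \<phi> 0) has_derivative (\<lambda>_. 0)) (at 0)"
        by (rule has_derivative_compose[where f = "\<lambda>x. (x, 0 :: real)", OF _ tangent])
          (auto intro!: derivative_eq_intros)
      thus "((\<lambda>x. f x 0 \<phi> 0) has_real_derivative 0) (at 0)"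
        by (simp add: has_field_derivative_def lambda_zero)
      fix h assume h: "\<bar>h\<bar> \<le> \<rho>"
      show "\<bar>f h 0 \<phi> 0 - c1 * h\<bar> \<le> (C * \<rho> + C) * h\<^sup>2"
        using T[of h 0] h cube[OF h] sq[OF abc(1), of h]
        by (simp add: qform_def distrib_right)
    qed (use zero \<rho> in auto)
    moreover have "c2 = 0"
    proof (rule linear_coefficient_eq_0[where g = "\<lambda>v. f 0 v \<phi> 0" and K = "C * \<rho> + C" and \<rho> = \<rho>])
      have "((\<lambda>v. case (0, v) of (x, v) \<Rightarrow> f x v \<phi> 0) has_derivative (\<lambda>_. 0)) (at 0)"
        by (rule has_derivative_compose[where f = "\<lambda>x. (0 :: real, x)", OF _ tangent])
          (auto intro!: derivative_eq_intros)
      thus "((\<lambda>v. f 0 v \<phi> 0) has_real_derivative 0) (at 0)"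
        by (simp add: has_field_derivative_def lambda_zero)
      fix h assume h: "\<bar>h\<bar> \<le> \<rho>"
      show "\<bar>f 0 h \<phi> 0 - c2 * h\<bar> \<le> (C * \<rho> + C) * h\<^sup>2"
        using T[of 0 h] h cube[OF h] sq[OF abc(3), of h]
        by (simp add: qform_def distrib_right)
    qed (use zero \<rho> in auto)
    ultimately show ?thesis
      unfolding quad_jet_def using abc L *[OF \<phi>] zero[of \<phi>] by (auto simp only: mult_zero_left add_0)
  qed
  thus ?thesis using C \<rho> by blast
qed

lemma periodic_int_shift:
  fixes g :: "real \<Rightarrow> 'a"
  assumes per: "\<And>\<phi>. g (\<phi> + p) = g \<phi>"
  shows "g (\<phi> + of_int k * p) = g \<phi>"
proof -
  have nat: "g (\<phi> + real n * p) = g \<phi>" for n \<phi>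
  proof (induction n)
    case (Suc n)
    have "g (\<phi> + real (Suc n) * p) = g ((\<phi> + real n * p) + p)" by (simp add: algebra_simps)
    thus ?case using per Suc by simp
  qed simp
  show ?thesis
  proof (cases "0 \<le> k")
    case True
    hence "real (nat k) = of_int k" by simp
    thus ?thesis using nat[of \<phi> "nat k"] by simp
  next
    case False
    hence "real (nat (- k)) = - of_int k" by simp
    hence "(\<phi> + of_int k * p) + real (nat (- k)) * p = \<phi>" by simp
    thus ?thesis using nat[of "\<phi> + of_int k * p" "nat (- k)"] by metis
  qed
qed

text \<open>Local constants can be merged over a compact interval of phases, and one period suffices.\<close>

lemma uniform_quad_jet:
  fixes f :: "real \<Rightarrow> real \<Rightarrow> real \<Rightarrow> real \<Rightarrow> real"
  assumes pos: "0 < \<delta>" "0 < \<epsilon>0"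
    and an: "\<And>\<phi>. real_analytic4_at f 0 0 \<phi> 0"
    and per: "\<And>x v \<phi> \<epsilon>. norm (x, v) < \<delta> \<Longrightarrow> \<bar>\<epsilon>\<bar> < \<epsilon>0 \<Longrightarrow> f x v (\<phi> + 2 * pi) \<epsilon> = f x v \<phi> \<epsilon>"
    and zero: "\<And>\<phi>. f 0 0 \<phi> 0 = 0"
    and tangent: "\<And>\<phi>. ((\<lambda>(x, v). f x v \<phi> 0) has_derivative (\<lambda>_. 0)) (at (0, 0))"
  shows "\<exists>C \<rho>. 0 \<le> C \<and> 0 < \<rho> \<and> (\<forall>\<phi>. quad_jet f \<phi> C \<rho>)"
proof -
  define P where "P a b \<longleftrightarrow> (\<exists>C \<rho>. 0 \<le> C \<and> 0 < \<rho> \<and> (\<forall>\<phi>\<in>{a..b}. quad_jet f \<phi> C \<rho>))" for a b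
  have "P 0 (2 * pi)"
  proof (rule Bolzano)
    fix a b c assume "P a b" "P b c" "a \<le> b" "b \<le> c"
    then obtain C \<rho> C' \<rho>' where 1: "0 \<le> C" "0 < \<rho>" "\<And>\<phi>. \<phi> \<in> {a..b} \<Longrightarrow> quad_jet f \<phi> C \<rho>"
      and 2: "0 \<le> C'" "0 < \<rho>'" "\<And>\<phi>. \<phi> \<in> {b..c} \<Longrightarrow> quad_jet f \<phi> C' \<rho>'"
      unfolding P_def by blast
    have "quad_jet f \<phi> (max C C') (min \<rho> \<rho>')" if "\<phi> \<in> {a..c}" for \<phi>
    proof (cases "\<phi> \<le> b")
      case True
      thus ?thesis using that by (intro quad_jet_mono[OF 1(3)]) auto
    next
      case False
      thus ?thesis using that by (intro quad_jet_mono[OF 2(3)]) auto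
    qed
    thus "P a c" unfolding P_def using 1 2
      by (intro exI[of _ "max C C'"] exI[of _ "min \<rho> \<rho>'"]) auto
  next
    fix x
    obtain C \<rho> where *: "0 \<le> C" "0 < \<rho>" "\<And>\<phi>. \<bar>\<phi> - x\<bar> \<le> \<rho> \<Longrightarrow> quad_jet f \<phi> C \<rho>"
      using local_quad_jet[OF an zero tangent] by blast
    have "P a b" if "a \<le> x" "x \<le> b" "b - a < \<rho>" for a b
    proof -
      have "quad_jet f \<phi> C \<rho>" if "\<phi> \<in> {a..b}" for \<phi>
        using \<open>a \<le> x\<close> \<open>x \<le> b\<close> \<open>b - a < \<rho>\<close> that by (intro *(3)) (simp add: abs_le_iff)
      thus ?thesis unfolding P_def using *(1,2) by blast
    qed
    thus "\<exists>d>0. \<forall>a b. a \<le> x \<and> x \<le> b \<and> b - a < d \<longrightarrow> P a b"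
      using *(2) by blast
  qed auto
  then obtain C \<rho>' where C: "0 \<le> C" and \<rho>': "0 < \<rho>'"
    and J: "\<And>\<phi>. \<phi> \<in> {0..2 * pi} \<Longrightarrow> quad_jet f \<phi> C \<rho>'"
    unfolding P_def by blast
  define \<rho> where "\<rho> = min \<rho>' (min (\<delta> / 2) (\<epsilon>0 / 2))"
  have \<rho>: "0 < \<rho>" "\<rho> \<le> \<rho>'" "\<rho> < \<delta>" "\<rho> < \<epsilon>0" using pos \<rho>' by (auto simp: \<rho>_def)
  have "quad_jet f \<phi> C \<rho>" for \<phi>
  proof -
    define k where "k = \<lfloor>\<phi> / (2 * pi)\<rfloor>"
    define \<phi>' where "\<phi>' = \<phi> - of_int k * (2 * pi)"
    have "\<phi>' \<in> {0..2 * pi}"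
      using floor_correct[of "\<phi> / (2 * pi)"] unfolding \<phi>'_def k_def[symmetric]
      by (auto simp: field_simps)
    hence j: "quad_jet f \<phi>' C \<rho>" using J quad_jet_mono \<rho>(2) by blast
    have "f x v \<phi> \<epsilon> = f x v \<phi>' \<epsilon>" if "amp x v \<le> \<rho>" "\<bar>\<epsilon>\<bar> \<le> \<rho>" for x v \<epsilon>
    proof -
      have "norm (x, v) \<le> amp x v" using norm_Pair_le[of x v] by simp
      hence "\<And>\<phi>. f x v (\<phi> + 2 * pi) \<epsilon> = f x v \<phi> \<epsilon>" using that \<rho> by (intro per) auto
      from periodic_int_shift[of "\<lambda>\<phi>. f x v \<phi> \<epsilon>", OF this, of \<phi>' k]
      show ?thesis by (simp add: \<phi>'_def)
    qed
    note eq = this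
    hence e0: "f x v \<phi> 0 = f x v \<phi>' 0" if "amp x v \<le> \<rho>" for x v
      using that \<rho> by simp
    have "forcing_lipschitz f \<phi> C \<rho>"
      using j eq e0 by (simp add: quad_jet_def forcing_lipschitz_def)
    moreover have "cubic_remainder (\<lambda>x v. f x v \<phi> 0 - q x v) C \<rho>"
      if "cubic_remainder (\<lambda>x v. f x v \<phi>' 0 - q x v) C \<rho>" for q
      using that e0 unfolding cubic_remainder_def by (metis order_trans)
    ultimately show ?thesis using j zero unfolding quad_jet_def by blast
  qed
  thus ?thesis using C \<rho> by blast
qed

lemma real_analytic4_at_bounded_linear:
  assumes T: "bounded_linear T" and f: "real_analytic4_at f x0 v0 \<phi>0 \<epsilon>0"
  shows "real_analytic4_at (\<lambda>x v \<phi> \<epsilon>. T (f x v \<phi> \<epsilon>)) x0 v0 \<phi>0 \<epsilon>0"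
proof -
  obtain r A where r: "r > 0" and A: "\<And>x v \<phi> \<epsilon>. \<bar>x - x0\<bar> < r \<Longrightarrow> \<bar>v - v0\<bar> < r \<Longrightarrow> \<bar>\<phi> - \<phi>0\<bar> < r \<Longrightarrow>
      \<bar>\<epsilon> - \<epsilon>0\<bar> < r \<Longrightarrow>
        ((\<lambda>(i, j, k, l). ((x - x0) ^ i * (v - v0) ^ j * (\<phi> - \<phi>0) ^ k * (\<epsilon> - \<epsilon>0) ^ l) *\<^sub>R A i j k l)
          has_sum f x v \<phi> \<epsilon>) UNIV"
    using f unfolding real_analytic4_at_def by blast
  show ?thesis
    unfolding real_analytic4_at_def
  proof (intro exI[of _ r] conjI r exI[of _ "\<lambda>i j k l. T (A i j k l)"] allI impI; elim conjE)
    fix x v \<phi> \<epsilon> assume *: "\<bar>x - x0\<bar> < r" "\<bar>v - v0\<bar> < r" "\<bar>\<phi> - \<phi>0\<bar> < r" "\<bar>\<epsilon> - \<epsilon>0\<bar> < r"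
    show "((\<lambda>(i, j, k, l). ((x - x0) ^ i * (v - v0) ^ j * (\<phi> - \<phi>0) ^ k * (\<epsilon> - \<epsilon>0) ^ l) *\<^sub>R T (A i j k l))
          has_sum T (f x v \<phi> \<epsilon>)) UNIV"
      using has_sum_bounded_linear[OF T A[OF *]]
      by (simp add: case_prod_unfold linear_simps[OF T] o_def)
  qed
qed

section \<open>The linear flow of the slow mode\<close>

text \<open>The unforced slow mode \<open>x'' + d x' + e x = 0\<close>, linearized at the origin and required at one instant
  only.\<close>

definition linear_flow :: "real \<Rightarrow> real \<Rightarrow> (real \<Rightarrow> real) \<Rightarrow> (real \<Rightarrow> real) \<Rightarrow> real \<Rightarrow> bool" where
  "linear_flow d e X V t \<longleftrightarrow> (X has_real_derivative V t) (at t) \<and>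
     (V has_real_derivative - d * V t - e * X t) (at t)"

text \<open>With characteristic roots \<open>\<alpha> \<plusminus> i \<beta>\<close> the solution is an explicit damped oscillation.  The amplitude
  bound holds for negative times as well, which is what makes both signs of \<open>2 \<alpha> - Re r\<close> below tractable.\<close>

lemma linear_flow_exists:
  fixes \<alpha> \<beta> x v :: real
  assumes "\<beta> \<noteq> 0" "d = - 2 * \<alpha>" "e = \<alpha>\<^sup>2 + \<beta>\<^sup>2"
  obtains X V K where "X 0 = x" "V 0 = v" "\<And>t. linear_flow d e X V t"
    "\<And>t. amp (X t) (V t) \<le> K * exp (\<alpha> * t)"
    "x \<noteq> 0 \<or> v \<noteq> 0 \<Longrightarrow> \<forall>t. 0 < amp (X t) (V t)"
proof -
  define A where "A = x"
  define B where "B = (v - \<alpha> * x) / \<beta>"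
  define A' where "A' = \<alpha> * A + \<beta> * B"
  define B' where "B' = \<alpha> * B - \<beta> * A"
  have A': "A' = v" using assms(1) by (simp add: A'_def A_def B_def)
  define X where "X t = exp (\<alpha> * t) * (A * cos (\<beta> * t) + B * sin (\<beta> * t))" for t
  define V where "V t = exp (\<alpha> * t) * (A' * cos (\<beta> * t) + B' * sin (\<beta> * t))" for t
  have osc: "\<bar>a * cos s + b * sin s\<bar> \<le> \<bar>a\<bar> + \<bar>b\<bar>" for a b s :: real
  proof -
    have "\<bar>a * cos s + b * sin s\<bar> \<le> \<bar>a\<bar> * \<bar>cos s\<bar> + \<bar>b\<bar> * \<bar>sin s\<bar>"
      using abs_triangle_ineq[of "a * cos s" "b * sin s"] by (simp add: abs_mult)
    also have "\<dots> \<le> \<bar>a\<bar> * 1 + \<bar>b\<bar> * 1" by (intro add_mono mult_left_mono) auto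
    finally show ?thesis by simp
  qed
  show thesis
  proof (rule that[of X V "\<bar>A\<bar> + \<bar>B\<bar> + (\<bar>A'\<bar> + \<bar>B'\<bar>)"])
    show "X 0 = x" "V 0 = v" by (simp_all add: X_def V_def A_def A')
    show "linear_flow d e X V t" for t
      unfolding linear_flow_def
    proof
      show "(X has_real_derivative V t) (at t)"
        unfolding X_def V_def
        by (auto intro!: derivative_eq_intros simp: A'_def B'_def algebra_simps)
      show "(V has_real_derivative - d * V t - e * X t) (at t)"
        unfolding X_def V_def
        by (auto intro!: derivative_eq_intros
            simp: A'_def B'_def assms(2,3) algebra_simps power2_eq_square)
    qed
    show "amp (X t) (V t) \<le> (\<bar>A\<bar> + \<bar>B\<bar> + (\<bar>A'\<bar> + \<bar>B'\<bar>)) * exp (\<alpha> * t)" for t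
    proof -
      have "amp (X t) (V t) \<le> exp (\<alpha> * t) * (\<bar>A\<bar> + \<bar>B\<bar>) + exp (\<alpha> * t) * (\<bar>A'\<bar> + \<bar>B'\<bar>)"
        unfolding X_def V_def abs_mult abs_exp_cancel by (intro add_mono mult_left_mono osc) auto
      thus ?thesis by (simp add: algebra_simps)
    qed
    assume nz: "x \<noteq> 0 \<or> v \<noteq> 0"
    show "\<forall>t. 0 < amp (X t) (V t)"
    proof (rule allI, rule ccontr)
      fix t assume "\<not> 0 < amp (X t) (V t)"
      hence XV: "X t = 0" "V t = 0" by linarith+
      define c s where cs: "c = cos (\<beta> * t)" "s = sin (\<beta> * t)"
      have one: "c\<^sup>2 + s\<^sup>2 = 1" by (simp add: cs)
      have 1: "A * c + B * s = 0" using XV(1) by (simp add: X_def cs)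
      have "A' * c + B' * s = 0" using XV(2) by (simp add: V_def cs)
      moreover have "A' * c + B' * s = \<alpha> * (A * c + B * s) + \<beta> * (B * c - A * s)"
        by (simp add: A'_def B'_def algebra_simps)
      ultimately have 2: "B * c - A * s = 0" using 1 assms(1) by simp
      have "A = A * (c\<^sup>2 + s\<^sup>2)" by (simp add: one)
      also have "\<dots> = c * (A * c + B * s) - s * (B * c - A * s)"
        by (simp add: algebra_simps power2_eq_square)
      finally have A0: "A = 0" using 1 2 by simp
      have "B = B * (c\<^sup>2 + s\<^sup>2)" by (simp add: one)
      also have "\<dots> = s * (A * c + B * s) + c * (B * c - A * s)"
        by (simp add: algebra_simps power2_eq_square)
      finally have B0: "B = 0" using 1 2 by simp
      show False using nz A0 B0 assms(1) by (simp add: A_def B_def)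
    qed
  qed
qed

text \<open>The linear flow acts on quadratic forms by a derivation; its matrix in the coefficients is the source
  of the formulas for \<open>W~\<close> and of the matrix \<open>L\<close>.\<close>

lemma qform_along_flow:
  fixes a b c :: "'b::real_normed_vector"
  assumes "linear_flow d e X V t"
  shows "((\<lambda>t. qform a b c (X t) (V t)) has_vector_derivative
     qform (- (e *\<^sub>R b)) (2 *\<^sub>R a - d *\<^sub>R b - (2 * e) *\<^sub>R c) (b - (2 * d) *\<^sub>R c) (X t) (V t)) (at t)"
proof -
  have X: "(X has_real_derivative V t) (at t)"
    and V: "(V has_real_derivative - d * V t - e * X t) (at t)"
    using assms by (auto simp: linear_flow_def)
  have "((\<lambda>t. (X t)\<^sup>2) has_real_derivative 2 * X t * V t) (at t)"
    "((\<lambda>t. X t * V t) has_real_derivative V t * V t + X t * (- d * V t - e * X t)) (at t)"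
    "((\<lambda>t. (V t)\<^sup>2) has_real_derivative 2 * V t * (- d * V t - e * X t)) (at t)"
    using X V by (auto intro!: derivative_eq_intros)
  note D = this
  have S: "((\<lambda>t. g t *\<^sub>R k) has_vector_derivative g' *\<^sub>R k) (at t)"
    if "(g has_real_derivative g') (at t)" for g g' and k :: 'b
    using has_vector_derivative_scaleR[OF that has_vector_derivative_const[of k]] by simp
  have "((\<lambda>t. (X t)\<^sup>2 *\<^sub>R a + (X t * V t) *\<^sub>R b + (V t)\<^sup>2 *\<^sub>R c) has_vector_derivative
      (2 * X t * V t) *\<^sub>R a + (V t * V t + X t * (- d * V t - e * X t)) *\<^sub>R b
        + (2 * V t * (- d * V t - e * X t)) *\<^sub>R c) (at t)"
    by (intro has_vector_derivative_add S D)
  also have "(2 * X t * V t) *\<^sub>R a + (V t * V t + X t * (- d * V t - e * X t)) *\<^sub>R b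
        + (2 * V t * (- d * V t - e * X t)) *\<^sub>R c
    = qform (- (e *\<^sub>R b)) (2 *\<^sub>R a - d *\<^sub>R b - (2 * e) *\<^sub>R c) (b - (2 * d) *\<^sub>R c) (X t) (V t)"
    by (simp add: qform_def algebra_simps power2_eq_square)
  finally show ?thesis by (simp add: qform_def)
qed

text \<open>Constancy gives \<open>|D| \<le> const exp ((2 \<alpha> - Re r) t)\<close> for every real \<open>t\<close>, and a suitable \<open>t\<close> makes the
  right-hand side as small as desired.\<close>

lemma resonance_free_form_eq_0:
  fixes D :: "real \<Rightarrow> real \<Rightarrow> real \<Rightarrow> complex"
  assumes lin: "\<beta> \<noteq> 0" "d = - 2 * \<alpha>" "e = \<alpha>\<^sup>2 + \<beta>\<^sup>2" and nonres: "Re r \<noteq> 2 * \<alpha>"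
    and bound: "\<And>\<theta> x v. norm (D \<theta> x v) \<le> C * (amp x v)\<^sup>2"
    and const: "\<And>X V \<theta> t. (\<And>t. linear_flow d e X V t) \<Longrightarrow> (\<And>t. 0 < amp (X t) (V t)) \<Longrightarrow>
       exp (- (r * of_real t)) * D (\<theta> + \<Omega> * t) (X t) (V t) = D \<theta> (X 0) (V 0)"
  shows "D \<theta> x v = 0"
proof (cases "x = 0 \<and> v = 0")
  case True
  thus ?thesis using bound[of \<theta> x v] by simp
next
  case False
  obtain X V K where XV: "X 0 = x" "V 0 = v" "\<And>t. linear_flow d e X V t"
    "\<And>t. amp (X t) (V t) \<le> K * exp (\<alpha> * t)"
    "x \<noteq> 0 \<or> v \<noteq> 0 \<Longrightarrow> \<forall>t. 0 < amp (X t) (V t)"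
    using linear_flow_exists[OF lin] by blast
  have C: "0 \<le> C" using order_trans[OF norm_ge_zero bound[of 0 1 0]] by simp
  define \<kappa> where "\<kappa> = 2 * \<alpha> - Re r"
  have \<kappa>: "\<kappa> \<noteq> 0" using nonres by (simp add: \<kappa>_def)
  have le: "norm (D \<theta> x v) \<le> C * K\<^sup>2 * exp (\<kappa> * t)" for t
  proof -
    have "norm (D \<theta> x v) = norm (exp (- (r * of_real t)) * D (\<theta> + \<Omega> * t) (X t) (V t))"
      using const[of X V t \<theta>] XV False by simp
    also have "\<dots> = exp (- (Re r * t)) * norm (D (\<theta> + \<Omega> * t) (X t) (V t))"
      by (simp add: norm_mult)
    also have "\<dots> \<le> exp (- (Re r * t)) * (C * (K * exp (\<alpha> * t))\<^sup>2)"
      using C XV(4)[of t]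
      by (intro mult_left_mono order_trans[OF bound] power_mono) auto
    also have "\<dots> = C * K\<^sup>2 * (exp (- (Re r * t)) * (exp (\<alpha> * t) * exp (\<alpha> * t)))"
      by (simp add: power2_eq_square)
    also have "\<dots> = C * K\<^sup>2 * exp (\<kappa> * t)"
      by (simp add: \<kappa>_def exp_add[symmetric] algebra_simps)
    finally show ?thesis .
  qed
  have "norm (D \<theta> x v) \<le> 0"
  proof (rule field_le_epsilon)
    fix \<eta> :: real assume \<eta>: "0 < \<eta>"
    (* At this time, of either sign, the exponential equals \<eta> / (C K^2 + 1). *)
    define t where "t = ln (\<eta> / (C * K\<^sup>2 + 1)) / \<kappa>"
    have p: "0 < C * K\<^sup>2 + 1" using C by (simp add: add_nonneg_pos)
    have "exp (\<kappa> * t) = \<eta> / (C * K\<^sup>2 + 1)"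
      using \<kappa> \<eta> p by (simp add: t_def)
    hence "norm (D \<theta> x v) \<le> C * K\<^sup>2 * (\<eta> / (C * K\<^sup>2 + 1))" using le[of t] by simp
    also have "\<dots> \<le> \<eta>" using p \<eta> C by (simp add: field_simps)
    finally show "norm (D \<theta> x v) \<le> 0 + \<eta>" by simp
  qed
  thus ?thesis by simp
qed

section \<open>Quadratic parts forced by invariance\<close>

text \<open>A mean value inequality by bisection.  It is stated without a derivative because it will be applied to
  the graph along a path that leaves the invariant manifold.\<close>

lemma locally_lipschitz_increment:
  fixes f :: "real \<Rightarrow> 'b::real_normed_vector"
  assumes "a \<le> b"
    and loc: "\<And>t. a \<le> t \<Longrightarrow> t \<le> b \<Longrightarrow> \<forall>\<^sub>F \<tau> in at t. norm (f \<tau> - f t) \<le> \<kappa> * \<bar>\<tau> - t\<bar>"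
  shows "norm (f b - f a) \<le> \<kappa> * (b - a)"
  using assms(1)
proof (induction rule: Bolzano)
  case (trans a b c)
  have "norm (f c - f a) \<le> norm (f c - f b) + norm (f b - f a)"
    using norm_triangle_ineq[of "f c - f b" "f b - f a"] by simp
  thus ?case using trans by (simp add: algebra_simps)
next
  case (local t)
  obtain \<delta> where \<delta>: "0 < \<delta>"
    "\<And>\<tau>. \<tau> \<noteq> t \<Longrightarrow> dist \<tau> t < \<delta> \<Longrightarrow> norm (f \<tau> - f t) \<le> \<kappa> * \<bar>\<tau> - t\<bar>"
    using loc[OF local] unfolding eventually_at by auto
  have near: "norm (f \<tau> - f t) \<le> \<kappa> * \<bar>\<tau> - t\<bar>" if "\<bar>\<tau> - t\<bar> < \<delta>" for \<tau>
    using \<delta>(2)[of \<tau>] that by (cases "\<tau> = t") (auto simp: dist_real_def)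
  have "norm (f v - f u) \<le> \<kappa> * (v - u)" if "u \<le> t" "t \<le> v" "v - u < \<delta>" for u v
  proof -
    have "norm (f v - f u) \<le> norm (f v - f t) + norm (f u - f t)"
      using norm_triangle_ineq4[of "f v - f t" "f u - f t"] by simp
    also have "\<dots> \<le> \<kappa> * \<bar>v - t\<bar> + \<kappa> * \<bar>u - t\<bar>" using that by (intro add_mono near) auto
    also have "\<dots> = \<kappa> * (v - u)" using that by (simp add: algebra_simps)
    finally show ?thesis .
  qed
  thus ?case using \<delta>(1) by blast
qed

lemma has_vector_derivative_imp_increment:
  fixes g :: "real \<Rightarrow> 'b::real_normed_vector"
  assumes "(g has_vector_derivative D) (at t)" "norm D < \<kappa>"
  shows "\<forall>\<^sub>F \<tau> in at t. norm (g \<tau> - g t) \<le> \<kappa> * \<bar>\<tau> - t\<bar>"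
proof -
  obtain \<delta> where \<delta>: "0 < \<delta>"
    "\<And>\<tau>. norm (\<tau> - t) < \<delta> \<Longrightarrow> norm (g \<tau> - g t - (\<tau> - t) *\<^sub>R D) \<le> (\<kappa> - norm D) * norm (\<tau> - t)"
    using assms unfolding has_vector_derivative_def has_derivative_at_alt
    by (metis diff_gt_0_iff_gt)
  have "norm (g \<tau> - g t) \<le> \<kappa> * \<bar>\<tau> - t\<bar>" if "dist \<tau> t < \<delta>" for \<tau>
  proof -
    have "norm (g \<tau> - g t) \<le> norm (g \<tau> - g t - (\<tau> - t) *\<^sub>R D) + norm ((\<tau> - t) *\<^sub>R D)"
      using norm_triangle_ineq[of "g \<tau> - g t - (\<tau> - t) *\<^sub>R D" "(\<tau> - t) *\<^sub>R D"] by simp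
    also have "\<dots> \<le> (\<kappa> - norm D) * \<bar>\<tau> - t\<bar> + \<bar>\<tau> - t\<bar> * norm D"
      using \<delta>(2)[of \<tau>] that by (simp add: dist_real_def)
    finally show ?thesis by (simp add: algebra_simps)
  qed
  thus ?thesis unfolding eventually_at using \<delta>(1) by blast
qed

lemma bounded_by_multiples_eq_0:
  fixes z :: "'b::real_normed_vector"
  assumes "0 < s0" "\<And>s. 0 < s \<Longrightarrow> s \<le> s0 \<Longrightarrow> norm z \<le> K * s"
  shows "z = 0"
proof -
  have "((\<lambda>s. K * s) \<longlongrightarrow> K * 0) (at_right (0::real))"
    by (intro tendsto_intros)
  moreover have "\<forall>\<^sub>F s in at_right (0::real). norm z \<le> K * s"
    unfolding eventually_at_right_field using assms by (intro exI[of _ s0]) auto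
  ultimately have "norm z \<le> K * 0"
    by (intro tendsto_le[OF _ _ tendsto_const]) auto
  thus ?thesis by simp
qed

lemma qform_scale: "qform a b c (s * x) (s * v) = s\<^sup>2 *\<^sub>R qform a b c x v"
  by (simp add: qform_def power_mult_distrib scaleR_right_distrib power2_eq_square mult_ac)

lemma qform_bound:
  fixes a b c :: "'b::real_normed_vector"
  assumes "norm a \<le> C" "norm b \<le> C" "norm c \<le> C"
  shows "norm (qform a b c x v) \<le> C * (amp x v)\<^sup>2"
proof -
  have "norm (qform a b c x v) \<le> x\<^sup>2 * norm a + \<bar>x * v\<bar> * norm b + v\<^sup>2 * norm c"
    unfolding qform_def
    by (intro order_trans[OF norm_triangle_ineq] add_mono) auto
  also have "\<dots> \<le> x\<^sup>2 * C + \<bar>x * v\<bar> * C + v\<^sup>2 * C"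
    using assms by (intro add_mono mult_left_mono) auto
  also have "\<dots> = C * (x\<^sup>2 + \<bar>x * v\<bar> + v\<^sup>2)" by (simp add: algebra_simps)
  also have "\<dots> \<le> C * (amp x v)\<^sup>2"
    using order_trans[OF norm_ge_zero assms(1)]
    by (intro mult_left_mono) (auto simp: power2_sum abs_mult)
  finally show ?thesis .
qed

lemma linear_flow_scale: "linear_flow d e X V t \<Longrightarrow> linear_flow d e (\<lambda>t. s * X t) (\<lambda>t. s * V t) t"
  unfolding linear_flow_def by (auto intro!: derivative_eq_intros simp: algebra_simps)

lemma linear_flow_bounded:
  assumes "\<And>t. linear_flow d e X V t"
  obtains K where "0 < K" "\<And>t. a \<le> t \<Longrightarrow> t \<le> b \<Longrightarrow> amp (X t) (V t) \<le> K"
proof -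
  have "continuous_on {a..b} X" "continuous_on {a..b} V"
    using assms unfolding linear_flow_def
    by (meson DERIV_isCont continuous_at_imp_continuous_on)+
  hence "continuous_on {a..b} (\<lambda>t. amp (X t) (V t))" by (intro continuous_intros)
  hence "bounded ((\<lambda>t. amp (X t) (V t)) ` {a..b})"
    by (intro compact_imp_bounded compact_continuous_image) auto
  then obtain K where "0 < K" "\<And>y. y \<in> (\<lambda>t. amp (X t) (V t)) ` {a..b} \<Longrightarrow> norm y \<le> K"
    unfolding bounded_pos by blast
  thus thesis by (intro that[of K]) force+
qed

lemma exp_bounded:
  fixes r :: complex
  obtains E where "0 < E" "\<And>t. a \<le> t \<Longrightarrow> t \<le> b \<Longrightarrow> norm (exp (- (r * of_real t))) \<le> E"
proof -
  have "continuous_on {a..b} (\<lambda>t. exp (- (r * of_real t)))" by (intro continuous_intros)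
  hence "bounded ((\<lambda>t. exp (- (r * of_real t))) ` {a..b})"
    by (intro compact_imp_bounded compact_continuous_image) auto
  then obtain K where "0 < K" "\<And>y. y \<in> (\<lambda>t. exp (- (r * of_real t))) ` {a..b} \<Longrightarrow> norm y \<le> K"
    unfolding bounded_pos by blast
  thus thesis by (intro that[of K]) force+
qed

text \<open>The quadratic form is left unspecified: it is identified only afterwards, by invariance.\<close>

definition quad_expansion :: "(real \<Rightarrow> real \<Rightarrow> 'b::real_normed_vector) \<Rightarrow> real \<Rightarrow> real \<Rightarrow> bool" where
  "quad_expansion g C \<rho> \<longleftrightarrow> (\<exists>a b c. norm a \<le> C \<and> norm b \<le> C \<and> norm c \<le> C \<and>
     (\<forall>x v. amp x v \<le> \<rho> \<longrightarrow> norm (g x v - qform a b c x v) \<le> C * amp x v ^ 3))"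

text \<open>Along the linear flow \<open>u\<close> satisfies \<open>u' = r u + f\<close> with a quadratic forcing \<open>f\<close>, up to third
  order.  The linear flow is not a trajectory, so \<open>u\<close> is compared there with \<open>Y\<close>, the values of \<open>u\<close> on the
  nonlinear trajectory through the same point, whose derivative is known from the equations of motion.\<close>

definition first_order_along_flow where
  "first_order_along_flow d e \<Omega> r f20 f11 f02 (u :: real \<Rightarrow> real \<Rightarrow> real \<Rightarrow> complex) C \<rho> \<longleftrightarrow>
     (\<forall>X V t \<theta>. linear_flow d e X V t \<longrightarrow> 0 < amp (X t) (V t) \<longrightarrow> amp (X t) (V t) \<le> \<rho> \<longrightarrow>
       (\<exists>Y y'. Y t = u (X t) (V t) (\<theta> + \<Omega> * t) \<and> (Y has_vector_derivative y') (at t) \<and>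
         norm (y' - r * Y t - qform f20 f11 f02 (X t) (V t)) \<le> C * amp (X t) (V t) ^ 3 \<and>
         (\<forall>\<^sub>F \<tau> in at t. norm (u (X \<tau>) (V \<tau>) (\<theta> + \<Omega> * \<tau>) - Y \<tau>)
           \<le> C * amp (X t) (V t) ^ 3 * \<bar>\<tau> - t\<bar>)))"

text \<open>The form \<open>B\<close> with coefficients \<open>b20, b11, b02\<close> solves \<open>B' = r B + f\<close> exactly along the linear flow.  So
  \<open>exp (- r t) (u - B)\<close> changes only by third order terms over a fixed time; evaluated at the
  scaled flow \<open>s (X, V)\<close> and divided by \<open>s\<^sup>2\<close>, this shows in the limit \<open>s \<rightarrow> 0\<close> that the quadratic part
  \<open>D\<close> of \<open>u - B\<close> satisfies the hypothesis of \<open>resonance_free_form_eq_0\<close>.\<close>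

lemma invariant_quadratic_part:
  fixes u :: "real \<Rightarrow> real \<Rightarrow> real \<Rightarrow> complex"
  assumes lin: "\<beta> \<noteq> 0" "d = - 2 * \<alpha>" "e = \<alpha>\<^sup>2 + \<beta>\<^sup>2" and nonres: "Re r \<noteq> 2 * \<alpha>"
    and C: "0 \<le> C" and \<rho>: "0 < \<rho>"
    and jet: "\<And>\<phi>. quad_expansion (\<lambda>x v. u x v \<phi>) C \<rho>"
    and dyn: "first_order_along_flow d e \<Omega> r f20 f11 f02 u C \<rho>"
    and alg: "r * b20 + f20 = - (e *\<^sub>R b11)" "r * b11 + f11 = 2 *\<^sub>R b20 - d *\<^sub>R b11 - (2 * e) *\<^sub>R b02"
       "r * b02 + f02 = b11 - (2 * d) *\<^sub>R b02"
    and small: "amp x v \<le> \<rho>"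
  shows "norm (u x v \<phi> - qform b20 b11 b02 x v) \<le> C * amp x v ^ 3"
proof -
  obtain a b c where abc: "\<And>\<phi>. norm (a \<phi>) \<le> C" "\<And>\<phi>. norm (b \<phi>) \<le> C" "\<And>\<phi>. norm (c \<phi>) \<le> C"
    and T: "\<And>\<phi> x v. amp x v \<le> \<rho> \<Longrightarrow>
      norm (u x v \<phi> - qform (a \<phi>) (b \<phi>) (c \<phi>) x v) \<le> C * amp x v ^ 3"
    using jet unfolding quad_expansion_def by metis
  define q where "q = qform b20 b11 b02"
  define D where "D \<phi> x v = qform (a \<phi> - b20) (b \<phi> - b11) (c \<phi> - b02) x v" for \<phi> x v
  have Du: "norm (u x v \<phi> - q x v - D \<phi> x v) \<le> C * amp x v ^ 3" if "amp x v \<le> \<rho>" for \<phi> x v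
  proof -
    have "u x v \<phi> - q x v - D \<phi> x v = u x v \<phi> - qform (a \<phi>) (b \<phi>) (c \<phi>) x v"
      by (simp add: D_def q_def qform_def scaleR_right_diff_distrib)
    thus ?thesis using T[OF that, of \<phi>] by metis
  qed
  have Dscale: "D \<phi> (s * x) (s * v) = s\<^sup>2 *\<^sub>R D \<phi> x v" for \<phi> x v s by (simp add: D_def qform_scale)
  have const: "exp (- (r * of_real t0)) * D (\<theta> + \<Omega> * t0) (X t0) (V t0)
      = exp (- (r * of_real t1)) * D (\<theta> + \<Omega> * t1) (X t1) (V t1)"
    if flow: "\<And>t. linear_flow d e X V t" and nz: "\<And>t. 0 < amp (X t) (V t)" and t01: "t0 \<le> t1"
    for X V \<theta> t0 t1
  proof -
    obtain K where K: "0 < K" "\<And>t. t0 \<le> t \<Longrightarrow> t \<le> t1 \<Longrightarrow> amp (X t) (V t) \<le> K"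
      using linear_flow_bounded[OF flow] by metis
    obtain E where E: "0 < E" "\<And>t. t0 \<le> t \<Longrightarrow> t \<le> t1 \<Longrightarrow> norm (exp (- (r * of_real t))) \<le> E"
      using exp_bounded by metis
    define \<kappa> where "\<kappa> = E * C + 1 + (E + 1) * C"
    have \<kappa>: "0 \<le> \<kappa>" using E C by (simp add: \<kappa>_def)
    (* Accumulated drift over [t0, t1] plus the two Taylor errors at its end points, per s^3. *)
    define M where "M = \<kappa> * K ^ 3 * (t1 - t0) + 2 * (E * (C * K ^ 3))"
    have "norm (exp (- (r * of_real t1)) * D (\<theta> + \<Omega> * t1) (X t1) (V t1)
        - exp (- (r * of_real t0)) * D (\<theta> + \<Omega> * t0) (X t0) (V t0)) \<le> M * s"
      (is "norm (?D1 - ?D0) \<le> _") if s: "0 < s" "s \<le> \<rho> / K" for s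
    proof -
      define F where "F t = exp (- (r * of_real t)) *
        (u (s * X t) (s * V t) (\<theta> + \<Omega> * t) - q (s * X t) (s * V t))" for t
      have n: "amp (s * X t) (s * V t) = s * amp (X t) (V t)" for t
        using s by (simp add: abs_mult algebra_simps)
      have nK: "amp (s * X t) (s * V t) \<le> s * K" "amp (s * X t) (s * V t) \<le> \<rho>"
        if "t0 \<le> t" "t \<le> t1" for t
      proof -
        show *: "amp (s * X t) (s * V t) \<le> s * K"
          unfolding n using K(2)[OF that] s by (intro mult_left_mono) auto
        show "amp (s * X t) (s * V t) \<le> \<rho>"
          using * s K(1) by (simp add: field_simps)
      qed
      have n3: "(amp (s * X t) (s * V t)) ^ 3 \<le> s ^ 3 * K ^ 3" if "t0 \<le> t" "t \<le> t1" for t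
        using power_mono[OF nK(1)[OF that], of 3] by (simp add: power_mult_distrib)
      have F: "norm (F t - s\<^sup>2 *\<^sub>R (exp (- (r * of_real t)) * D (\<theta> + \<Omega> * t) (X t) (V t)))
          \<le> E * (C * (s ^ 3 * K ^ 3))" if "t0 \<le> t" "t \<le> t1" for t
      proof -
        have "F t - s\<^sup>2 *\<^sub>R (exp (- (r * of_real t)) * D (\<theta> + \<Omega> * t) (X t) (V t))
            = exp (- (r * of_real t)) * (u (s * X t) (s * V t) (\<theta> + \<Omega> * t) - q (s * X t) (s * V t)
              - D (\<theta> + \<Omega> * t) (s * X t) (s * V t))"
          by (simp add: F_def Dscale algebra_simps)
        also have "norm \<dots> \<le> E * (C * (s ^ 3 * K ^ 3))"
          unfolding norm_mult
          using E(2)[OF that] Du[OF nK(2)[OF that]] n3[OF that] C E(1)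
          by (intro mult_mono) (auto intro: order_trans mult_left_mono)
        finally show ?thesis .
      qed
      have "norm (F t1 - F t0) \<le> (\<kappa> * (s ^ 3 * K ^ 3)) * (t1 - t0)"
      proof (rule locally_lipschitz_increment[OF t01])
        fix t assume t: "t0 \<le> t" "t \<le> t1"
        let ?x = "s * X t" and ?v = "s * V t" and ?e = "exp (- (r * of_real t))"
        let ?u = "u (s * X t) (s * V t) (\<theta> + \<Omega> * t)" and ?q = "q (s * X t) (s * V t)"
        let ?f = "qform f20 f11 f02 (s * X t) (s * V t)"
        define N where "N = (amp ?x ?v) ^ 3"
        have N: "0 < N" "N \<le> s ^ 3 * K ^ 3" using nz[of t] s n3[OF t] n[of t] by (auto simp: N_def)
        have fl: "linear_flow d e (\<lambda>t. s * X t) (\<lambda>t. s * V t) t" by (rule linear_flow_scale[OF flow])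
        have pos: "0 < amp ?x ?v" unfolding n using s nz[of t] by simp
        obtain Y y' where Y: "Y t = ?u"
            "(Y has_vector_derivative y') (at t)"
            "norm (y' - r * ?u - ?f) \<le> C * N"
            "\<forall>\<^sub>F \<tau> in at t. norm (u (s * X \<tau>) (s * V \<tau>) (\<theta> + \<Omega> * \<tau>) - Y \<tau>) \<le> C * N * \<bar>\<tau> - t\<bar>"
          using dyn[unfolded first_order_along_flow_def, rule_format, OF fl pos nK(2)[OF t], of \<theta>]
          unfolding N_def by auto
        (* G has a derivative at t because Y does; F follows the graph along the linear flow. *)
        define G where "G \<tau> = exp (- (r * of_real \<tau>)) * (Y \<tau> - q (s * X \<tau>) (s * V \<tau>))" for \<tau>
        define G' where "G' = ?e * (y' - r * ?u - ?f)"
        have ed: "((\<lambda>\<tau>. exp (- (r * of_real \<tau>))) has_vector_derivative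
            - r * ?e) (at t)"
        proof -
          have "((\<lambda>z. exp (- (r * z))) has_field_derivative - r * ?e) (at (of_real t))"
            by (auto intro!: derivative_eq_intros)
          from has_vector_derivative_real_field[OF this] show ?thesis by (simp add: o_def)
        qed
        have qd: "((\<lambda>\<tau>. q (s * X \<tau>) (s * V \<tau>)) has_vector_derivative
            r * ?q + ?f) (at t)"
        proof -
          have "r * ?q + ?f
            = qform (r * b20 + f20) (r * b11 + f11) (r * b02 + f02) ?x ?v"
            by (simp add: q_def qform_def algebra_simps)
          thus ?thesis using qform_along_flow[OF fl, of b20 b11 b02] unfolding q_def alg by simp
        qed
        have "(G has_vector_derivative ?e *
              (y' - (r * ?q + ?f))
              + (- r * ?e) * (Y t - ?q)) (at t)"
          unfolding G_def
          by (rule has_vector_derivative_mult[OF ed has_vector_derivative_diff[OF Y(2) qd]])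
        also have "?e *
              (y' - (r * ?q + ?f))
              + (- r * ?e) * (Y t - ?q) = G'"
          by (simp add: G'_def Y(1) algebra_simps)
        finally have Gd: "(G has_vector_derivative G') (at t)" .
        have "norm G' \<le> E * (C * N)"
          unfolding G'_def norm_mult using E(1) E(2)[OF t] Y(3) by (intro mult_mono) auto
        hence "norm G' < E * (C * N) + N" using N by simp
        from has_vector_derivative_imp_increment[OF Gd this]
        have ev1: "\<forall>\<^sub>F \<tau> in at t. norm (G \<tau> - G t) \<le> (E * (C * N) + N) * \<bar>\<tau> - t\<bar>" .
        have "((\<lambda>\<tau>. norm (exp (- (r * of_real \<tau>)))) \<longlongrightarrow> norm (?e)) (at t)"
          by (intro tendsto_intros)
        hence ev2: "\<forall>\<^sub>F \<tau> in at t. norm (exp (- (r * of_real \<tau>))) < E + 1"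
          by (rule order_tendstoD(2)) (use E(2)[OF t] in linarith)
        from ev1 ev2 Y(4)
        show "\<forall>\<^sub>F \<tau> in at t. norm (F \<tau> - F t) \<le> \<kappa> * (s ^ 3 * K ^ 3) * \<bar>\<tau> - t\<bar>"
        proof eventually_elim
          case (elim \<tau>)
          have "F \<tau> - G \<tau> = exp (- (r * of_real \<tau>)) * (u (s * X \<tau>) (s * V \<tau>) (\<theta> + \<Omega> * \<tau>) - Y \<tau>)"
            by (simp add: F_def G_def algebra_simps)
          hence "norm (F \<tau> - G \<tau>) \<le> (E + 1) * (C * N * \<bar>\<tau> - t\<bar>)"
            using elim(2,3) E(1) by (auto simp: norm_mult intro!: mult_mono)
          moreover have "F t = G t" by (simp add: F_def G_def Y(1))
          moreover have "norm (F \<tau> - G t) \<le> norm (F \<tau> - G \<tau>) + norm (G \<tau> - G t)"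
            using norm_triangle_ineq[of "F \<tau> - G \<tau>" "G \<tau> - G t"] by simp
          ultimately have "norm (F \<tau> - F t) \<le> (E + 1) * (C * N * \<bar>\<tau> - t\<bar>) + (E * (C * N) + N) * \<bar>\<tau> - t\<bar>"
            using elim(1) by simp
          also have "\<dots> = \<kappa> * N * \<bar>\<tau> - t\<bar>" by (simp add: \<kappa>_def algebra_simps)
          also have "\<dots> \<le> \<kappa> * (s ^ 3 * K ^ 3) * \<bar>\<tau> - t\<bar>"
            using N(2) \<kappa> by (intro mult_right_mono mult_left_mono) auto
          finally show ?case .
        qed
      qed
      moreover have "norm (x - y) \<le> norm (z - w) + norm (z - x) + norm (w - y)" for x y z w :: complex
        by norm
      hence "norm (s\<^sup>2 *\<^sub>R ?D1 - s\<^sup>2 *\<^sub>R ?D0)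
          \<le> norm (F t1 - F t0) + norm (F t1 - s\<^sup>2 *\<^sub>R ?D1) + norm (F t0 - s\<^sup>2 *\<^sub>R ?D0)" .
      ultimately have "norm (s\<^sup>2 *\<^sub>R ?D1 - s\<^sup>2 *\<^sub>R ?D0) \<le> (\<kappa> * (s ^ 3 * K ^ 3)) * (t1 - t0)
          + E * (C * (s ^ 3 * K ^ 3)) + E * (C * (s ^ 3 * K ^ 3))"
        using F[of t1] F[of t0] t01 by linarith
      also have "\<dots> = s\<^sup>2 * (M * s)" by (simp add: M_def power3_eq_cube power2_eq_square algebra_simps)
      also have "norm (s\<^sup>2 *\<^sub>R ?D1 - s\<^sup>2 *\<^sub>R ?D0) = s\<^sup>2 * norm (?D1 - ?D0)"
        by (simp flip: scaleR_diff_right)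
      finally show ?thesis using s by simp
    qed
    note le = this
    have "0 < \<rho> / K" using \<rho> K(1) by simp
    from bounded_by_multiples_eq_0[OF this le] show ?thesis by simp
  qed
  have D0: "D \<phi> x v = 0" for x v
  proof (rule resonance_free_form_eq_0[OF lin nonres])
    define C' where "C' = C + (norm b20 + norm b11 + norm b02)"
    show "norm (D \<theta> x v) \<le> C' * (amp x v)\<^sup>2" for \<theta> x v
      unfolding D_def
      by (rule qform_bound; rule order_trans[OF norm_triangle_ineq4])
        (use abc[of \<theta>] norm_ge_zero[of b20] norm_ge_zero[of b11] norm_ge_zero[of b02]
          in \<open>unfold C'_def, linarith+\<close>)
    fix X V \<theta> t
    assume flow: "\<And>t. linear_flow d e X V t"
      and nz: "\<And>t. 0 < amp (X t) (V t)"
    show "exp (- (r * of_real t)) * D (\<theta> + \<Omega> * t) (X t) (V t) = D \<theta> (X 0) (V 0)"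
    proof -
      have "exp (- (r * of_real t)) * D (\<theta> + \<Omega> * t) (X t) (V t)
          = exp (- (r * of_real 0)) * D (\<theta> + \<Omega> * 0) (X 0) (V 0)"
      proof (cases "0 \<le> t")
        case True
        show ?thesis by (rule const[OF flow nz True, symmetric])
      next
        case False
        thus ?thesis by (intro const[OF flow nz]) simp
      qed
      thus ?thesis by simp
    qed
  qed
  show ?thesis using Du[OF small, of \<phi>] by (simp add: D0 q_def)
qed

section \<open>Modal equations and the matrices of the reduced model\<close>

lemma poly_det:
  fixes A :: "'a::comm_ring_1 poly^'n^'n"
  shows "poly (det A) x = det (\<chi> i j. poly (A $ i $ j) x)"
  by (simp add: det_def poly_sum poly_prod of_int_poly)

text \<open>Congruence with \<open>\<Phi>\<close> diagonalizes the matrix polynomial, and \<open>\<Phi>\<close> is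
  invertible.\<close>

lemma modal_root_is_eigenvalue:
  fixes M C K \<Phi> :: "real^'n^'n" and r :: complex
  assumes modal: "modal_matrix M C K \<Phi> \<omega>s \<zeta>s"
    and root: "r\<^sup>2 + of_real (2 * \<zeta>s i * \<omega>s i) * r + of_real ((\<omega>s i)\<^sup>2) = 0"
  shows "poly (quad_charpoly M C K) r = 0"
proof -
  define cm :: "real^'n^'n \<Rightarrow> complex^'n^'n" where "cm A = (\<chi> a b. of_real (A $ a $ b))" for A
  define N where "N = (\<chi> a b. of_real (K $ a $ b) + r * of_real (C $ a $ b) + r\<^sup>2 * of_real (M $ a $ b))"
  have cm_mult: "cm (A ** B) = cm A ** cm B" for A B
    by (simp add: cm_def matrix_matrix_mult_def vec_eq_iff)
  have charpoly: "poly (quad_charpoly M C K) r = det N"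
    by (simp add: quad_charpoly_def poly_det N_def power2_eq_square algebra_simps)
  let ?T = "cm (transpose \<Phi>)" and ?F = "cm \<Phi>"
  have entry: "(?T ** N ** ?F) $ a $ b = of_real ((transpose \<Phi> ** K ** \<Phi>) $ a $ b)
      + r * of_real ((transpose \<Phi> ** C ** \<Phi>) $ a $ b) + r\<^sup>2 * of_real ((transpose \<Phi> ** M ** \<Phi>) $ a $ b)"
    for a b
    by (simp add: cm_def N_def matrix_matrix_mult_def sum.distrib sum_distrib_left sum_distrib_right
        algebra_simps)
  have "det (?T ** N ** ?F) = (\<Prod>a\<in>UNIV. (?T ** N ** ?F) $ a $ a)"
    by (rule det_diagonal) (use modal in \<open>auto simp: entry modal_matrix_def diag_matrix_def mat_def\<close>)
  also have "(?T ** N ** ?F) $ i $ i = 0"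
    using modal root by (simp add: entry modal_matrix_def diag_matrix_def mat_def algebra_simps)
  hence "(\<Prod>a\<in>UNIV. (?T ** N ** ?F) $ a $ a) = 0" by (auto simp: prod_zero_iff)
  finally have "det ?T * det N * det ?F = 0" by (simp add: det_mul)
  moreover have "det ?T * det (cm M) * det ?F = 1"
  proof -
    have "?T ** cm M ** ?F = cm (mat 1)" using modal by (simp add: modal_matrix_def flip: cm_mult)
    also have "\<dots> = mat 1" by (auto simp: cm_def mat_def vec_eq_iff)
    finally show ?thesis by (metis det_I det_mul)
  qed
  ultimately show ?thesis unfolding charpoly by auto
qed

text \<open>With \<open>\<lambda> = \<alpha> + i \<beta>\<close> and its conjugate \<open>\<mu>\<close>, the derivation induced by the linear flow on quadratic forms
  has the eigenvalues \<open>2 \<lambda>\<close>, \<open>\<lambda> + \<mu>\<close>, \<open>2 \<mu>\<close>, all with real part \<open>2 \<alpha>\<close>.  The products \<open>r + d\<close> and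
  \<open>r\<^sup>2 + 2 d r + 4 e\<close> in the proof are the factors of its characteristic polynomial.\<close>

lemma quadratic_form_eigenvalue:
  fixes r b20 b11 b02 :: complex
  assumes lin: "\<beta> \<noteq> 0" "d = - 2 * \<alpha>" "e = \<alpha>\<^sup>2 + \<beta>\<^sup>2" and nonres: "Re r \<noteq> 2 * \<alpha>"
    and eq: "r * b20 = - (e *\<^sub>R b11)" "r * b11 = 2 *\<^sub>R b20 - d *\<^sub>R b11 - (2 * e) *\<^sub>R b02"
       "r * b02 = b11 - (2 * d) *\<^sub>R b02"
  shows "b20 = 0 \<and> b11 = 0 \<and> b02 = 0"
proof -
  have e: "e > 0" using lin by (simp add: add_nonneg_pos)
  have rd: "r + of_real d \<noteq> 0" using nonres lin(2) by (auto simp: complex_eq_iff)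
  have rr: "r\<^sup>2 + 2 * of_real d * r + 4 * of_real e \<noteq> 0"
  proof
    assume "r\<^sup>2 + 2 * of_real d * r + 4 * of_real e = 0"
    hence "(r + of_real d)\<^sup>2 = of_real (d\<^sup>2 - 4 * e)" by (simp add: power2_sum algebra_simps)
    also have "d\<^sup>2 - 4 * e = - 4 * \<beta>\<^sup>2" using lin by (simp add: algebra_simps)
    finally have *: "Re ((r + of_real d)\<^sup>2) = - 4 * \<beta>\<^sup>2" "Im ((r + of_real d)\<^sup>2) = 0" by simp_all
    define a b where "a = Re (r + of_real d)" and "b = Im (r + of_real d)"
    have "a\<^sup>2 - b\<^sup>2 = - 4 * \<beta>\<^sup>2" "2 * a * b = 0" using * by (simp_all add: a_def b_def power2_eq_square algebra_simps)
    moreover have "a \<noteq> 0" using nonres lin(2) by (simp add: a_def)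
    ultimately have "a\<^sup>2 = - 4 * \<beta>\<^sup>2" by simp
    moreover have "a\<^sup>2 > 0" using \<open>a \<noteq> 0\<close> by simp
    moreover have "\<beta>\<^sup>2 \<ge> 0" by simp
    ultimately show False by linarith
  qed
  have eqs: "r * b20 = - (of_real e * b11)" "(r + of_real d) * b11 = 2 * b20 - 2 * of_real e * b02"
    "(r + 2 * of_real d) * b02 = b11"
    using eq by (simp_all add: scaleR_conv_of_real algebra_simps)
  have "(r + of_real d) * (r\<^sup>2 + 2 * of_real d * r + 4 * of_real e) * b11
      = r * (r + 2 * of_real d) * ((r + of_real d) * b11) + 4 * of_real e * (r + of_real d) * b11"
    by (simp add: algebra_simps power2_eq_square)
  also have "\<dots> = 2 * (r + 2 * of_real d) * (r * b20) - 2 * of_real e * r * ((r + 2 * of_real d) * b02)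
      + 4 * of_real e * (r + of_real d) * b11"
    unfolding eqs(2) by (simp add: algebra_simps)
  also have "\<dots> = 0" unfolding eqs(1,3) by (simp add: algebra_simps)
  finally have b11: "b11 = 0" using rd rr by simp
  have b20: "b20 = of_real e * b02" using eqs(2) b11 by simp
  have "b02 = 0"
  proof (rule ccontr)
    assume "b02 \<noteq> 0"
    hence "r = 0" "r + 2 * of_real d = 0" using eqs(1,3) b11 b20 e by auto
    thus False using rd by auto
  qed
  thus ?thesis using b11 b20 by simp
qed

text \<open>After elimination of \<open>w~\<close>, the rows of \<open>L w = s\<close> compare the coefficients of \<open>x\<^sup>2\<close>, \<open>x v\<close>, \<open>v\<^sup>2\<close> in the
  modal equation for the quadratic forms with the coefficients \<open>w\<close> and \<open>w~\<close>.\<close>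

lemma L_matrix_equations:
  fixes w11 w12 w22 s20 s11 s02 :: real
  assumes L: "L_matrix \<omega> \<zeta> \<omega>i \<zeta>i *v vector [w11, w12, w22] = vector [s20, s11, s02]"
    and wt11: "wt11 = - 2 * \<omega>\<^sup>2 * w12"
    and wt12: "wt12 = w11 - 2 * \<zeta> * \<omega> * w12 - \<omega>\<^sup>2 * w22"
    and wt22: "wt22 = 2 * w12 - 4 * \<zeta> * \<omega> * w22"
  shows "- 2 * \<omega>\<^sup>2 * wt12 + 2 * \<zeta>i * \<omega>i * wt11 + \<omega>i\<^sup>2 * w11 + s20 = 0"
    and "wt11 - 2 * \<zeta> * \<omega> * wt12 - \<omega>\<^sup>2 * wt22 + 2 * \<zeta>i * \<omega>i * wt12 + \<omega>i\<^sup>2 * w12 + s11 = 0"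
    and "2 * wt12 - 4 * \<zeta> * \<omega> * wt22 + 2 * \<zeta>i * \<omega>i * wt22 + \<omega>i\<^sup>2 * w22 + s02 = 0"
proof -
  have comp: "(L_matrix \<omega> \<zeta> \<omega>i \<zeta>i *v vector [w11, w12, w22]) $ k = (vector [s20, s11, s02] :: real^3) $ k" for k
    using L by simp
  note exp = L_matrix_def matrix_vector_mult_def sum_3 vector_3
  show "- 2 * \<omega>\<^sup>2 * wt12 + 2 * \<zeta>i * \<omega>i * wt11 + \<omega>i\<^sup>2 * w11 + s20 = 0"
    using comp[of 1] unfolding wt11 wt12 wt22
    by (simp add: exp algebra_simps power2_eq_square power3_eq_cube power4_eq_xxxx)
  show "wt11 - 2 * \<zeta> * \<omega> * wt12 - \<omega>\<^sup>2 * wt22 + 2 * \<zeta>i * \<omega>i * wt12 + \<omega>i\<^sup>2 * w12 + s11 = 0"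
    using comp[of 2] unfolding wt11 wt12 wt22
    by (simp add: exp algebra_simps power2_eq_square power3_eq_cube power4_eq_xxxx)
  show "2 * wt12 - 4 * \<zeta> * \<omega> * wt22 + 2 * \<zeta>i * \<omega>i * wt22 + \<omega>i\<^sup>2 * w22 + s02 = 0"
    using comp[of 3] unfolding wt11 wt12 wt22
    by (simp add: exp algebra_simps power2_eq_square power3_eq_cube power4_eq_xxxx)
qed

text \<open>The first order form of the modal equation: the first three identities say that \<open>g\<close>, the quadratic part of
  \<open>\<eta>~ - r1 \<eta>\<close>, satisfies \<open>g' = r2 g - s\<close> along the linear flow, where \<open>s\<close> is the quadratic force, the other three that
  the quadratic part of \<open>\<eta>\<close> satisfies \<open>\<eta>' = r1 \<eta> + g\<close>.\<close>

lemma modal_factorization: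
  fixes w11 w12 w22 s20 s11 s02 wt11 wt12 wt22 :: real and r1 r2 :: complex
  assumes L: "L_matrix \<omega> \<zeta> \<omega>i \<zeta>i *v vector [w11, w12, w22] = vector [s20, s11, s02]"
    and wt11: "wt11 = - 2 * \<omega>\<^sup>2 * w12"
    and wt12: "wt12 = w11 - 2 * \<zeta> * \<omega> * w12 - \<omega>\<^sup>2 * w22"
    and wt22: "wt22 = 2 * w12 - 4 * \<zeta> * \<omega> * w22"
    and r: "r1 + r2 = - of_real (2 * \<zeta>i * \<omega>i)" "r1 * r2 = of_real (\<omega>i\<^sup>2)"
    and d: "d = 2 * \<zeta> * \<omega>" and e: "e = \<omega>\<^sup>2"
  defines "g20 \<equiv> of_real wt11 - r1 * of_real w11"
    and "g11 \<equiv> of_real (2 * wt12) - r1 * of_real (2 * w12)"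
    and "g02 \<equiv> of_real wt22 - r1 * of_real w22"
  shows "r2 * g20 + of_real (- s20) = - (e *\<^sub>R g11)"
    and "r2 * g11 + of_real (- 2 * s11) = 2 *\<^sub>R g20 - d *\<^sub>R g11 - (2 * e) *\<^sub>R g02"
    and "r2 * g02 + of_real (- s02) = g11 - (2 * d) *\<^sub>R g02"
    and "r1 * of_real w11 + g20 = - (e *\<^sub>R of_real (2 * w12))"
    and "r1 * of_real (2 * w12) + g11
      = 2 *\<^sub>R of_real w11 - d *\<^sub>R of_real (2 * w12) - (2 * e) *\<^sub>R of_real w22"
    and "r1 * of_real w22 + g02 = of_real (2 * w12) - (2 * d) *\<^sub>R of_real w22"
proof -
  note eqs = L_matrix_equations[OF L wt11 wt12 wt22]
  have r2: "r2 = - of_real (2 * \<zeta>i * \<omega>i) - r1" using r(1) by (simp add: algebra_simps)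
  have prod: "r1 * r2 * z = of_real (\<omega>i\<^sup>2) * z" for z using r(2) by simp
  have split: "r2 * (of_real a - r1 * of_real b) = - r1 * of_real a - of_real (2 * \<zeta>i * \<omega>i * a + \<omega>i\<^sup>2 * b)"
    for a b
  proof -
    have "r2 * (of_real a - r1 * of_real b) = r2 * of_real a - r1 * r2 * of_real b"
      by (simp add: algebra_simps)
    also have "\<dots> = - r1 * of_real a - of_real (2 * \<zeta>i * \<omega>i * a + \<omega>i\<^sup>2 * b)"
      unfolding prod by (simp add: r2 algebra_simps)
    finally show ?thesis .
  qed
  have s: "s20 = 2 * \<omega>\<^sup>2 * wt12 - (2 * \<zeta>i * \<omega>i * wt11 + \<omega>i\<^sup>2 * w11)"
    "2 * s11 = - 2 * wt11 + 2 * d * wt12 + 2 * e * wt22 - (2 * \<zeta>i * \<omega>i * (2 * wt12) + \<omega>i\<^sup>2 * (2 * w12))"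
    "s02 = - 2 * wt12 + 2 * d * wt22 - (2 * \<zeta>i * \<omega>i * wt22 + \<omega>i\<^sup>2 * w22)"
    using eqs by (simp_all add: d e algebra_simps)
  show "r2 * g20 + of_real (- s20) = - (e *\<^sub>R g11)"
    unfolding g20_def g11_def split s(1)
    by (simp add: e wt11 scaleR_conv_of_real algebra_simps)
  show "r2 * g11 + of_real (- 2 * s11) = 2 *\<^sub>R g20 - d *\<^sub>R g11 - (2 * e) *\<^sub>R g02"
  proof -
    have "of_real (- 2 * s11) = (- of_real (2 * s11) :: complex)" by simp
    thus ?thesis unfolding g20_def g11_def g02_def split s(2)
      by (simp add: d e wt12 scaleR_conv_of_real algebra_simps)
  qed
  show "r2 * g02 + of_real (- s02) = g11 - (2 * d) *\<^sub>R g02"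
    unfolding g11_def g02_def split s(3)
    by (simp add: d wt22 scaleR_conv_of_real algebra_simps)
  show "r1 * of_real w11 + g20 = - (e *\<^sub>R of_real (2 * w12))"
    by (simp add: g20_def wt11 e scaleR_conv_of_real algebra_simps)
  show "r1 * of_real (2 * w12) + g11
      = 2 *\<^sub>R of_real w11 - d *\<^sub>R of_real (2 * w12) - (2 * e) *\<^sub>R of_real w22"
    by (simp add: g11_def wt12 d e scaleR_conv_of_real algebra_simps)
  show "r1 * of_real w22 + g02 = of_real (2 * w12) - (2 * d) *\<^sub>R of_real w22"
    by (simp add: g02_def wt22 d scaleR_conv_of_real algebra_simps)
qed

text \<open>A vector in the kernel solves the modal equation without force.  By the factorization the derivation on
  quadratic forms maps \<open>g\<close> to \<open>r2 g\<close>, so \<open>g = 0\<close>; then it maps the form with the coefficients \<open>w\<close> to its multiple by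
  \<open>r1\<close>, so \<open>w = 0\<close>.\<close>

lemma L_matrix_invertible:
  fixes r1 r2 :: complex
  assumes lin: "\<beta> \<noteq> 0" "2 * \<zeta> * \<omega> = - 2 * \<alpha>" "\<omega>\<^sup>2 = \<alpha>\<^sup>2 + \<beta>\<^sup>2"
    and r: "r1 + r2 = - of_real (2 * \<zeta>i * \<omega>i)" "r1 * r2 = of_real (\<omega>i\<^sup>2)"
    and nonres: "Re r1 \<noteq> 2 * \<alpha>" "Re r2 \<noteq> 2 * \<alpha>"
  shows "invertible (L_matrix \<omega> \<zeta> \<omega>i \<zeta>i)"
proof -
  have "w = 0" if L: "L_matrix \<omega> \<zeta> \<omega>i \<zeta>i *v w = 0" for w
  proof -
    have v: "w = vector [w $ 1, w $ 2, w $ 3]" by (simp add: vec_eq_iff forall_3 vector_3)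
    have L0: "L_matrix \<omega> \<zeta> \<omega>i \<zeta>i *v vector [w $ 1, w $ 2, w $ 3] = vector [0, 0, 0]"
      using L unfolding v[symmetric] by (simp add: vec_eq_iff forall_3 vector_3)
    note f = modal_factorization[OF L0 refl refl refl r refl refl]
    have "of_real (- 2 * \<omega>\<^sup>2 * w $ 2) - r1 * of_real (w $ 1) = 0 \<and>
       of_real (2 * (w $ 1 - 2 * \<zeta> * \<omega> * w $ 2 - \<omega>\<^sup>2 * w $ 3)) - r1 * of_real (2 * w $ 2) = 0 \<and>
       of_real (2 * w $ 2 - 4 * \<zeta> * \<omega> * w $ 3) - r1 * of_real (w $ 3) = 0"
      by (rule quadratic_form_eigenvalue[OF lin nonres(2)]) (use f(1-3) in simp_all)
    hence g: "of_real (- 2 * \<omega>\<^sup>2 * w $ 2) - r1 * of_real (w $ 1) = 0"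
       "of_real (2 * (w $ 1 - 2 * \<zeta> * \<omega> * w $ 2 - \<omega>\<^sup>2 * w $ 3)) - r1 * of_real (2 * w $ 2) = 0"
       "of_real (2 * w $ 2 - 4 * \<zeta> * \<omega> * w $ 3) - r1 * of_real (w $ 3) = 0" by blast+
    have "complex_of_real (w $ 1) = 0 \<and> complex_of_real (2 * w $ 2) = 0 \<and> complex_of_real (w $ 3) = 0"
      by (rule quadratic_form_eigenvalue[OF lin nonres(1) f(4-6)[unfolded g add_0_right]])
    thus ?thesis by (simp add: vec_eq_iff forall_3)
  qed
  thus ?thesis
    by (simp add: invertible_left_inverse matrix_left_invertible_ker)
qed

lemma qform_of_real: "qform (of_real a) (of_real b) (of_real c) x v = (of_real (qform a b c x v) :: complex)"
  by (simp add: qform_def scaleR_conv_of_real)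

text \<open>As for first order equations, \<open>Y\<close> and \<open>Z\<close> are the values of \<open>H\<close> and \<open>H'\<close> on the nonlinear
  trajectory, and \<open>s11\<close> is the off-diagonal entry of a symmetric matrix, whence the factor 2.\<close>

definition second_order_along_flow where
  "second_order_along_flow d e \<Omega> \<kappa> \<mu> s20 s11 s02 (H :: real \<Rightarrow> real \<Rightarrow> real \<Rightarrow> real) H' C \<rho> \<longleftrightarrow>
     (\<forall>X V t \<theta>. linear_flow d e X V t \<longrightarrow> 0 < amp (X t) (V t) \<longrightarrow> amp (X t) (V t) \<le> \<rho> \<longrightarrow>
       (\<exists>Y Z z'. Y t = H (X t) (V t) (\<theta> + \<Omega> * t) \<and> Z t = H' (X t) (V t) (\<theta> + \<Omega> * t) \<and>
         (Y has_real_derivative Z t) (at t) \<and> (Z has_real_derivative z') (at t) \<and>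
         \<bar>z' + \<kappa> * Z t + \<mu> * Y t + qform s20 (2 * s11) s02 (X t) (V t)\<bar> \<le> C * amp (X t) (V t) ^ 3 \<and>
         (\<forall>\<^sub>F \<tau> in at t. \<bar>H (X \<tau>) (V \<tau>) (\<theta> + \<Omega> * \<tau>) - Y \<tau>\<bar> \<le> C * amp (X t) (V t) ^ 3 * \<bar>\<tau> - t\<bar>) \<and>
         (\<forall>\<^sub>F \<tau> in at t. \<bar>H' (X \<tau>) (V \<tau>) (\<theta> + \<Omega> * \<tau>) - Z \<tau>\<bar> \<le> C * amp (X t) (V t) ^ 3 * \<bar>\<tau> - t\<bar>)))"

text \<open>The factorization is applied twice, first to \<open>\<eta>~ - r1 \<eta>\<close> and then to \<open>\<eta>\<close>.  Working with one root at a
  time covers critically damped modes, where \<open>r1 = r2\<close>.\<close>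

lemma modal_graph_leading:
  fixes H H' :: "real \<Rightarrow> real \<Rightarrow> real \<Rightarrow> real" and r1 r2 :: complex
  assumes lin: "\<beta> \<noteq> 0" "2 * \<zeta> * \<omega> = - 2 * \<alpha>" "\<omega>\<^sup>2 = \<alpha>\<^sup>2 + \<beta>\<^sup>2"
    and r: "r1 + r2 = - of_real (2 * \<zeta>i * \<omega>i)" "r1 * r2 = of_real (\<omega>i\<^sup>2)"
    and nonres: "Re r1 \<noteq> 2 * \<alpha>" "Re r2 \<noteq> 2 * \<alpha>"
    and K: "0 \<le> K" and \<rho>: "0 < \<rho>"
    and jet: "\<And>\<phi>. quad_expansion (\<lambda>x v. H x v \<phi>) K \<rho>"
    and jet': "\<And>\<phi>. quad_expansion (\<lambda>x v. H' x v \<phi>) K \<rho>"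
    and dyn: "second_order_along_flow (2 * \<zeta> * \<omega>) (\<omega>\<^sup>2) \<Omega> (2 * \<zeta>i * \<omega>i) (\<omega>i\<^sup>2) s20 s11 s02 H H' K \<rho>"
    and L: "L_matrix \<omega> \<zeta> \<omega>i \<zeta>i *v vector [w11, w12, w22] = vector [s20, s11, s02]"
    and wt11: "wt11 = - 2 * \<omega>\<^sup>2 * w12"
    and wt12: "wt12 = w11 - 2 * \<zeta> * \<omega> * w12 - \<omega>\<^sup>2 * w22"
    and wt22: "wt22 = 2 * w12 - 4 * \<zeta> * \<omega> * w22"
  shows "\<exists>K'\<ge>0. \<forall>\<phi> x v. amp x v \<le> \<rho> \<longrightarrow>
     \<bar>H x v \<phi> - qform w11 (2 * w12) w22 x v\<bar> \<le> K' * amp x v ^ 3 \<and>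
     \<bar>H' x v \<phi> - qform wt11 (2 * wt12) wt22 x v\<bar> \<le> K' * amp x v ^ 3"
proof -
  define C where "C = K + norm r1 * K"
  have C: "K \<le> C" "0 \<le> C" using K by (auto simp: C_def)
  define u where "u x v \<phi> = of_real (H' x v \<phi>) - r1 * of_real (H x v \<phi>)" for x v \<phi>
  define g20 g11 g02 where g: "g20 = of_real wt11 - r1 * of_real w11"
    "g11 = of_real (2 * wt12) - r1 * of_real (2 * w12)"
    "g02 = of_real wt22 - r1 * of_real w22"
  note alg = modal_factorization[OF L wt11 wt12 wt22 r refl refl, folded g]
  have comb: "norm (of_real a - r1 * of_real b) \<le> C * N" if "\<bar>a\<bar> \<le> K * N" "\<bar>b\<bar> \<le> K * N" for a b N :: real
  proof -
    have "norm (of_real a - r1 * of_real b) \<le> \<bar>a\<bar> + norm r1 * \<bar>b\<bar>"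
      by (rule order_trans[OF norm_triangle_ineq4]) (simp add: norm_mult)
    also have "\<dots> \<le> K * N + norm r1 * (K * N)" using that by (intro add_mono mult_left_mono) auto
    finally show ?thesis by (simp add: C_def algebra_simps)
  qed
  have stage1: "norm (u x v \<phi> - qform g20 g11 g02 x v) \<le> C * amp x v ^ 3"
    if "amp x v \<le> \<rho>" for x v \<phi>
  proof (rule invariant_quadratic_part[OF lin nonres(2) C(2) \<rho> _ _ alg(1-3) that, where \<Omega> = \<Omega>])
    fix \<phi>
    obtain a b c where abc: "\<bar>a\<bar> \<le> K" "\<bar>b\<bar> \<le> K" "\<bar>c\<bar> \<le> K" and T: "\<And>x v. amp x v \<le> \<rho> \<Longrightarrow>
        \<bar>H x v \<phi> - qform a b c x v\<bar> \<le> K * amp x v ^ 3" using jet[unfolded quad_expansion_def real_norm_def] by blast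
    obtain a' b' c' where abc': "\<bar>a'\<bar> \<le> K" "\<bar>b'\<bar> \<le> K" "\<bar>c'\<bar> \<le> K" and T': "\<And>x v. amp x v \<le> \<rho> \<Longrightarrow>
        \<bar>H' x v \<phi> - qform a' b' c' x v\<bar> \<le> K * amp x v ^ 3" using jet'[unfolded quad_expansion_def real_norm_def] by blast
    show "quad_expansion (\<lambda>x v. u x v \<phi>) C \<rho>"
      unfolding quad_expansion_def
    proof (intro exI conjI allI impI)
      show "norm (of_real a' - r1 * of_real a) \<le> C" using comb[of a' 1 a] abc abc' by simp
      show "norm (of_real b' - r1 * of_real b) \<le> C" using comb[of b' 1 b] abc abc' by simp
      show "norm (of_real c' - r1 * of_real c) \<le> C" using comb[of c' 1 c] abc abc' by simp
      fix x v :: real assume le: "amp x v \<le> \<rho>"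
      have "u x v \<phi> - qform (of_real a' - r1 * of_real a) (of_real b' - r1 * of_real b)
            (of_real c' - r1 * of_real c) x v
          = of_real (H' x v \<phi> - qform a' b' c' x v) - r1 * of_real (H x v \<phi> - qform a b c x v)"
        by (simp add: u_def qform_def scaleR_conv_of_real algebra_simps)
      thus "norm (u x v \<phi> - qform (of_real a' - r1 * of_real a) (of_real b' - r1 * of_real b)
            (of_real c' - r1 * of_real c) x v) \<le> C * amp x v ^ 3"
        using comb[OF T'[OF le] T[OF le]] by metis
    qed
  next
    show "first_order_along_flow (2 * \<zeta> * \<omega>) (\<omega>\<^sup>2) \<Omega> r2 (of_real (- s20)) (of_real (- 2 * s11))
        (of_real (- s02)) u C \<rho>"
      unfolding first_order_along_flow_def
    proof (intro allI impI, goal_cases)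
      case (1 X V t \<theta>)
      note flow = 1(1) and n = 1(2,3)
      define N where "N = (amp (X t) (V t)) ^ 3"
      have N: "0 \<le> N" by (simp add: N_def)
      obtain Y Z z' where YZ: "Y t = H (X t) (V t) (\<theta> + \<Omega> * t)" "Z t = H' (X t) (V t) (\<theta> + \<Omega> * t)"
         and YD: "(Y has_real_derivative Z t) (at t)" and ZD: "(Z has_real_derivative z') (at t)"
         and eq: "\<bar>z' + 2 * \<zeta>i * \<omega>i * Z t + \<omega>i\<^sup>2 * Y t + qform s20 (2 * s11) s02 (X t) (V t)\<bar> \<le> K * N"
         and ev: "\<forall>\<^sub>F \<tau> in at t. \<bar>H (X \<tau>) (V \<tau>) (\<theta> + \<Omega> * \<tau>) - Y \<tau>\<bar> \<le> K * N * \<bar>\<tau> - t\<bar>"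
           "\<forall>\<^sub>F \<tau> in at t. \<bar>H' (X \<tau>) (V \<tau>) (\<theta> + \<Omega> * \<tau>) - Z \<tau>\<bar> \<le> K * N * \<bar>\<tau> - t\<bar>"
        using dyn[unfolded second_order_along_flow_def, rule_format, OF flow n, of \<theta>, folded N_def]
        by (elim exE conjE) (rule that)
      have UD: "((\<lambda>\<tau>. of_real (Z \<tau>) - r1 * of_real (Y \<tau>)) has_vector_derivative
          of_real z' - r1 * of_real (Z t)) (at t)"
        using YD ZD by (auto intro!: derivative_eq_intros has_vector_derivative_of_real)
      show ?case
      proof (intro exI conjI)
        show "of_real (Z t) - r1 * of_real (Y t) = u (X t) (V t) (\<theta> + \<Omega> * t)"
          by (simp add: u_def YZ)
        show "((\<lambda>\<tau>. of_real (Z \<tau>) - r1 * of_real (Y \<tau>)) has_vector_derivative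
          of_real z' - r1 * of_real (Z t)) (at t)" by (rule UD)
        have "of_real z' - r1 * of_real (Z t) - r2 * (of_real (Z t) - r1 * of_real (Y t))
             - qform (of_real (- s20)) (of_real (- 2 * s11)) (of_real (- s02)) (X t) (V t)
           = of_real z' - (r1 + r2) * of_real (Z t) + (r1 * r2) * of_real (Y t)
             - of_real (qform (- s20) (- 2 * s11) (- s02) (X t) (V t))"
          unfolding qform_of_real by (simp add: algebra_simps)
        also have "\<dots> = of_real (z' + 2 * \<zeta>i * \<omega>i * Z t + \<omega>i\<^sup>2 * Y t + qform s20 (2 * s11) s02 (X t) (V t))"
          unfolding r by (simp add: qform_def)
        finally show "norm (of_real z' - r1 * of_real (Z t) - r2 * (of_real (Z t) - r1 * of_real (Y t))
             - qform (of_real (- s20)) (of_real (- 2 * s11)) (of_real (- s02)) (X t) (V t))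
             \<le> C * amp (X t) (V t) ^ 3"
          unfolding N_def[symmetric]
          using order_trans[OF eq mult_right_mono[OF C(1) N]] by (simp only: norm_of_real)
        from ev show "\<forall>\<^sub>F \<tau> in at t. norm (u (X \<tau>) (V \<tau>) (\<theta> + \<Omega> * \<tau>) - (of_real (Z \<tau>) - r1 * of_real (Y \<tau>)))
             \<le> C * amp (X t) (V t) ^ 3 * \<bar>\<tau> - t\<bar>"
        proof eventually_elim
          case (elim \<tau>)
          have "u (X \<tau>) (V \<tau>) (\<theta> + \<Omega> * \<tau>) - (of_real (Z \<tau>) - r1 * of_real (Y \<tau>))
            = of_real (H' (X \<tau>) (V \<tau>) (\<theta> + \<Omega> * \<tau>) - Z \<tau>) - r1 * of_real (H (X \<tau>) (V \<tau>) (\<theta> + \<Omega> * \<tau>) - Y \<tau>)"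
            by (simp add: u_def algebra_simps)
          note eqn = this
          have 1: "\<bar>H' (X \<tau>) (V \<tau>) (\<theta> + \<Omega> * \<tau>) - Z \<tau>\<bar> \<le> K * (N * \<bar>\<tau> - t\<bar>)"
            and 2: "\<bar>H (X \<tau>) (V \<tau>) (\<theta> + \<Omega> * \<tau>) - Y \<tau>\<bar> \<le> K * (N * \<bar>\<tau> - t\<bar>)"
            using elim by (simp_all only: mult.assoc)
          show ?case unfolding eqn N_def[symmetric] using comb[OF 1 2] by (simp only: mult.assoc)
        qed
      qed
    qed
  qed
  have stage2: "norm (of_real (H x v \<phi>) - qform (of_real w11) (of_real (2 * w12)) (of_real w22) x v :: complex)
      \<le> C * amp x v ^ 3"
    if "amp x v \<le> \<rho>" for x v \<phi>
  proof (rule invariant_quadratic_part[OF lin nonres(1) C(2) \<rho> _ _ alg(4-6) that,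
        where \<Omega> = \<Omega> and u = "\<lambda>x v \<phi>. of_real (H x v \<phi>)"])
    fix \<phi>
    obtain a b c where abc: "\<bar>a\<bar> \<le> K" "\<bar>b\<bar> \<le> K" "\<bar>c\<bar> \<le> K" and T: "\<And>x v. amp x v \<le> \<rho> \<Longrightarrow>
        \<bar>H x v \<phi> - qform a b c x v\<bar> \<le> K * amp x v ^ 3" using jet[unfolded quad_expansion_def real_norm_def] by blast
    show "quad_expansion (\<lambda>x v. complex_of_real (H x v \<phi>)) C \<rho>"
      unfolding quad_expansion_def
    proof (intro exI conjI allI impI)
      show "norm (of_real a :: complex) \<le> C" "norm (of_real b :: complex) \<le> C" "norm (of_real c :: complex) \<le> C"
        using abc C by auto
      fix x v :: real assume le: "amp x v \<le> \<rho>"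
      have "\<bar>H x v \<phi> - qform a b c x v\<bar> \<le> C * amp x v ^ 3"
        by (rule order_trans[OF T[OF le] mult_right_mono[OF C(1)]]) simp
      thus "norm (of_real (H x v \<phi>) - qform (of_real a) (of_real b) (of_real c) x v :: complex)
          \<le> C * amp x v ^ 3"
        unfolding qform_of_real of_real_diff[symmetric] norm_of_real .
    qed
  next
    show "first_order_along_flow (2 * \<zeta> * \<omega>) (\<omega>\<^sup>2) \<Omega> r1 g20 g11 g02 (\<lambda>x v \<phi>. of_real (H x v \<phi>)) C \<rho>"
      unfolding first_order_along_flow_def
    proof (intro allI impI, goal_cases)
      case (1 X V t \<theta>)
      note flow = 1(1) and n = 1(2,3)
      obtain Y Z where YZ: "Y t = H (X t) (V t) (\<theta> + \<Omega> * t)" "Z t = H' (X t) (V t) (\<theta> + \<Omega> * t)"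
         and YD: "(Y has_real_derivative Z t) (at t)"
         and ev: "\<forall>\<^sub>F \<tau> in at t. \<bar>H (X \<tau>) (V \<tau>) (\<theta> + \<Omega> * \<tau>) - Y \<tau>\<bar> \<le> K * amp (X t) (V t) ^ 3 * \<bar>\<tau> - t\<bar>"
        using dyn[unfolded second_order_along_flow_def, rule_format, OF flow n, of \<theta>] by (elim exE conjE) (rule that)
      show ?case
      proof (intro exI conjI)
        show "complex_of_real (Y t) = of_real (H (X t) (V t) (\<theta> + \<Omega> * t))" by (simp add: YZ)
        show "((\<lambda>\<tau>. complex_of_real (Y \<tau>)) has_vector_derivative of_real (Z t)) (at t)"
          using YD by (rule has_vector_derivative_of_real)
        show "norm (of_real (Z t) - r1 * of_real (Y t) - qform g20 g11 g02 (X t) (V t))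
             \<le> C * amp (X t) (V t) ^ 3"
          using stage1[OF n(2), of "\<theta> + \<Omega> * t"] by (simp add: u_def YZ)
        from ev show "\<forall>\<^sub>F \<tau> in at t. norm (complex_of_real (H (X \<tau>) (V \<tau>) (\<theta> + \<Omega> * \<tau>)) - of_real (Y \<tau>))
             \<le> C * amp (X t) (V t) ^ 3 * \<bar>\<tau> - t\<bar>"
        proof eventually_elim
          case (elim \<tau>)
          have "K * amp (X t) (V t) ^ 3 * \<bar>\<tau> - t\<bar> \<le> C * amp (X t) (V t) ^ 3 * \<bar>\<tau> - t\<bar>"
            using C by (intro mult_right_mono) auto
          thus ?case using elim unfolding of_real_diff[symmetric] norm_of_real by linarith
        qed
      qed
    qed
  qed
  define K' where "K' = C + norm r1 * C"
  have K': "0 \<le> K'" "C \<le> K'" using C by (auto simp: K'_def)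
  show ?thesis
  proof (intro exI[of _ K'] conjI K' allI impI)
    fix \<phi> x v :: real assume le: "amp x v \<le> \<rho>"
    define N where "N = (amp x v) ^ 3"
    have N: "0 \<le> N" by (simp add: N_def)
    have s2: "\<bar>H x v \<phi> - qform w11 (2 * w12) w22 x v\<bar> \<le> C * N"
      using stage2[OF le, of \<phi>] unfolding qform_of_real of_real_diff[symmetric] norm_of_real N_def .
    thus "\<bar>H x v \<phi> - qform w11 (2 * w12) w22 x v\<bar> \<le> K' * amp x v ^ 3"
      using mult_right_mono[OF K'(2) N] by (simp add: N_def)
    have "of_real (H' x v \<phi> - qform wt11 (2 * wt12) wt22 x v)
        = (u x v \<phi> - qform g20 g11 g02 x v) + r1 * of_real (H x v \<phi> - qform w11 (2 * w12) w22 x v)"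
      by (simp add: u_def g qform_def scaleR_conv_of_real algebra_simps)
    hence "\<bar>H' x v \<phi> - qform wt11 (2 * wt12) wt22 x v\<bar>
        = norm ((u x v \<phi> - qform g20 g11 g02 x v) + r1 * of_real (H x v \<phi> - qform w11 (2 * w12) w22 x v))"
      by (metis norm_of_real)
    also have "\<dots> \<le> norm (u x v \<phi> - qform g20 g11 g02 x v) + norm r1 * \<bar>H x v \<phi> - qform w11 (2 * w12) w22 x v\<bar>"
      by (rule order_trans[OF norm_triangle_ineq]) (simp only: norm_mult norm_of_real order_refl)
    also have "\<dots> \<le> C * N + norm r1 * (C * N)"
      using stage1[OF le, of \<phi>] s2 by (intro add_mono mult_left_mono) (auto simp: N_def)
    finally show "\<bar>H' x v \<phi> - qform wt11 (2 * wt12) wt22 x v\<bar> \<le> K' * amp x v ^ 3"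
      by (simp add: K'_def N_def algebra_simps)
  qed
qed

section \<open>Expansion of polynomial forces along small arguments\<close>

lemma mpow_0: "mpow y 0 = 1"
  by (simp add: mpow_def)

lemma mpow_axis: "mpow y (axis i 1) = y $ i"
proof -
  have "mpow y (axis i 1) = (\<Prod>j\<in>UNIV. if j = i then y $ j else 1)"
    unfolding mpow_def by (rule prod.cong) (auto simp: axis_def)
  thus ?thesis by simp
qed

lemma mdeg_eq_0_iff: "mdeg u = 0 \<longleftrightarrow> u = 0"
  by (auto simp: mdeg_def vec_eq_iff)

lemma mdeg_axis: "mdeg (axis i 1) = 1"
  by (simp add: mdeg_def axis_def)

lemma mdeg_eq_1_imp_axis:
  assumes "mdeg u = 1"
  obtains i where "u = axis i 1"
proof -
  obtain i where i: "u $ i = 1" "\<And>j. j \<noteq> i \<Longrightarrow> u $ j = 0"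
    using assms unfolding mdeg_def by (auto simp: sum_eq_Suc0_iff)
  hence "u = axis i 1" by (auto simp: vec_eq_iff axis_def)
  thus thesis by (rule that)
qed

lemma mpow_bound:
  assumes "\<And>i. \<bar>y $ i\<bar> \<le> Y"
  shows "\<bar>mpow y u\<bar> \<le> Y ^ mdeg u"
proof -
  have "\<bar>mpow y u\<bar> = (\<Prod>i\<in>UNIV. \<bar>y $ i\<bar> ^ (u $ i))"
    by (simp add: mpow_def abs_prod power_abs)
  also have "\<dots> \<le> (\<Prod>i\<in>UNIV. Y ^ (u $ i))"
    using assms by (intro prod_mono conjI power_mono) auto
  also have "\<dots> = Y ^ mdeg u" by (simp add: mdeg_def power_sum)
  finally show ?thesis .
qed

lemma mech_poly_eq_cubic:
  assumes "l \<le> 3" "\<And>i j u w. i + j + mdeg u + mdeg w > l \<Longrightarrow> p i j u w = 0"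
  shows "mech_poly l p = mech_poly 3 p"
proof -
  have "i + j + mdeg u + mdeg w \<le> l" if "p i j u w \<noteq> 0" for i j u w
    using assms(2) that not_le by blast
  thus ?thesis
    unfolding mech_poly_def using assms(1)
    by (intro ext sum.mono_neutral_left finite_orders) (auto simp: orders_def)
qed

lemma mech_poly_component:
  "mech_poly l q x v y y' $ i = mech_poly l (\<lambda>j k u w. q j k u w $ i) x v y y'"
  by (simp add: mech_poly_def sum_component case_prod_unfold)

text \<open>The terms of \<open>P\<close> that survive in the reduced model: for arguments \<open>y, y'\<close> of second order the products of two
  of them, and their products with quadratic monomials in \<open>(x, v)\<close>, are of fourth order.\<close>

definition mech_leading ::
  "(nat \<Rightarrow> nat \<Rightarrow> nat^'n \<Rightarrow> nat^'n \<Rightarrow> real) \<Rightarrow> real \<Rightarrow> real \<Rightarrow> real^'n \<Rightarrow> real^'n \<Rightarrow> real" where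
  "mech_leading p x v y y' =
     p 2 0 0 0 * x\<^sup>2 + p 1 1 0 0 * x * v + p 0 2 0 0 * v\<^sup>2
     + p 3 0 0 0 * x ^ 3 + p 2 1 0 0 * x\<^sup>2 * v + p 1 2 0 0 * x * v\<^sup>2 + p 0 3 0 0 * v ^ 3
     + (x *\<^sub>R coeffs_y p 1 0 + v *\<^sub>R coeffs_y p 0 1) \<bullet> y
     + (x *\<^sub>R coeffs_y' p 1 0 + v *\<^sub>R coeffs_y' p 0 1) \<bullet> y'"

text \<open>Terms are sorted by their total degree in \<open>(y, y')\<close>.  The monomials of degree 0, and those of degree 1 with a single
  factor \<open>x\<close> or \<open>v\<close>, are listed explicitly; each of the others contains two factors from \<open>(y, y')\<close>,
  or one such factor and two from \<open>(x, v)\<close>.\<close>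

lemma mech_poly_leading:
  fixes p :: "nat \<Rightarrow> nat \<Rightarrow> nat^'n \<Rightarrow> nat^'n \<Rightarrow> real"
  shows "\<exists>C\<ge>0. \<forall>x v y y' Y. amp x v \<le> 1 \<longrightarrow> Y \<le> 1 \<longrightarrow> (\<forall>i. \<bar>y $ i\<bar> \<le> Y) \<longrightarrow> (\<forall>i. \<bar>y' $ i\<bar> \<le> Y) \<longrightarrow>
     \<bar>mech_poly 3 p x v y y' - mech_leading p x v y y'\<bar> \<le> C * ((amp x v)\<^sup>2 * Y + Y\<^sup>2)"
proof -
  define J where "J = {(2::nat, 0::nat), (1, 1), (0, 2), (3, 0), (2, 1), (1, 2), (0, 3)}"
  define A0 where "A0 = (\<lambda>(j, k). (j, k, 0 :: nat^'n, 0 :: nat^'n)) ` J"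
  define A1 where "A1 j k = (\<lambda>i :: 'n. (j :: nat, k :: nat, axis i 1 :: nat^'n, 0 :: nat^'n)) ` UNIV" for j k
  define A2 where "A2 j k = (\<lambda>i :: 'n. (j :: nat, k :: nat, 0 :: nat^'n, axis i 1 :: nat^'n)) ` UNIV" for j k
  let ?main = "A0 \<union> (A1 1 0 \<union> (A1 0 1 \<union> (A2 1 0 \<union> A2 0 1)))"
  define R where "R = orders 3 - ?main"
  define C where "C = (\<Sum>(j, k, u, w)\<in>R. \<bar>p j k u w\<bar>)"
  have ax: "axis i 1 \<noteq> (0 :: nat^'n)" for i :: 'n by (simp add: axis_eq_0_iff)
  have md0: "mdeg (0 :: nat^'n) = 0" by (simp add: mdeg_eq_0_iff)
  have sub: "?main \<subseteq> orders 3"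
    by (auto simp: A0_def A1_def A2_def J_def orders_def mdeg_axis[unfolded One_nat_def] md0)
  have finR: "finite R" by (simp add: R_def finite_orders)
  have C: "0 \<le> C" by (auto simp: C_def intro!: sum_nonneg)
  have "\<bar>mech_poly 3 p x v y y' - mech_leading p x v y y'\<bar> \<le> C * ((amp x v)\<^sup>2 * Y + Y\<^sup>2)"
    if N1: "amp x v \<le> 1" and Y1: "Y \<le> 1" and y: "\<And>i. \<bar>y $ i\<bar> \<le> Y" and y': "\<And>i. \<bar>y' $ i\<bar> \<le> Y"
    for x v y y' Y
  proof -
    define N where "N = amp x v"
    have N: "0 \<le> N" "N \<le> 1" "\<bar>x\<bar> \<le> N" "\<bar>v\<bar> \<le> N" using N1 by (auto simp: N_def)
    have Y0: "0 \<le> Y" using order_trans[OF abs_ge_zero y] .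
    define t where "t = (\<lambda>(j, k, u, w). (x ^ j * v ^ k * mpow y u * mpow y' w) *\<^sub>R p j k u w)"
    have disj: "sum t (X \<union> Z) = sum t X + sum t Z" if "finite X" "finite Z" "X \<inter> Z = {}" for X Z
      using that by (rule sum.union_disjoint)
    have S1: "sum t (A1 j k) = (x ^ j * v ^ k) * (coeffs_y p j k \<bullet> y)" for j k
      unfolding A1_def
      by (subst sum.reindex)
        (auto simp: inj_on_def axis_eq_axis t_def mpow_0 mpow_axis[unfolded One_nat_def]
          coeffs_y_def inner_vec_def sum_distrib_left mult_ac intro!: sum.cong)
    have S2: "sum t (A2 j k) = (x ^ j * v ^ k) * (coeffs_y' p j k \<bullet> y')" for j k
      unfolding A2_def
      by (subst sum.reindex)
        (auto simp: inj_on_def axis_eq_axis t_def mpow_0 mpow_axis[unfolded One_nat_def]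
          coeffs_y'_def inner_vec_def sum_distrib_left mult_ac intro!: sum.cong)
    have "mech_poly 3 p x v y y' = sum t (orders 3)" by (simp add: mech_poly_def t_def)
    also have "\<dots> = sum t ?main + sum t R"
      unfolding R_def using sum.subset_diff[OF sub finite_orders, of t] by simp
    also have "sum t ?main
        = sum t A0 + (sum t (A1 1 0) + (sum t (A1 0 1) + (sum t (A2 1 0) + sum t (A2 0 1))))"
      by (subst disj, simp add: A0_def A1_def A2_def J_def, simp add: A0_def A1_def A2_def J_def,
          force simp: A0_def A1_def A2_def J_def ax)+ (rule refl)
    also have "sum t A0 = (\<Sum>(j, k)\<in>J. x ^ j * v ^ k * p j k 0 0)"
      unfolding A0_def by (subst sum.reindex) (auto simp: inj_on_def t_def mpow_0 intro!: sum.cong)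
    also have "\<dots> = p 2 0 0 0 * x\<^sup>2 + p 1 1 0 0 * x * v + p 0 2 0 0 * v\<^sup>2
        + p 3 0 0 0 * x ^ 3 + p 2 1 0 0 * x\<^sup>2 * v + p 1 2 0 0 * x * v\<^sup>2 + p 0 3 0 0 * v ^ 3"
      by (simp add: J_def algebra_simps)
    finally have "mech_poly 3 p x v y y' - mech_leading p x v y y' = sum t R"
      by (simp add: mech_leading_def inner_add_left S1 S2)
    also have "\<bar>sum t R\<bar> \<le> (\<Sum>\<alpha>\<in>R. \<bar>t \<alpha>\<bar>)" by (rule sum_abs)
    also have "\<dots> \<le> (\<Sum>(j, k, u, w)\<in>R. \<bar>p j k u w\<bar> * (N\<^sup>2 * Y + Y\<^sup>2))"
    proof (rule sum_mono, clarify)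
      fix j k u w assume R: "(j, k, u, w) \<in> R"
      define D where "D = mdeg u + mdeg w"
      have ord: "2 \<le> j + k + D" "j + k + D \<le> 3" using R by (auto simp: R_def orders_def D_def)
      have "\<bar>x ^ j * v ^ k * mpow y u * mpow y' w\<bar> \<le> N ^ j * N ^ k * Y ^ mdeg u * Y ^ mdeg w"
        unfolding abs_mult power_abs using N Y0
        by (intro mult_mono power_mono mpow_bound y y' mult_nonneg_nonneg zero_le_power) auto
      also have "\<dots> = N ^ (j + k) * Y ^ D" by (simp add: power_add D_def)
      also have "\<dots> \<le> N\<^sup>2 * Y + Y\<^sup>2"
      proof -
        have "D \<noteq> 0"
        proof
          assume "D = 0"
          hence "u = 0" "w = 0" by (auto simp: D_def mdeg_eq_0_iff)
          moreover have "(j, k) \<in> J" using ord \<open>D = 0\<close> by (auto simp: J_def)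
          ultimately show False using R by (auto simp: R_def A0_def)
        qed
        moreover have "2 \<le> j + k" if "D = 1"
        proof (rule ccontr)
          assume "\<not> 2 \<le> j + k"
          hence jk: "j = 1 \<and> k = 0 \<or> j = 0 \<and> k = 1" using ord that by auto
          have "mdeg u = 1 \<and> w = 0 \<or> u = 0 \<and> mdeg w = 1"
            using that mdeg_eq_0_iff[of u] mdeg_eq_0_iff[of w] unfolding D_def by linarith
          hence "(\<exists>i. u = axis i 1) \<and> w = 0 \<or> u = 0 \<and> (\<exists>i. w = axis i 1)"
            using mdeg_eq_1_imp_axis by metis
          thus False using R jk by (auto simp: R_def A1_def A2_def)
        qed
        ultimately consider "D = 1" "2 \<le> j + k" | "2 \<le> D" by linarith
        thus ?thesis
        proof cases
          case 1
          have "N ^ (j + k) * Y ^ D \<le> N\<^sup>2 * Y"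
            using 1 N Y0 power_decreasing[OF 1(2) N(1,2)] by (simp add: mult_right_mono)
          thus ?thesis by (simp add: add_increasing2)
        next
          case 2
          have "N ^ (j + k) * Y ^ D \<le> 1 * Y\<^sup>2"
            using N Y0 power_decreasing[OF 2 Y0 Y1] by (intro mult_mono power_le_one) auto
          thus ?thesis using Y0 by (simp add: add_increasing)
        qed
      qed
      finally have "\<bar>x ^ j * v ^ k * mpow y u * mpow y' w\<bar> \<le> N\<^sup>2 * Y + Y\<^sup>2" .
      from mult_right_mono[OF this abs_ge_zero[of "p j k u w"]]
      show "\<bar>t (j, k, u, w)\<bar> \<le> \<bar>p j k u w\<bar> * (N\<^sup>2 * Y + Y\<^sup>2)"
        by (simp add: t_def abs_mult mult_ac)
    qed
    also have "\<dots> = C * (N\<^sup>2 * Y + Y\<^sup>2)"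
      by (simp add: C_def sum_distrib_right case_prod_unfold)
    finally show ?thesis by (simp add: N_def)
  qed
  thus ?thesis using C by blast
qed

lemma abs_matrix_vector_le:
  fixes A :: "real^'n^'m"
  assumes "\<And>j. \<bar>y $ j\<bar> \<le> Y"
  shows "\<bar>(A *v y) $ i\<bar> \<le> (\<Sum>a\<in>UNIV. \<Sum>b\<in>UNIV. \<bar>A $ a $ b\<bar>) * Y"
proof -
  have Y: "0 \<le> Y" using order_trans[OF abs_ge_zero assms] .
  have "\<bar>(A *v y) $ i\<bar> \<le> (\<Sum>b\<in>UNIV. \<bar>A $ i $ b\<bar> * \<bar>y $ b\<bar>)"
    unfolding matrix_vector_mult_def by (simp add: abs_mult[symmetric] sum_abs)
  also have "\<dots> \<le> (\<Sum>b\<in>UNIV. \<bar>A $ i $ b\<bar> * Y)"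
    using assms by (intro sum_mono mult_left_mono) auto
  also have "\<dots> = (\<Sum>b\<in>UNIV. \<bar>A $ i $ b\<bar>) * Y" by (simp add: sum_distrib_right)
  also have "\<dots> \<le> (\<Sum>a\<in>UNIV. \<Sum>b\<in>UNIV. \<bar>A $ a $ b\<bar>) * Y"
    using Y by (intro mult_right_mono member_le_sum[of i UNIV "\<lambda>a. \<Sum>b\<in>UNIV. \<bar>A $ a $ b\<bar>"])
      (auto intro: sum_nonneg)
  finally show ?thesis .
qed

lemma abs_inner_pencil_le:
  fixes a b z :: "real^'n"
  assumes z: "\<And>i. \<bar>z $ i\<bar> \<le> Y"
  shows "\<bar>(x *\<^sub>R a + v *\<^sub>R b) \<bullet> z\<bar> \<le> (\<Sum>i\<in>UNIV. \<bar>a $ i\<bar> + \<bar>b $ i\<bar>) * ((amp x v) * Y)"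
proof -
  define N where "N = amp x v"
  have N: "0 \<le> N" "\<bar>x\<bar> \<le> N" "\<bar>v\<bar> \<le> N" by (auto simp: N_def)
  have "\<bar>(x *\<^sub>R a + v *\<^sub>R b) \<bullet> z\<bar> \<le> (\<Sum>i\<in>UNIV. \<bar>(x * a $ i + v * b $ i) * z $ i\<bar>)"
    by (simp add: inner_vec_def sum_abs)
  also have "\<dots> \<le> (\<Sum>i\<in>UNIV. (\<bar>a $ i\<bar> + \<bar>b $ i\<bar>) * N * Y)"
  proof (rule sum_mono)
    fix i
    have "\<bar>x * a $ i + v * b $ i\<bar> \<le> N * \<bar>a $ i\<bar> + N * \<bar>b $ i\<bar>"
      using N by (intro order_trans[OF abs_triangle_ineq] add_mono)
        (auto simp: abs_mult intro!: mult_right_mono)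
    hence "\<bar>x * a $ i + v * b $ i\<bar> * \<bar>z $ i\<bar> \<le> (N * \<bar>a $ i\<bar> + N * \<bar>b $ i\<bar>) * Y"
      using z N by (intro mult_mono) auto
    thus "\<bar>(x * a $ i + v * b $ i) * z $ i\<bar> \<le> (\<bar>a $ i\<bar> + \<bar>b $ i\<bar>) * N * Y"
      by (simp only: abs_mult) (simp add: algebra_simps)
  qed
  finally show ?thesis by (simp add: N_def sum_distrib_right mult.assoc)
qed

lemma mech_poly_bounds:
  fixes p :: "nat \<Rightarrow> nat \<Rightarrow> nat^'n \<Rightarrow> nat^'n \<Rightarrow> real"
  shows "\<exists>C\<ge>0. \<forall>x v y y' Y. amp x v \<le> 1 \<longrightarrow> Y \<le> 1 \<longrightarrow> (\<forall>i. \<bar>y $ i\<bar> \<le> Y) \<longrightarrow> (\<forall>i. \<bar>y' $ i\<bar> \<le> Y) \<longrightarrow>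
     \<bar>mech_poly 3 p x v y y'\<bar> \<le> C * ((amp x v)\<^sup>2 + Y) \<and>
     \<bar>mech_poly 3 p x v y y' - mech_poly 3 p x v 0 0\<bar> \<le> C * ((amp x v) * Y + Y\<^sup>2)"
proof -
  obtain C0 where C0: "0 \<le> C0" and L: "\<And>x v y y' Y. amp x v \<le> 1 \<Longrightarrow> Y \<le> 1 \<Longrightarrow>
     (\<And>i. \<bar>y $ i\<bar> \<le> Y) \<Longrightarrow> (\<And>i. \<bar>y' $ i\<bar> \<le> Y) \<Longrightarrow>
     \<bar>mech_poly 3 p x v y y' - mech_leading p x v y y'\<bar> \<le> C0 * ((amp x v)\<^sup>2 * Y + Y\<^sup>2)"
    using mech_poly_leading[of p] by blast
  define S where "S = \<bar>p 2 0 0 0\<bar> + \<bar>p 1 1 0 0\<bar> + \<bar>p 0 2 0 0\<bar>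
     + \<bar>p 3 0 0 0\<bar> + \<bar>p 2 1 0 0\<bar> + \<bar>p 1 2 0 0\<bar> + \<bar>p 0 3 0 0\<bar>"
  define U where "U = (\<Sum>i\<in>UNIV. \<bar>coeffs_y p 1 0 $ i\<bar> + \<bar>coeffs_y p 0 1 $ i\<bar>)
     + (\<Sum>i\<in>UNIV. \<bar>coeffs_y' p 1 0 $ i\<bar> + \<bar>coeffs_y' p 0 1 $ i\<bar>)"
  have SU: "0 \<le> S" "0 \<le> U" by (auto simp: S_def U_def intro!: add_nonneg_nonneg sum_nonneg)
  define C where "C = S + 2 * (C0 + U)"
  have main: "\<bar>mech_poly 3 p x v y y'\<bar> \<le> C * ((amp x v)\<^sup>2 + Y) \<and>
     \<bar>mech_poly 3 p x v y y' - mech_poly 3 p x v 0 0\<bar> \<le> C * ((amp x v) * Y + Y\<^sup>2)"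
    if N1: "amp x v \<le> 1" and Y1: "Y \<le> 1" and y: "\<And>i. \<bar>y $ i\<bar> \<le> Y" and y': "\<And>i. \<bar>y' $ i\<bar> \<le> Y"
    for x v y y' Y
  proof -
    define N where "N = amp x v"
    have N: "0 \<le> N" "N \<le> 1" "\<bar>x\<bar> \<le> N" "\<bar>v\<bar> \<le> N" using N1 by (auto simp: N_def)
    have Y0: "0 \<le> Y" using order_trans[OF abs_ge_zero y] .
    note lin = abs_inner_pencil_le[where x = x and v = v and Y = Y, folded N_def]
    define P0 where "P0 = mech_leading p x v 0 0"
    have P0: "mech_poly 3 p x v 0 0 = P0"
      using L[of x v 0 0 0] N1 by (simp add: P0_def)
    have "mech_leading p x v y y' - P0 = (x *\<^sub>R coeffs_y p 1 0 + v *\<^sub>R coeffs_y p 0 1) \<bullet> y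
       + (x *\<^sub>R coeffs_y' p 1 0 + v *\<^sub>R coeffs_y' p 0 1) \<bullet> y'"
      by (simp add: mech_leading_def P0_def)
    also have "\<bar>\<dots>\<bar> \<le> U * (N * Y)"
      unfolding U_def distrib_right using lin[OF y] lin[OF y'] by (intro order_trans[OF abs_triangle_ineq] add_mono)
    finally have "\<bar>mech_poly 3 p x v y y' - P0\<bar> \<le> U * (N * Y) + C0 * (N\<^sup>2 * Y + Y\<^sup>2)"
      using L[OF N1 Y1 y y'] unfolding N_def[symmetric] by linarith
    also have "\<dots> \<le> U * (N * Y + Y\<^sup>2) + C0 * (N * Y + Y\<^sup>2)"
      using N Y0 SU C0 by (intro add_mono mult_left_mono mult_right_mono) (auto simp: power2_eq_square mult_left_le)
    finally have D: "\<bar>mech_poly 3 p x v y y' - P0\<bar> \<le> (U + C0) * (N * Y + Y\<^sup>2)" by (simp add: algebra_simps)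
    have mono: "\<bar>x ^ i * v ^ j\<bar> \<le> N\<^sup>2" if "2 \<le> i + j" for i j
    proof -
      have "\<bar>x ^ i * v ^ j\<bar> \<le> N ^ i * N ^ j" unfolding abs_mult power_abs using N by (intro mult_mono power_mono) auto
      also have "\<dots> \<le> N\<^sup>2" using power_decreasing[OF that N(1,2)] by (simp add: power_add)
      finally show ?thesis .
    qed
    have pm: "\<bar>r * (x ^ i * v ^ j)\<bar> \<le> \<bar>r\<bar> * N\<^sup>2" if "2 \<le> i + j" for r i j
      unfolding abs_mult[of r] using mono[OF that] by (intro mult_left_mono) auto
    have "P0 = p 2 0 0 0 * (x ^ 2 * v ^ 0) + p 1 1 0 0 * (x ^ 1 * v ^ 1) + p 0 2 0 0 * (x ^ 0 * v ^ 2)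
        + p 3 0 0 0 * (x ^ 3 * v ^ 0) + p 2 1 0 0 * (x ^ 2 * v ^ 1) + p 1 2 0 0 * (x ^ 1 * v ^ 2)
        + p 0 3 0 0 * (x ^ 0 * v ^ 3)"
      by (simp add: P0_def mech_leading_def)
    also have "\<bar>\<dots>\<bar> \<le> S * N\<^sup>2"
      unfolding S_def distrib_right
      by (intro order_trans[OF abs_triangle_ineq] add_mono pm) auto
    finally have "\<bar>P0\<bar> \<le> S * N\<^sup>2" .
    moreover have "(U + C0) * (N * Y + Y\<^sup>2) \<le> (U + C0) * (Y + Y)"
      using N Y0 Y1 SU C0 by (intro mult_left_mono add_mono) (auto simp: power2_eq_square mult_left_le mult_left_le_one_le)
    ultimately have "\<bar>mech_poly 3 p x v y y'\<bar> \<le> S * N\<^sup>2 + 2 * (C0 + U) * Y"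
      using D by (simp add: algebra_simps)
    also have "\<dots> \<le> C * N\<^sup>2 + C * Y"
      using SU C0 Y0 by (intro add_mono mult_right_mono) (auto simp: C_def)
    finally have "\<bar>mech_poly 3 p x v y y'\<bar> \<le> C * (N\<^sup>2 + Y)" by (simp add: algebra_simps)
    moreover have "(U + C0) * (N * Y + Y\<^sup>2) \<le> C * (N * Y + Y\<^sup>2)"
      using N Y0 SU C0 by (intro mult_right_mono) (auto simp: C_def)
    ultimately show ?thesis using D unfolding P0 N_def by linarith
  qed
  show ?thesis by (intro exI[of _ C] conjI allI impI) (use SU C0 main in \<open>auto simp: C_def\<close>)
qed

lemma cubic_form_bound:
  fixes x v :: real
  shows "\<bar>r30 * x ^ 3 + r21 * x\<^sup>2 * v + r12 * x * v\<^sup>2 + r03 * v ^ 3\<bar>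
    \<le> (\<bar>r30\<bar> + \<bar>r21\<bar> + \<bar>r12\<bar> + \<bar>r03\<bar>) * amp x v ^ 3"
proof -
  define N where "N = amp x v"
  have pm: "\<bar>r * (x ^ i * v ^ j)\<bar> \<le> \<bar>r\<bar> * N ^ 3" if "i + j = 3" for r i j
  proof -
    have "\<bar>x ^ i * v ^ j\<bar> \<le> N ^ i * N ^ j"
      unfolding abs_mult power_abs by (intro mult_mono power_mono) (auto simp: N_def)
    thus ?thesis unfolding abs_mult[of r] power_add[symmetric] that by (intro mult_left_mono) auto
  qed
  have "r30 * x ^ 3 + r21 * x\<^sup>2 * v + r12 * x * v\<^sup>2 + r03 * v ^ 3
    = r30 * (x ^ 3 * v ^ 0) + r21 * (x ^ 2 * v ^ 1) + r12 * (x ^ 1 * v ^ 2) + r03 * (x ^ 0 * v ^ 3)"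
    by simp
  also have "\<bar>\<dots>\<bar> \<le> (\<bar>r30\<bar> + \<bar>r21\<bar> + \<bar>r12\<bar> + \<bar>r03\<bar>) * N ^ 3"
    unfolding distrib_right by (intro order_trans[OF abs_triangle_ineq] add_mono pm) auto
  finally show ?thesis by (simp add: N_def)
qed

section \<open>The invariant graph in modal coordinates\<close>

lemma quad_jet_bounds:
  assumes "quad_jet f \<phi> C \<rho>" "0 \<le> C" "\<rho> \<le> 1"
  shows quad_jet_lipschitz: "amp x v \<le> s \<Longrightarrow> amp x' v' \<le> s \<Longrightarrow> s \<le> \<rho> \<Longrightarrow>
      \<bar>f x v \<phi> 0 - f x' v' \<phi> 0\<bar> \<le> 4 * C * s * amp (x - x') (v - v')"
    and quad_jet_size: "amp x v \<le> \<rho> \<Longrightarrow> \<bar>f x v \<phi> 0\<bar> \<le> 4 * C * (amp x v)\<^sup>2"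
    and quad_jet_expansion: "quad_expansion (\<lambda>x v. f x v \<phi> 0) C \<rho>"
    and quad_jet_forcing: "amp x v \<le> \<rho> \<Longrightarrow> \<bar>\<epsilon>\<bar> \<le> \<rho> \<Longrightarrow> \<bar>f x v \<phi> \<epsilon> - f x v \<phi> 0\<bar> \<le> C * \<bar>\<epsilon>\<bar>"
proof -
  obtain a b c where z: "f 0 0 \<phi> 0 = 0" and abc: "\<bar>a\<bar> \<le> C" "\<bar>b\<bar> \<le> C" "\<bar>c\<bar> \<le> C"
    and "cubic_remainder (\<lambda>x v. f x v \<phi> 0 - qform a b c x v) C \<rho>" and E: "forcing_lipschitz f \<phi> C \<rho>"
    using assms(1) unfolding quad_jet_def by blast
  note L = this(5)[unfolded cubic_remainder_def, rule_format]
  show lip: "\<bar>f x v \<phi> 0 - f x' v' \<phi> 0\<bar> \<le> 4 * C * s * amp (x - x') (v - v')"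
    if le: "amp x v \<le> s" "amp x' v' \<le> s" "s \<le> \<rho>" for x v x' v' s
  proof -
    define d where "d = amp (x - x') (v - v')"
    have s: "0 \<le> s" and d: "0 \<le> d" "\<bar>x - x'\<bar> \<le> d" "\<bar>v - v'\<bar> \<le> d" using le by (auto simp: d_def)
    have "qform a b c x v - qform a b c x' v'
        = a * ((x + x') * (x - x')) + b * (x * (v - v') + v' * (x - x')) + c * ((v + v') * (v - v'))"
      by (simp add: qform_def power2_eq_square algebra_simps)
    also have "\<bar>\<dots>\<bar> \<le> C * (s * (\<bar>x - x'\<bar> + \<bar>x - x'\<bar>)) + C * (s * d) + C * (s * (\<bar>v - v'\<bar> + \<bar>v - v'\<bar>))"
    proof (intro order_trans[OF abs_triangle_ineq] add_mono)
      have "\<bar>x + x'\<bar> * \<bar>x - x'\<bar> \<le> (s + s) * \<bar>x - x'\<bar>" using le by (intro mult_right_mono) auto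
      hence "\<bar>(x + x') * (x - x')\<bar> \<le> s * (\<bar>x - x'\<bar> + \<bar>x - x'\<bar>)"
        unfolding abs_mult by (simp add: distrib_left distrib_right)
      thus "\<bar>a * ((x + x') * (x - x'))\<bar> \<le> C * (s * (\<bar>x - x'\<bar> + \<bar>x - x'\<bar>))"
        unfolding abs_mult[of a] using abc s by (intro mult_mono) auto
      have "\<bar>v + v'\<bar> * \<bar>v - v'\<bar> \<le> (s + s) * \<bar>v - v'\<bar>" using le by (intro mult_right_mono) auto
      hence "\<bar>(v + v') * (v - v')\<bar> \<le> s * (\<bar>v - v'\<bar> + \<bar>v - v'\<bar>)"
        unfolding abs_mult by (simp add: distrib_left distrib_right)
      thus "\<bar>c * ((v + v') * (v - v'))\<bar> \<le> C * (s * (\<bar>v - v'\<bar> + \<bar>v - v'\<bar>))"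
        unfolding abs_mult[of c] using abc s by (intro mult_mono) auto
      have "\<bar>x * (v - v') + v' * (x - x')\<bar> \<le> s * \<bar>v - v'\<bar> + s * \<bar>x - x'\<bar>"
        using le by (intro order_trans[OF abs_triangle_ineq] add_mono)
          (auto simp: abs_mult intro!: mult_right_mono)
      thus "\<bar>b * (x * (v - v') + v' * (x - x'))\<bar> \<le> C * (s * d)"
        unfolding abs_mult[of b] using abc s by (intro mult_mono) (auto simp: d_def algebra_simps)
    qed
    also have "\<dots> = 3 * C * s * d" by (simp add: d_def algebra_simps)
    finally have q: "\<bar>qform a b c x v - qform a b c x' v'\<bar> \<le> 3 * C * s * d" .
    have "s * s \<le> s * 1" using s le assms(3) by (intro mult_left_mono) auto
    hence "C * s\<^sup>2 * d \<le> C * s * d"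
      using assms(2) d by (intro mult_right_mono mult_left_mono) (auto simp: power2_eq_square)
    thus ?thesis using q L[OF le] unfolding d_def[symmetric] by (simp add: algebra_simps)
  qed
  show "\<bar>f x v \<phi> 0\<bar> \<le> 4 * C * (amp x v)\<^sup>2" if "amp x v \<le> \<rho>" for x v
    using lip[of x v "amp x v" 0 0] that z by (simp add: power2_eq_square mult.assoc)
  have "\<bar>f x v \<phi> 0 - qform a b c x v\<bar> \<le> C * amp x v ^ 3" if "amp x v \<le> \<rho>" for x v
    using L[of x v "amp x v" 0 0] that z by (simp add: qform_def power3_eq_cube power2_eq_square mult.assoc)
  thus "quad_expansion (\<lambda>x v. f x v \<phi> 0) C \<rho>"
    unfolding quad_expansion_def real_norm_def using abc by blast
  show "amp x v \<le> \<rho> \<Longrightarrow> \<bar>\<epsilon>\<bar> \<le> \<rho> \<Longrightarrow> \<bar>f x v \<phi> \<epsilon> - f x v \<phi> 0\<bar> \<le> C * \<bar>\<epsilon>\<bar>"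
    using E by (simp add: forcing_lipschitz_def)
qed

text \<open>For a mass-normalized \<open>\<Phi>\<close> this is the \<open>i\<close>-th component of \<open>\<Phi>\<^sup>-\<^sup>1 h\<close>, since \<open>\<Phi>\<^sup>T M\<close> is then the inverse
  of \<open>\<Phi>\<close>.\<close>

definition modal_graph ::
  "real^'n^'n \<Rightarrow> real^'n^'n \<Rightarrow> (real \<Rightarrow> real \<Rightarrow> real \<Rightarrow> real \<Rightarrow> real^'n) \<Rightarrow> 'n \<Rightarrow>
    real \<Rightarrow> real \<Rightarrow> real \<Rightarrow> real \<Rightarrow> real" where
  "modal_graph \<Phi> M h i x v \<phi> \<epsilon> = (transpose \<Phi> *v (M *v h x v \<phi> \<epsilon>)) $ i"

lemma modal_inverse:
  assumes "modal_matrix M C K \<Phi> \<omega>s \<zeta>s"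
  shows "\<Phi> *v (transpose \<Phi> *v (M *v y)) = y"
proof -
  have "(transpose \<Phi> ** M) ** \<Phi> = mat 1" using assms by (simp add: modal_matrix_def)
  hence "\<Phi> ** (transpose \<Phi> ** M) = mat 1" by (rule matrix_left_right_inverse[THEN iffD1])
  thus ?thesis by (simp add: matrix_vector_mul_assoc matrix_mul_assoc)
qed

lemma modal_damping_stiffness:
  assumes "modal_matrix M C K \<Phi> \<omega>s \<zeta>s"
  shows "(transpose \<Phi> *v (C *v y)) $ i = 2 * \<zeta>s i * \<omega>s i * (transpose \<Phi> *v (M *v y)) $ i"
    and "(transpose \<Phi> *v (K *v y)) $ i = (\<omega>s i)\<^sup>2 * (transpose \<Phi> *v (M *v y)) $ i"
proof -
  define \<eta> where "\<eta> = transpose \<Phi> *v (M *v y)"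
  have y: "y = \<Phi> *v \<eta>" using modal_inverse[OF assms] by (simp add: \<eta>_def)
  have diag: "(diag_matrix d *v \<eta>) $ i = d i * \<eta> $ i" for d
    by (simp add: diag_matrix_def matrix_vector_mult_def if_distrib[of "\<lambda>z. z * _"] cong: if_cong)
  have "transpose \<Phi> *v (C *v y) = (transpose \<Phi> ** C ** \<Phi>) *v \<eta>"
    "transpose \<Phi> *v (K *v y) = (transpose \<Phi> ** K ** \<Phi>) *v \<eta>"
    unfolding y by (simp_all add: matrix_vector_mul_assoc matrix_mul_assoc)
  moreover have "transpose \<Phi> ** C ** \<Phi> = diag_matrix (\<lambda>i. 2 * \<zeta>s i * \<omega>s i)"
    "transpose \<Phi> ** K ** \<Phi> = diag_matrix (\<lambda>i. (\<omega>s i)\<^sup>2)"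
    using assms by (simp_all only: modal_matrix_def)
  ultimately show "(transpose \<Phi> *v (C *v y)) $ i = 2 * \<zeta>s i * \<omega>s i * (transpose \<Phi> *v (M *v y)) $ i"
    "(transpose \<Phi> *v (K *v y)) $ i = (\<omega>s i)\<^sup>2 * (transpose \<Phi> *v (M *v y)) $ i"
    by (simp_all only: diag \<eta>_def[symmetric])
qed

lemma bounded_linear_modal: "bounded_linear (\<lambda>y :: real^'n. (transpose \<Phi> *v (M *v y)) $ i)"
  by (intro bounded_linear_compose[OF bounded_linear_vec_nth]
      bounded_linear_compose[OF matrix_vector_mul_bounded_linear] matrix_vector_mul_bounded_linear)

text \<open>Local invariance of the graph at \<open>\<epsilon> = 0\<close>: the coefficients of the second order part of
  the graph are already determined there.\<close>

definition unforced_invariant where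
  "unforced_invariant m c k P F1 M C K Q F2 \<Omega> \<delta> (h :: real \<Rightarrow> real \<Rightarrow> real \<Rightarrow> real \<Rightarrow> real^'n) h' \<longleftrightarrow>
     (\<forall>t0 x0 v0. norm (x0, v0) < \<delta> \<longrightarrow> (\<exists>\<tau>>0. \<exists>x x' y y'.
         forced_solution m c k P F1 M C K Q F2 \<Omega> 0 {t0 - \<tau><..<t0 + \<tau>} x x' y y' \<and>
         x t0 = x0 \<and> x' t0 = v0 \<and>
         (\<forall>t\<in>{t0 - \<tau><..<t0 + \<tau>}. norm (x t, x' t) < \<delta> \<and>
            y t = h (x t) (x' t) (\<Omega> * t) 0 \<and> y' t = h' (x t) (x' t) (\<Omega> * t) 0)))"

text \<open>Shifting time by \<open>\<theta> / \<Omega>\<close> lets a trajectory start at a prescribed time and phase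
  simultaneously.\<close>

lemma ssm_trajectory_through:
  fixes h h' :: "real \<Rightarrow> real \<Rightarrow> real \<Rightarrow> real \<Rightarrow> real^'n"
  assumes inv: "unforced_invariant m c k P F1 M C K Q F2 \<Omega> \<delta> h h'"
    and \<Omega>: "\<Omega> \<noteq> 0" and z: "norm (x0, v0) < \<delta>"
  obtains x x' a y y' y'' where "x t = x0" "x' t = v0"
    "(x has_real_derivative v0) (at t)" "(x' has_real_derivative a) (at t)"
    "(y has_vector_derivative y' t) (at t)" "(y' has_vector_derivative y'') (at t)"
    "m * a + c * v0 + k * x0 + P x0 v0 (y t) (y' t) = 0"
    "M *v y'' + C *v y' t + K *v y t + Q x0 v0 (y t) (y' t) = 0"
    "\<forall>\<^sub>F \<tau> in nhds t. y \<tau> = h (x \<tau>) (x' \<tau>) (\<theta> + \<Omega> * \<tau>) 0 \<and> y' \<tau> = h' (x \<tau>) (x' \<tau>) (\<theta> + \<Omega> * \<tau>) 0"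
proof -
  define s where "s = \<theta> / \<Omega>"
  have s: "\<Omega> * (\<tau> + s) = \<theta> + \<Omega> * \<tau>" for \<tau> using \<Omega> by (simp add: s_def algebra_simps)
  define t0 where "t0 = t + s"
  obtain \<sigma> X X' Y Y' where \<sigma>: "0 < \<sigma>"
    and sol: "forced_solution m c k P F1 M C K Q F2 \<Omega> 0 {t0 - \<sigma><..<t0 + \<sigma>} X X' Y Y'"
    and init: "X t0 = x0" "X' t0 = v0"
    and graph: "\<And>t. t \<in> {t0 - \<sigma><..<t0 + \<sigma>} \<Longrightarrow>
       Y t = h (X t) (X' t) (\<Omega> * t) 0 \<and> Y' t = h' (X t) (X' t) (\<Omega> * t) 0"
    using inv z unfolding unforced_invariant_def by blast
  have "t0 \<in> {t0 - \<sigma><..<t0 + \<sigma>}" using \<sigma> by simp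
  then obtain a y'' where D: "(X has_real_derivative X' t0) (at t0)" "(X' has_real_derivative a) (at t0)"
      "(Y has_vector_derivative Y' t0) (at t0)" "(Y' has_vector_derivative y'') (at t0)"
      "m * a + c * X' t0 + k * X t0 + P (X t0) (X' t0) (Y t0) (Y' t0) = 0"
      "M *v y'' + C *v Y' t0 + K *v Y t0 + Q (X t0) (X' t0) (Y t0) (Y' t0) = 0"
    using sol unfolding forced_solution_def by fastforce
  have shift: "((\<lambda>\<tau>. f (\<tau> + s)) has_vector_derivative f') (at t)"
    if "(f has_vector_derivative f') (at t0)" for f :: "real \<Rightarrow> real^'n" and f'
  proof -
    have "((\<lambda>\<tau>. \<tau> + s) has_vector_derivative 1) (at t)" by (auto intro!: derivative_eq_intros)
    from vector_diff_chain_at[OF this, of f f'] that show ?thesis by (simp add: t0_def o_def)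
  qed
  show thesis
  proof (rule that[of "\<lambda>\<tau>. X (\<tau> + s)" "\<lambda>\<tau>. X' (\<tau> + s)" a "\<lambda>\<tau>. Y (\<tau> + s)" "\<lambda>\<tau>. Y' (\<tau> + s)" y''];
      (simp add: t0_def[symmetric] init)?)
    show "((\<lambda>\<tau>. X (\<tau> + s)) has_real_derivative v0) (at t)"
      using D(1) init unfolding t0_def DERIV_shift by simp
    show "((\<lambda>\<tau>. X' (\<tau> + s)) has_real_derivative a) (at t)"
      using D(2) unfolding t0_def DERIV_shift by simp
    show "((\<lambda>\<tau>. Y (\<tau> + s)) has_vector_derivative Y' t0) (at t)" by (rule shift[OF D(3)])
    show "((\<lambda>\<tau>. Y' (\<tau> + s)) has_vector_derivative y'') (at t)" by (rule shift[OF D(4)])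
    show "m * a + c * v0 + k * x0 + P x0 v0 (Y t0) (Y' t0) = 0"
      "M *v y'' + C *v Y' t0 + K *v Y t0 + Q x0 v0 (Y t0) (Y' t0) = 0"
      using D(5,6) init by simp_all
    show "\<forall>\<^sub>F \<tau> in nhds t. Y (\<tau> + s) = h (X (\<tau> + s)) (X' (\<tau> + s)) (\<theta> + \<Omega> * \<tau>) 0 \<and>
        Y' (\<tau> + s) = h' (X (\<tau> + s)) (X' (\<tau> + s)) (\<theta> + \<Omega> * \<tau>) 0"
      unfolding eventually_nhds_metric
    proof (intro exI[of _ \<sigma>] conjI \<sigma> allI impI)
      fix \<tau> assume "dist \<tau> t < \<sigma>"
      hence "\<tau> + s \<in> {t0 - \<sigma><..<t0 + \<sigma>}" by (auto simp: t0_def dist_real_def)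
      from graph[OF this] show "Y (\<tau> + s) = h (X (\<tau> + s)) (X' (\<tau> + s)) (\<theta> + \<Omega> * \<tau>) 0"
        "Y' (\<tau> + s) = h' (X (\<tau> + s)) (X' (\<tau> + s)) (\<theta> + \<Omega> * \<tau>) 0" by (simp_all add: s)
    qed
  qed
qed

text \<open>At time \<open>t\<close> both paths pass through the same point with the same velocity, and their accelerations differ by
  \<open>O(amp\<^sup>2)\<close>, so they separate at this rate; multiplied by the Lipschitz constant \<open>O(amp)\<close> of the graph this is of
  third order.\<close>

lemma graph_closeness:
  fixes f :: "real \<Rightarrow> real \<Rightarrow> real \<Rightarrow> real \<Rightarrow> real"
  assumes jet: "\<And>\<phi>. quad_jet f \<phi> C \<rho>" and C: "0 \<le> C" and \<rho>: "\<rho> \<le> 1"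
    and flow: "linear_flow d e X V t"
    and pos: "0 < amp (X t) (V t)" and small: "2 * amp (X t) (V t) \<le> \<rho>"
    and x: "x t = X t" "(x has_real_derivative V t) (at t)"
    and v: "v t = V t" "(v has_real_derivative a) (at t)"
    and a: "\<bar>a - (- d * V t - e * X t)\<bar> \<le> B * (amp (X t) (V t))\<^sup>2"
    and Y: "\<forall>\<^sub>F \<tau> in nhds t. Y \<tau> = f (x \<tau>) (v \<tau>) (\<theta> + \<Omega> * \<tau>) 0"
  shows "\<forall>\<^sub>F \<tau> in at t. \<bar>f (X \<tau>) (V \<tau>) (\<theta> + \<Omega> * \<tau>) 0 - Y \<tau>\<bar>
      \<le> 8 * C * (B + 2) * amp (X t) (V t) ^ 3 * \<bar>\<tau> - t\<bar>"
proof -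
  define n where "n = amp (X t) (V t)"
  have n: "0 < n" "2 * n \<le> \<rho>" using pos small by (auto simp: n_def)
  have XD: "(X has_real_derivative V t) (at t)" "(V has_real_derivative - d * V t - e * X t) (at t)"
    using flow by (auto simp: linear_flow_def)
  have "((\<lambda>\<tau>. X \<tau> - x \<tau>) has_vector_derivative 0) (at t)"
    using DERIV_diff[OF XD(1) x(2)] by (simp add: has_real_derivative_iff_has_vector_derivative)
  from has_vector_derivative_imp_increment[OF this, of "n\<^sup>2"]
  have 1: "\<forall>\<^sub>F \<tau> in at t. \<bar>X \<tau> - x \<tau>\<bar> \<le> n\<^sup>2 * \<bar>\<tau> - t\<bar>" using n x(1) by simp
  have "((\<lambda>\<tau>. V \<tau> - v \<tau>) has_vector_derivative (- d * V t - e * X t) - a) (at t)"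
    using DERIV_diff[OF XD(2) v(2)] by (simp only: has_real_derivative_iff_has_vector_derivative)
  moreover have "norm ((- d * V t - e * X t) - a) < (B + 1) * n\<^sup>2"
  proof -
    have "norm ((- d * V t - e * X t) - a) = \<bar>a - (- d * V t - e * X t)\<bar>"
      by (simp only: real_norm_def abs_minus_commute)
    also have "\<dots> \<le> B * n\<^sup>2" using a by (simp only: n_def)
    also have "\<dots> < (B + 1) * n\<^sup>2" using n by (simp add: distrib_right)
    finally show ?thesis .
  qed
  ultimately have "\<forall>\<^sub>F \<tau> in at t. norm ((V \<tau> - v \<tau>) - (V t - v t)) \<le> ((B + 1) * n\<^sup>2) * \<bar>\<tau> - t\<bar>"
    by (rule has_vector_derivative_imp_increment)
  hence 2: "\<forall>\<^sub>F \<tau> in at t. \<bar>V \<tau> - v \<tau>\<bar> \<le> (B + 1) * n\<^sup>2 * \<bar>\<tau> - t\<bar>" using v(1) by simp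
  have near: "\<forall>\<^sub>F \<tau> in at t. \<bar>p \<tau>\<bar> + \<bar>q \<tau>\<bar> < 2 * n"
    if "(p has_real_derivative p') (at t)" "(q has_real_derivative q') (at t)" "p t = X t" "q t = V t"
    for p q p' q'
  proof -
    have "(p \<longlongrightarrow> p t) (at t)" "(q \<longlongrightarrow> q t) (at t)"
      using DERIV_isCont[OF that(1)] DERIV_isCont[OF that(2)] by (simp_all add: isCont_def)
    hence "((\<lambda>\<tau>. \<bar>p \<tau>\<bar> + \<bar>q \<tau>\<bar>) \<longlongrightarrow> \<bar>p t\<bar> + \<bar>q t\<bar>) (at t)" by (intro tendsto_intros)
    thus ?thesis by (rule order_tendstoD(2)) (use n that in \<open>simp add: n_def\<close>)
  qed
  have Y': "\<forall>\<^sub>F \<tau> in at t. Y \<tau> = f (x \<tau>) (v \<tau>) (\<theta> + \<Omega> * \<tau>) 0"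
    using Y by (simp add: eventually_nhds_conv_at)
  from 1 2 near[OF XD refl refl] near[OF x(2) v(2) x(1) v(1)] Y'
  show ?thesis
  proof eventually_elim
    case (elim \<tau>)
    have "\<bar>f (X \<tau>) (V \<tau>) (\<theta> + \<Omega> * \<tau>) 0 - Y \<tau>\<bar>
        \<le> 4 * C * (2 * n) * (\<bar>X \<tau> - x \<tau>\<bar> + \<bar>V \<tau> - v \<tau>\<bar>)"
      unfolding elim(5) using elim n by (intro quad_jet_lipschitz[OF jet C \<rho>]) auto
    also have "\<dots> \<le> 4 * C * (2 * n) * (n\<^sup>2 * \<bar>\<tau> - t\<bar> + (B + 1) * n\<^sup>2 * \<bar>\<tau> - t\<bar>)"
      using elim C n by (intro mult_left_mono add_mono) auto
    also have "\<dots> = 8 * C * (B + 2) * n ^ 3 * \<bar>\<tau> - t\<bar>"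
      by (simp add: power3_eq_cube power2_eq_square algebra_simps)
    finally show ?case by (simp add: n_def)
  qed
qed

text \<open>The modal equation on the trajectory through a point of the graph, with
  the nonlinear force replaced by its quadratic part in \<open>(x, v)\<close>: the graph has second order, so its
  contribution to the force is at least of third order.\<close>

lemma modal_graph_dynamics:
  fixes h h' :: "real \<Rightarrow> real \<Rightarrow> real \<Rightarrow> real \<Rightarrow> real^'n"
    and p :: "nat \<Rightarrow> nat \<Rightarrow> nat^'n \<Rightarrow> nat^'n \<Rightarrow> real"
    and q :: "nat \<Rightarrow> nat \<Rightarrow> nat^'n \<Rightarrow> nat^'n \<Rightarrow> real^'n"
  assumes m: "m > 0" and \<Omega>: "\<Omega> \<noteq> 0"
    and modal: "modal_matrix M C K \<Phi> \<omega>s \<zeta>s"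
    and s: "\<And>i. has_quadratic_part (\<lambda>x v. modal_force \<Phi> (mech_poly 3 q) x v 0 0 $ i) (s20 $ i) (s11 $ i) (s02 $ i)"
    and inv: "unforced_invariant m c k (mech_poly 3 p) F1 M C K (mech_poly 3 q) F2 \<Omega> \<delta> h h'"
    and A: "0 \<le> A" and \<rho>: "0 < \<rho>" "\<rho> \<le> 1" "\<rho> < \<delta>"
    and jet: "\<And>i \<phi>. quad_jet (modal_graph \<Phi> M h i) \<phi> A \<rho>"
    and jet': "\<And>i \<phi>. quad_jet (modal_graph \<Phi> M h' i) \<phi> A \<rho>"
  shows "\<exists>B \<sigma>. A \<le> B \<and> 0 < \<sigma> \<and> \<sigma> \<le> \<rho> \<and> (\<forall>i. second_order_along_flow (c / m) (k / m) \<Omega>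
      (2 * \<zeta>s i * \<omega>s i) ((\<omega>s i)\<^sup>2) (s20 $ i) (s11 $ i) (s02 $ i)
      (\<lambda>x v \<phi>. modal_graph \<Phi> M h i x v \<phi> 0) (\<lambda>x v \<phi>. modal_graph \<Phi> M h' i x v \<phi> 0) B \<sigma>)"
proof -
  define nrm :: "real^'n^'n \<Rightarrow> real" where "nrm A = (\<Sum>a\<in>UNIV. \<Sum>b\<in>UNIV. \<bar>A $ a $ b\<bar>)" for A
  have nrm: "0 \<le> nrm A" for A by (auto simp: nrm_def intro!: sum_nonneg)
  define E where "E = nrm \<Phi> * (4 * A)"
  have E: "0 \<le> E" using A nrm by (simp add: E_def)
  obtain CP where CP: "0 \<le> CP" and Pb: "\<And>x v y y' Y. amp x v \<le> 1 \<Longrightarrow> Y \<le> 1 \<Longrightarrow>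
      (\<And>i. \<bar>y $ i\<bar> \<le> Y) \<Longrightarrow> (\<And>i. \<bar>y' $ i\<bar> \<le> Y) \<Longrightarrow>
      \<bar>mech_poly 3 p x v y y'\<bar> \<le> CP * ((amp x v)\<^sup>2 + Y)"
    using mech_poly_bounds[of p] by blast
  have "\<exists>C\<ge>0. \<forall>x v y y' Y. amp x v \<le> 1 \<longrightarrow> Y \<le> 1 \<longrightarrow> (\<forall>i. \<bar>y $ i\<bar> \<le> Y) \<longrightarrow> (\<forall>i. \<bar>y' $ i\<bar> \<le> Y) \<longrightarrow>
      \<bar>mech_poly 3 q x v y y' $ j - mech_poly 3 q x v 0 0 $ j\<bar> \<le> C * ((amp x v) * Y + Y\<^sup>2)" for j
    unfolding mech_poly_component using mech_poly_bounds[of "\<lambda>a b u w. q a b u w $ j"] by blast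
  then obtain CQ where CQ: "\<And>j. 0 \<le> CQ j" and Qb: "\<And>j x v y y' Y. amp x v \<le> 1 \<Longrightarrow> Y \<le> 1 \<Longrightarrow>
      (\<And>i. \<bar>y $ i\<bar> \<le> Y) \<Longrightarrow> (\<And>i. \<bar>y' $ i\<bar> \<le> Y) \<Longrightarrow>
      \<bar>mech_poly 3 q x v y y' $ j - mech_poly 3 q x v 0 0 $ j\<bar> \<le> CQ j * ((amp x v) * Y + Y\<^sup>2)"
    by metis
  define CQ' where "CQ' = (\<Sum>j\<in>UNIV. CQ j)"
  have CQ': "CQ j \<le> CQ'" for j unfolding CQ'_def using CQ by (intro member_le_sum) auto
  have CQ'0: "0 \<le> CQ'" using CQ CQ' order_trans by blast
  obtain r30 r21 r12 r03 where cubic: "\<And>i x v. modal_force \<Phi> (mech_poly 3 q) x v 0 0 $ i =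
        (s20 $ i * x\<^sup>2 + 2 * s11 $ i * x * v + s02 $ i * v\<^sup>2) +
        (r30 i * x ^ 3 + r21 i * x\<^sup>2 * v + r12 i * x * v\<^sup>2 + r03 i * v ^ 3)"
    using s unfolding has_quadratic_part_def by metis
  define R where "R i = \<bar>r30 i\<bar> + \<bar>r21 i\<bar> + \<bar>r12 i\<bar> + \<bar>r03 i\<bar>" for i
  define R' where "R' = (\<Sum>i\<in>UNIV. R i)"
  have R': "R i \<le> R'" for i unfolding R'_def by (intro member_le_sum) (auto simp: R_def)
  have R0: "0 \<le> R i" for i by (simp add: R_def)
  have R'0: "0 \<le> R'" using R0 R' order_trans by blast
  define B1 where "B1 = CP * (1 + E) / m"
  have B1: "0 \<le> B1" using CP E m by (simp add: B1_def)
  define B2 where "B2 = R' + nrm (transpose \<Phi>) * (CQ' * (E + E\<^sup>2))"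
  define B3 where "B3 = 8 * A * (B1 + 2)"
  define B where "B = A + (B2 + B3)"
  have B23: "0 \<le> B2" "0 \<le> B3" using R'0 nrm CQ'0 E A B1 by (simp_all add: B2_def B3_def)
  hence B: "A \<le> B" "B2 \<le> B" "B3 \<le> B" using A by (auto simp: B_def)
  (* Half of \<rho> leaves room for doubling the amplitude in graph_closeness; the second bound makes the graph at most 1. *)
  define \<sigma> where "\<sigma> = min (\<rho> / 2) (1 / (E + 1))"
  have \<sigma>: "0 < \<sigma>" "2 * \<sigma> \<le> \<rho>" "\<sigma> \<le> \<rho>" using \<rho> E by (auto simp: \<sigma>_def)
  have \<sigma>E: "\<sigma> \<le> 1" "E * \<sigma> \<le> 1"
  proof -
    show "\<sigma> \<le> 1" using \<sigma> \<rho> by linarith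
    have "E * \<sigma> \<le> E * (1 / (E + 1))" using E by (intro mult_left_mono) (auto simp: \<sigma>_def)
    also have "\<dots> \<le> 1" using E by simp
    finally show "E * \<sigma> \<le> 1" .
  qed
  have "second_order_along_flow (c / m) (k / m) \<Omega>
      (2 * \<zeta>s i * \<omega>s i) ((\<omega>s i)\<^sup>2) (s20 $ i) (s11 $ i) (s02 $ i)
      (\<lambda>x v \<phi>. modal_graph \<Phi> M h i x v \<phi> 0) (\<lambda>x v \<phi>. modal_graph \<Phi> M h' i x v \<phi> 0) B \<sigma>" for i
    unfolding second_order_along_flow_def
  proof (intro allI impI, goal_cases)
    case (1 X V t \<theta>)
    note flow = 1(1) and pos = 1(2) and small = 1(3)
    define n where "n = amp (X t) (V t)"
    have n: "0 < n" "n \<le> \<sigma>" "n \<le> 1" using pos small \<sigma>E by (auto simp: n_def)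
    have "norm (X t, V t) \<le> amp (X t) (V t)" using norm_Pair_le[of "X t" "V t"] by simp
    hence "norm (X t, V t) < \<delta>" using small \<sigma> \<rho> by linarith
    obtain x x' a y y' y'' where xt: "x t = X t" "x' t = V t"
      and xD: "(x has_real_derivative V t) (at t)" "(x' has_real_derivative a) (at t)"
      and yD: "(y has_vector_derivative y' t) (at t)" "(y' has_vector_derivative y'') (at t)"
      and eq1: "m * a + c * V t + k * X t + mech_poly 3 p (X t) (V t) (y t) (y' t) = 0"
      and eq2: "M *v y'' + C *v y' t + K *v y t + mech_poly 3 q (X t) (V t) (y t) (y' t) = 0"
      and graph: "\<forall>\<^sub>F \<tau> in nhds t. y \<tau> = h (x \<tau>) (x' \<tau>) (\<theta> + \<Omega> * \<tau>) 0 \<and>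
          y' \<tau> = h' (x \<tau>) (x' \<tau>) (\<theta> + \<Omega> * \<tau>) 0"
      by (rule ssm_trajectory_through[OF inv \<Omega> \<open>norm (X t, V t) < \<delta>\<close>, of t \<theta>]) (rule that)
    let ?p = "mech_poly 3 p (X t) (V t) (y t) (y' t)"
    let ?q = "mech_poly 3 q (X t) (V t) (y t) (y' t)"
    let ?qlin = "mech_poly 3 q (X t) (V t) 0 0"
    let ?flin = "modal_force \<Phi> (mech_poly 3 q) (X t) (V t) 0 0 $ i"
    let ?s = "qform (s20 $ i) (2 * s11 $ i) (s02 $ i) (X t) (V t)"
    let ?alin = "- (c / m) * V t - (k / m) * X t"
    have yt: "y t = h (X t) (V t) (\<theta> + \<Omega> * t) 0" "y' t = h' (X t) (V t) (\<theta> + \<Omega> * t) 0"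
      using eventually_nhds_x_imp_x[OF graph] xt by simp_all
    define T where "T z = transpose \<Phi> *v (M *v z)" for z
    have size: "\<bar>z $ j\<bar> \<le> E * n\<^sup>2" if "\<And>i. \<bar>T z $ i\<bar> \<le> 4 * A * n\<^sup>2" for z j
      using abs_matrix_vector_le[of "T z" "4 * A * n\<^sup>2" \<Phi> j, OF that] modal_inverse[OF modal, of z]
      by (simp add: T_def E_def nrm_def mult.assoc)
    have n\<rho>: "amp (X t) (V t) \<le> \<rho>" using small \<sigma> by linarith
    have yb: "\<bar>y t $ j\<bar> \<le> E * n\<^sup>2" for j
      by (rule size) (use quad_jet_size[OF jet A \<rho>(2) n\<rho>] in \<open>simp add: T_def yt modal_graph_def n_def\<close>)
    have y'b: "\<bar>y' t $ j\<bar> \<le> E * n\<^sup>2" for j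
      by (rule size) (use quad_jet_size[OF jet' A \<rho>(2) n\<rho>] in \<open>simp add: T_def yt modal_graph_def n_def\<close>)
    have En: "E * n\<^sup>2 \<le> 1"
    proof -
      have "E * n\<^sup>2 = E * n * n" by (simp add: power2_eq_square)
      also have "\<dots> \<le> E * \<sigma> * 1" using E n \<sigma> by (intro mult_mono mult_left_mono) auto
      finally show ?thesis using \<sigma>E by simp
    qed
    have n1: "amp (X t) (V t) \<le> 1" using n by (simp add: n_def)
    have Pn: "\<bar>?p\<bar> \<le> CP * (n\<^sup>2 + E * n\<^sup>2)"
      using Pb[OF n1 En yb y'b] by (simp only: n_def)
    have acc: "a - ?alin = - ?p / m"
    proof -
      have "m * (a - ?alin) = m * a + c * V t + k * X t"
        using m by (simp add: algebra_simps)
      also have "\<dots> = - ?p" using eq1 by linarith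
      finally show ?thesis using m by (metis less_irrefl nonzero_mult_div_cancel_left)
    qed
    have "\<bar>a - ?alin\<bar> = \<bar>?p\<bar> / m"
      unfolding acc using m by simp
    also have "\<dots> \<le> CP * (n\<^sup>2 + E * n\<^sup>2) / m" using Pn m by (intro divide_right_mono) auto
    also have "\<dots> = B1 * n\<^sup>2" by (simp add: B1_def distrib_left distrib_right)
    finally have a: "\<bar>a - ?alin\<bar> \<le> B1 * (amp (X t) (V t))\<^sup>2"
      by (simp only: n_def)
    have Tz: "T y'' $ i + 2 * \<zeta>s i * \<omega>s i * T (y' t) $ i + (\<omega>s i)\<^sup>2 * T (y t) $ i
        + (transpose \<Phi> *v ?q) $ i = 0"
    proof -
      have "transpose \<Phi> *v (M *v y'' + C *v y' t + K *v y t + ?q) = 0"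
        unfolding eq2 by (rule matrix_vector_mult_0_right)
      hence "(transpose \<Phi> *v (M *v y'') + transpose \<Phi> *v (C *v y' t) + transpose \<Phi> *v (K *v y t)
          + transpose \<Phi> *v ?q) $ i = 0"
        by (simp only: matrix_vector_right_distrib zero_index)
      thus ?thesis
        unfolding T_def vector_add_component modal_damping_stiffness[OF modal] .
    qed
    have Qdiff: "\<bar>(transpose \<Phi> *v ?q) $ i
        - ?flin\<bar> \<le> nrm (transpose \<Phi>) * (CQ' * (E + E\<^sup>2) * n ^ 3)"
    proof -
      have "(transpose \<Phi> *v ?q) $ i
        - ?flin
        = (transpose \<Phi> *v (?q - ?qlin)) $ i"
        by (simp only: modal_force_def matrix_vector_mult_diff_distrib vector_minus_component
            matrix_vector_mult_0_right)
      also have "\<bar>\<dots>\<bar> \<le> nrm (transpose \<Phi>) * (CQ' * (E + E\<^sup>2) * n ^ 3)"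
        unfolding nrm_def
      proof (rule abs_matrix_vector_le)
        fix j
        have "\<bar>(?q - ?qlin) $ j\<bar>
            \<le> CQ j * (n * (E * n\<^sup>2) + (E * n\<^sup>2)\<^sup>2)"
          using Qb[OF n1 En yb y'b, of j] by (simp add: n_def)
        also have "\<dots> \<le> CQ' * (n * (E * n\<^sup>2) + (E * n\<^sup>2)\<^sup>2)"
          using CQ' n E by (intro mult_right_mono) auto
        also have "(E * n\<^sup>2)\<^sup>2 = E\<^sup>2 * n ^ 4" by (simp add: power_mult_distrib flip: power_mult)
        also have "E\<^sup>2 * n ^ 4 \<le> E\<^sup>2 * n ^ 3" using n by (intro mult_left_mono power_decreasing) auto
        hence "CQ' * (n * (E * n\<^sup>2) + E\<^sup>2 * n ^ 4) \<le> CQ' * (n * (E * n\<^sup>2) + E\<^sup>2 * n ^ 3)"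
          using CQ'0 by (intro mult_left_mono) auto
        also have "\<dots> = CQ' * (E + E\<^sup>2) * n ^ 3"
          by (simp add: power3_eq_cube power2_eq_square algebra_simps)
        finally show "\<bar>(?q - ?qlin) $ j\<bar>
            \<le> CQ' * (E + E\<^sup>2) * n ^ 3" .
      qed
      finally show ?thesis .
    qed
    have Qcub: "\<bar>?flin
        - ?s\<bar> \<le> R' * n ^ 3"
    proof -
      have "?flin
          - ?s
        = r30 i * X t ^ 3 + r21 i * (X t)\<^sup>2 * V t + r12 i * X t * (V t)\<^sup>2 + r03 i * V t ^ 3"
        by (simp add: cubic qform_def)
      also have "\<bar>\<dots>\<bar> \<le> R i * n ^ 3" unfolding R_def n_def by (rule cubic_form_bound)
      also have "\<dots> \<le> R' * n ^ 3" using R' n by (intro mult_right_mono) auto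
      finally show ?thesis .
    qed
    have BB: "B3 * n ^ 3 * \<bar>\<tau> - t\<bar> \<le> B * n ^ 3 * \<bar>\<tau> - t\<bar>" for \<tau>
      using B n by (intro mult_right_mono) auto
    have close: "\<forall>\<^sub>F \<tau> in at t. \<bar>modal_graph \<Phi> M g i (X \<tau>) (V \<tau>) (\<theta> + \<Omega> * \<tau>) 0 - Y \<tau>\<bar> \<le> B * n ^ 3 * \<bar>\<tau> - t\<bar>"
      if g: "\<And>\<phi>. quad_jet (modal_graph \<Phi> M g i) \<phi> A \<rho>"
        and Y: "\<forall>\<^sub>F \<tau> in nhds t. Y \<tau> = modal_graph \<Phi> M g i (x \<tau>) (x' \<tau>) (\<theta> + \<Omega> * \<tau>) 0" for g Y
      using graph_closeness[OF g A \<rho>(2) flow pos _ xt(1) xD(1) xt(2) xD(2) a Y] small \<sigma>(2)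
      unfolding B3_def[symmetric] n_def[symmetric]
      by (auto elim!: eventually_mono intro: order_trans[OF _ BB])
    show ?case
    proof (intro exI conjI)
      show "T (y t) $ i = modal_graph \<Phi> M h i (X t) (V t) (\<theta> + \<Omega> * t) 0"
        "T (y' t) $ i = modal_graph \<Phi> M h' i (X t) (V t) (\<theta> + \<Omega> * t) 0"
        by (simp_all add: T_def modal_graph_def yt)
      show "((\<lambda>\<tau>. T (y \<tau>) $ i) has_real_derivative T (y' t) $ i) (at t)"
        "((\<lambda>\<tau>. T (y' \<tau>) $ i) has_real_derivative T y'' $ i) (at t)"
        using bounded_linear.has_vector_derivative[OF bounded_linear_modal yD(1)]
          bounded_linear.has_vector_derivative[OF bounded_linear_modal yD(2)]
        by (simp_all only: T_def has_real_derivative_iff_has_vector_derivative)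
      show "\<bar>T y'' $ i + 2 * \<zeta>s i * \<omega>s i * T (y' t) $ i + (\<omega>s i)\<^sup>2 * T (y t) $ i
            + ?s\<bar> \<le> B * amp (X t) (V t) ^ 3"
      proof -
        have "\<bar>T y'' $ i + 2 * \<zeta>s i * \<omega>s i * T (y' t) $ i + (\<omega>s i)\<^sup>2 * T (y t) $ i
            + ?s\<bar>
          \<le> R' * n ^ 3 + nrm (transpose \<Phi>) * (CQ' * (E + E\<^sup>2) * n ^ 3)"
          using Tz Qdiff Qcub by linarith
        also have "\<dots> = B2 * n ^ 3" by (simp add: B2_def algebra_simps)
        also have "\<dots> \<le> B * n ^ 3" using B n by (intro mult_right_mono) auto
        finally show ?thesis by (simp add: n_def)
      qed
      show "\<forall>\<^sub>F \<tau> in at t. \<bar>modal_graph \<Phi> M h i (X \<tau>) (V \<tau>) (\<theta> + \<Omega> * \<tau>) 0 - T (y \<tau>) $ i\<bar>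
           \<le> B * amp (X t) (V t) ^ 3 * \<bar>\<tau> - t\<bar>"
        unfolding n_def[symmetric]
        by (rule close[OF jet]) (use graph in \<open>auto elim!: eventually_mono simp: T_def modal_graph_def\<close>)
      show "\<forall>\<^sub>F \<tau> in at t. \<bar>modal_graph \<Phi> M h' i (X \<tau>) (V \<tau>) (\<theta> + \<Omega> * \<tau>) 0 - T (y' \<tau>) $ i\<bar>
           \<le> B * amp (X t) (V t) ^ 3 * \<bar>\<tau> - t\<bar>"
        unfolding n_def[symmetric]
        by (rule close[OF jet']) (use graph in \<open>auto elim!: eventually_mono simp: T_def modal_graph_def\<close>)
    qed
  qed
  thus ?thesis using B(1) \<sigma> by blast
qed

lemma finite_uniform_constants:
  fixes R :: "'i::finite \<Rightarrow> real \<Rightarrow> real \<Rightarrow> bool"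
  assumes ex: "\<And>i. \<exists>C \<rho>. 0 \<le> C \<and> 0 < \<rho> \<and> R i C \<rho>"
    and mono: "\<And>i C \<rho> C' \<rho>'. R i C \<rho> \<Longrightarrow> C \<le> C' \<Longrightarrow> \<rho>' \<le> \<rho> \<Longrightarrow> R i C' \<rho>'"
  shows "\<exists>C \<rho>. 0 \<le> C \<and> 0 < \<rho> \<and> (\<forall>i. R i C \<rho>)"
proof -
  obtain C \<rho> where *: "\<And>i. 0 \<le> C i" "\<And>i. 0 < \<rho> i" "\<And>i. R i (C i) (\<rho> i)" using ex by metis
  have "R i (\<Sum>j\<in>UNIV. C j) (Min (range \<rho>))" for i
    by (rule mono[OF *(3)]) (auto intro: member_le_sum *(1))
  moreover have "0 \<le> (\<Sum>j\<in>UNIV. C j)" "0 < Min (range \<rho>)" using * by (auto intro: sum_nonneg)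
  ultimately show ?thesis by blast
qed

text \<open>These uniform estimates and the invariance at \<open>\<epsilon> = 0\<close> are all that the reduction uses of the spectral
  submanifold.\<close>

lemma slow_SSM_modal_jets:
  fixes h h' :: "real \<Rightarrow> real \<Rightarrow> real \<Rightarrow> real \<Rightarrow> real^'n"
  assumes ssm: "slow_SSM m c k P F1 M C K Q F2 \<Omega> h h'"
  obtains A \<rho> \<delta> where "0 \<le> A" "0 < \<rho>" "\<rho> \<le> 1" "\<rho> < \<delta>"
    "\<And>i \<phi>. quad_jet (modal_graph \<Phi> M h i) \<phi> A \<rho>" "\<And>i \<phi>. quad_jet (modal_graph \<Phi> M h' i) \<phi> A \<rho>"
    "unforced_invariant m c k P F1 M C K Q F2 \<Omega> \<delta> h h'"
proof -
  obtain \<delta> \<epsilon>0 where pos: "0 < \<delta>" "0 < \<epsilon>0"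
    and reg0: "\<forall>x v \<phi> \<epsilon>. norm (x, v) < \<delta> \<and> \<bar>\<epsilon>\<bar> < \<epsilon>0 \<longrightarrow>
           real_analytic4_at h x v \<phi> \<epsilon> \<and> real_analytic4_at h' x v \<phi> \<epsilon> \<and>
           h x v (\<phi> + 2 * pi) \<epsilon> = h x v \<phi> \<epsilon> \<and> h' x v (\<phi> + 2 * pi) \<epsilon> = h' x v \<phi> \<epsilon>"
    and tan: "\<forall>\<phi>. h 0 0 \<phi> 0 = 0 \<and> h' 0 0 \<phi> 0 = 0 \<and>
           ((\<lambda>(x, v). h x v \<phi> 0) has_derivative (\<lambda>_. 0)) (at (0, 0)) \<and>
           ((\<lambda>(x, v). h' x v \<phi> 0) has_derivative (\<lambda>_. 0)) (at (0, 0))"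
    and inv: "\<forall>\<epsilon> t0 x0 v0. 0 \<le> \<epsilon> \<and> \<epsilon> < \<epsilon>0 \<and> norm (x0, v0) < \<delta> \<longrightarrow>
           (\<exists>\<tau>>0. \<exists>x x' y y'.
              forced_solution m c k P F1 M C K Q F2 \<Omega> \<epsilon> {t0 - \<tau><..<t0 + \<tau>} x x' y y' \<and>
              x t0 = x0 \<and> x' t0 = v0 \<and>
              (\<forall>t\<in>{t0 - \<tau><..<t0 + \<tau>}. norm (x t, x' t) < \<delta> \<and>
                 y t = h (x t) (x' t) (\<Omega> * t) \<epsilon> \<and> y' t = h' (x t) (x' t) (\<Omega> * t) \<epsilon>))"
    using ssm unfolding slow_SSM_def by (elim exE conjE) (rule that)
  note reg = reg0[rule_format, OF conjI]
  have an: "real_analytic4_at h 0 0 \<phi> 0" "real_analytic4_at h' 0 0 \<phi> 0" for \<phi>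
    using reg[of 0 0 0 \<phi>] pos by (simp_all flip: zero_prod_def)
  have jet: "\<exists>C \<rho>. 0 \<le> C \<and> 0 < \<rho> \<and> (\<forall>\<phi>. quad_jet (modal_graph \<Phi> M g i) \<phi> C \<rho>)"
    if g: "\<And>\<phi>. real_analytic4_at g 0 0 \<phi> 0"
      "\<And>x v \<phi> \<epsilon>. norm (x, v) < \<delta> \<Longrightarrow> \<bar>\<epsilon>\<bar> < \<epsilon>0 \<Longrightarrow> g x v (\<phi> + 2 * pi) \<epsilon> = g x v \<phi> \<epsilon>"
      "\<And>\<phi>. g 0 0 \<phi> 0 = 0" "\<And>\<phi>. ((\<lambda>(x, v). g x v \<phi> 0) has_derivative (\<lambda>_. 0)) (at (0, 0))"
    for g :: "real \<Rightarrow> real \<Rightarrow> real \<Rightarrow> real \<Rightarrow> real^'n" and i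
  proof (rule uniform_quad_jet[OF pos])
    show "real_analytic4_at (modal_graph \<Phi> M g i) 0 0 \<phi> 0" for \<phi>
      unfolding modal_graph_def[abs_def]
      by (rule real_analytic4_at_bounded_linear[OF bounded_linear_modal g(1)])
    show "modal_graph \<Phi> M g i x v (\<phi> + 2 * pi) \<epsilon> = modal_graph \<Phi> M g i x v \<phi> \<epsilon>"
      if "norm (x, v) < \<delta>" "\<bar>\<epsilon>\<bar> < \<epsilon>0" for x v \<phi> \<epsilon>
      using g(2)[OF that] by (simp add: modal_graph_def)
    show "modal_graph \<Phi> M g i 0 0 \<phi> 0 = 0" for \<phi>
      by (simp add: modal_graph_def g(3) del: transpose_matrix_vector)
    show "((\<lambda>(x, v). modal_graph \<Phi> M g i x v \<phi> 0) has_derivative (\<lambda>_. 0)) (at (0, 0))" for \<phi>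
      using bounded_linear.has_derivative[OF bounded_linear_modal[where \<Phi> = \<Phi> and M = M and i = i] g(4)[of \<phi>]]
      by (simp add: modal_graph_def case_prod_unfold del: transpose_matrix_vector)
  qed
  define R where "R i C \<rho> \<longleftrightarrow> (\<forall>\<phi>. quad_jet (modal_graph \<Phi> M h i) \<phi> C \<rho> \<and> quad_jet (modal_graph \<Phi> M h' i) \<phi> C \<rho>)"
    for i C \<rho>
  have mono: "R i C' \<rho>'" if "R i C \<rho>" "C \<le> C'" "\<rho>' \<le> \<rho>" for i C \<rho> C' \<rho>'
    using that quad_jet_mono unfolding R_def by metis
  have "\<exists>C \<rho>. 0 \<le> C \<and> 0 < \<rho> \<and> R i C \<rho>" for i
  proof -
    obtain C1 \<rho>1 where 1: "0 \<le> C1" "0 < \<rho>1" "\<And>\<phi>. quad_jet (modal_graph \<Phi> M h i) \<phi> C1 \<rho>1"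
      using jet[of h i] an(1) reg tan by blast
    obtain C2 \<rho>2 where 2: "0 \<le> C2" "0 < \<rho>2" "\<And>\<phi>. quad_jet (modal_graph \<Phi> M h' i) \<phi> C2 \<rho>2"
      using jet[of h' i] an(2) reg tan by blast
    have "R i (max C1 C2) (min \<rho>1 \<rho>2)"
      unfolding R_def using quad_jet_mono[OF 1(3)] quad_jet_mono[OF 2(3)] by simp
    thus ?thesis using 1 2 by (intro exI[of _ "max C1 C2"] exI[of _ "min \<rho>1 \<rho>2"]) auto
  qed
  hence "\<exists>C \<rho>. 0 \<le> C \<and> 0 < \<rho> \<and> (\<forall>i. R i C \<rho>)"
    by (rule finite_uniform_constants) (rule mono)
  then obtain A \<rho>0 where A: "0 \<le> A" "0 < \<rho>0" "\<And>i. R i A \<rho>0" by blast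
  define \<rho> where "\<rho> = min \<rho>0 (min 1 (\<delta> / 2))"
  have \<rho>: "0 < \<rho>" "\<rho> \<le> 1" "\<rho> < \<delta>" "\<rho> \<le> \<rho>0" using A(2) pos by (auto simp: \<rho>_def)
  have "R i A \<rho>" for i using mono[OF A(3) order_refl \<rho>(4)] .
  hence "\<And>i \<phi>. quad_jet (modal_graph \<Phi> M h i) \<phi> A \<rho>" "\<And>i \<phi>. quad_jet (modal_graph \<Phi> M h' i) \<phi> A \<rho>"
    unfolding R_def by blast+
  moreover have "unforced_invariant m c k P F1 M C K Q F2 \<Omega> \<delta> h h'"
    using inv pos(2) unfolding unforced_invariant_def by (metis order_refl)
  ultimately show thesis by (rule that[OF A(1) \<rho>(1-3)])
qed

section \<open>The reduced model\<close>

text \<open>At each point a function bounded by a sum of three majorants is bounded by three times one of them; the first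
  summand with this property takes the whole value.\<close>

lemma ssm_remainderI:
  assumes \<sigma>: "0 < \<sigma>" and C: "0 \<le> C"
    and le: "\<And>x v \<phi> \<epsilon>. amp x v \<le> \<sigma> \<Longrightarrow> 0 < \<epsilon> \<Longrightarrow> \<epsilon> \<le> \<sigma> \<Longrightarrow>
      \<bar>R x v \<phi> \<epsilon>\<bar> \<le> C * ((amp x v) ^ 4 + \<epsilon> * amp x v + \<epsilon>\<^sup>2)"
  shows "ssm_remainder R"
proof -
  define D where "D = 16 * C"
  have D: "0 \<le> D" using C by (simp add: D_def)
  define f where "f = (\<lambda>((x, v), \<phi>, \<epsilon>). R x v \<phi> \<epsilon>)"
  define b1 :: "(real \<times> real) \<times> real \<times> real \<Rightarrow> real" where "b1 = (\<lambda>(z, \<phi>, \<epsilon>). norm z ^ 4)"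
  define b2 :: "(real \<times> real) \<times> real \<times> real \<Rightarrow> real" where "b2 = (\<lambda>(z, \<phi>, \<epsilon>). \<epsilon> * norm z)"
  define b3 :: "(real \<times> real) \<times> real \<times> real \<Rightarrow> real" where "b3 = (\<lambda>(z, \<phi>, \<epsilon>). \<epsilon>\<^sup>2)"
  define R1 where "R1 w = (if \<bar>f w\<bar> \<le> 3 * D * b1 w then f w else 0)" for w
  define R2 where "R2 w = (if \<bar>f w\<bar> \<le> 3 * D * b1 w then 0 else if \<bar>f w\<bar> \<le> 3 * D * b2 w then f w else 0)" for w
  define R3 where "R3 w = f w - R1 w - R2 w" for w
  have "\<forall>\<^sub>F w in small_filter. \<bar>f w\<bar> \<le> D * (b1 w + b2 w + b3 w)"
    unfolding small_filter_def eventually_prod_filter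
  proof (intro exI conjI allI impI)
    show "\<forall>\<^sub>F z in nhds (0, 0). norm (z :: real \<times> real) < \<sigma> / 2"
      unfolding eventually_nhds_metric using \<sigma>
      by (intro exI[of _ "\<sigma> / 2"]) (auto simp: dist_norm)
    show "\<forall>\<^sub>F \<phi> in principal UNIV. True" by simp
    show "\<forall>\<^sub>F \<epsilon> in at_right 0. 0 < \<epsilon> \<and> \<epsilon> \<le> \<sigma>"
      unfolding eventually_at_right_field using \<sigma> by (intro exI[of _ \<sigma>]) auto
    fix \<phi> \<epsilon> :: real assume "0 < \<epsilon> \<and> \<epsilon> \<le> \<sigma>"
    thus "(\<lambda>(\<phi>, \<epsilon>). 0 < \<epsilon> \<and> \<epsilon> \<le> \<sigma>) (\<phi>, \<epsilon>)" by simp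
  next
    fix z :: "real \<times> real" and w :: "real \<times> real"
    assume z: "norm z < \<sigma> / 2" and w: "(\<lambda>(\<phi>, \<epsilon>). 0 < \<epsilon> \<and> \<epsilon> \<le> \<sigma>) w"
    obtain x v where zz: "z = (x, v)" by (cases z)
    obtain \<phi> \<epsilon> where ww: "w = (\<phi>, \<epsilon>)" by (cases w)
    have \<epsilon>: "0 < \<epsilon>" "\<epsilon> \<le> \<sigma>" using w ww by auto
    have n: "amp x v \<le> 2 * norm z"
      using norm_fst_le[of x v] norm_snd_le[of v x] by (simp add: zz)
    have "\<bar>R x v \<phi> \<epsilon>\<bar> \<le> C * ((amp x v) ^ 4 + \<epsilon> * amp x v + \<epsilon>\<^sup>2)"
      using z n \<epsilon> by (intro le) auto
    also have "\<dots> \<le> C * ((2 * norm z) ^ 4 + \<epsilon> * (2 * norm z) + \<epsilon>\<^sup>2)"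
      using C n \<epsilon> by (intro mult_left_mono add_mono power_mono) auto
    also have "\<dots> \<le> C * (16 * norm z ^ 4 + 16 * (\<epsilon> * norm z) + 16 * \<epsilon>\<^sup>2)"
      using C \<epsilon> by (intro mult_left_mono add_mono) (auto simp: power_mult_distrib)
    also have "\<dots> = D * (b1 (z, w) + b2 (z, w) + b3 (z, w))"
      by (simp add: D_def b1_def b2_def b3_def ww algebra_simps)
    finally show "\<bar>f (z, w)\<bar> \<le> D * (b1 (z, w) + b2 (z, w) + b3 (z, w))"
      by (simp add: f_def zz ww)
  qed
  hence R3: "\<forall>\<^sub>F w in small_filter. norm (R3 w) \<le> 3 * D * norm (b3 w)"
  proof eventually_elim
    case (elim w)
    have "b3 w = norm (b3 w)" by (simp add: b3_def case_prod_unfold)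
    moreover have "0 \<le> D * b3 w" using D by (simp add: b3_def case_prod_unfold)
    ultimately show ?case using elim unfolding R3_def R1_def R2_def by (auto simp: algebra_simps)
  qed
  have R1: "norm (R1 w) \<le> 3 * D * norm (b1 w)" for w
    using D by (auto simp: R1_def b1_def case_prod_unfold)
  have R2: "norm (R2 w) \<le> 3 * D * norm (b2 w)" for w
  proof -
    have "3 * D * b2 w \<le> 3 * D * \<bar>b2 w\<bar>" using D by (intro mult_left_mono) auto
    thus ?thesis using D by (auto simp: R2_def)
  qed
  show ?thesis
    unfolding ssm_remainder_def b1_def[symmetric] b2_def[symmetric] b3_def[symmetric]
  proof (intro exI conjI allI)
    show "R x v \<phi> \<epsilon> = R1 ((x, v), \<phi>, \<epsilon>) + R2 ((x, v), \<phi>, \<epsilon>) + R3 ((x, v), \<phi>, \<epsilon>)" for x v \<phi> \<epsilon>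
      by (simp add: R3_def f_def)
    show "R1 \<in> O[small_filter](b1)" by (rule bigoI[of _ "3 * D"]) (rule always_eventually, rule allI, rule R1)
    show "R2 \<in> O[small_filter](b2)" by (rule bigoI[of _ "3 * D"]) (rule always_eventually, rule allI, rule R2)
    show "R3 \<in> O[small_filter](b3)" by (rule bigoI[of _ "3 * D"]) (rule R3)
  qed
qed

lemma W_matrix_tensor_square:
  "W_matrix a b c *v tensor_square x v = (\<chi> i. qform (a $ i) (2 * b $ i) (c $ i) x v)"
proof -
  have v4: "(vector [p, q, r, s] :: 'z::zero^4) $ 1 = p" "(vector [p, q, r, s] :: 'z^4) $ 2 = q"
    "(vector [p, q, r, s] :: 'z^4) $ 3 = r" "(vector [p, q, r, s] :: 'z^4) $ 4 = s" for p q r s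
    unfolding vector_def by simp_all
  show ?thesis
    by (simp add: vec_eq_iff W_matrix_def tensor_square_def matrix_vector_mult_def sum_4 v4
        transpose_def qform_def algebra_simps)
qed

lemma inner_W_matrix:
  "(transpose (\<Phi> ** W_matrix a b c) *v y) \<bullet> tensor_square x v
    = y \<bullet> (\<Phi> *v (\<chi> i. qform (a $ i) (2 * b $ i) (c $ i) x v))"
  by (simp add: dot_lmul_matrix W_matrix_tensor_square flip: matrix_vector_mul_assoc)

lemma quadratic_roots:
  fixes b c :: real
  obtains r1 r2 :: complex where "r1 + r2 = - of_real b" "r1 * r2 = of_real c"
    "r1\<^sup>2 + of_real b * r1 + of_real c = 0" "r2\<^sup>2 + of_real b * r2 + of_real c = 0"
proof -
  define s where "s = csqrt (of_real (b\<^sup>2 / 4 - c))"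
  have s: "s\<^sup>2 = of_real (b\<^sup>2 / 4 - c)" by (simp add: s_def)
  show thesis
  proof (rule that[of "- of_real b / 2 + s" "- of_real b / 2 - s"])
    show "- of_real b / 2 + s + (- of_real b / 2 - s) = - of_real b" by simp
    have "(- of_real b / 2 + s) * (- of_real b / 2 - s) = of_real b ^ 2 / 4 - s\<^sup>2"
      by (simp add: field_simps power2_eq_square)
    thus "(- of_real b / 2 + s) * (- of_real b / 2 - s) = of_real c" by (simp add: s)
    have "(- of_real b / 2 + s)\<^sup>2 + of_real b * (- of_real b / 2 + s) + of_real c = s\<^sup>2 - of_real b ^ 2 / 4 + of_real c"
      by (simp add: field_simps power2_eq_square)
    thus "(- of_real b / 2 + s)\<^sup>2 + of_real b * (- of_real b / 2 + s) + of_real c = 0" by (simp add: s)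
    have "(- of_real b / 2 - s)\<^sup>2 + of_real b * (- of_real b / 2 - s) + of_real c = s\<^sup>2 - of_real b ^ 2 / 4 + of_real c"
      by (simp add: field_simps power2_eq_square)
    thus "(- of_real b / 2 - s)\<^sup>2 + of_real b * (- of_real b / 2 - s) + of_real c = 0" by (simp add: s)
  qed
qed

text \<open>Real and imaginary part of the characteristic equation at a nonreal root determine \<open>c\<close> and
  \<open>k\<close>.\<close>

lemma slow_mode_parameters:
  fixes lx :: complex
  assumes root: "poly [: of_real k, of_real c, of_real m :] lx = 0" and "Im lx \<noteq> 0" "m > 0"
    and "\<omega>\<^sup>2 = k / m" "2 * \<zeta> * \<omega> = c / m"
  shows "2 * \<zeta> * \<omega> = - 2 * Re lx" "\<omega>\<^sup>2 = (Re lx)\<^sup>2 + (Im lx)\<^sup>2"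
proof -
  have z: "of_real k + lx * (of_real c + lx * of_real m) = 0" using root by simp
  have "Re (of_real k + lx * (of_real c + lx * of_real m)) = 0"
    "Im (of_real k + lx * (of_real c + lx * of_real m)) = 0" unfolding z by simp_all
  hence re: "k + Re lx * c + ((Re lx)\<^sup>2 - (Im lx)\<^sup>2) * m = 0" and im: "Im lx * (c + 2 * Re lx * m) = 0"
    by (simp_all add: algebra_simps power2_eq_square)
  have c: "c = - 2 * Re lx * m" using im assms(2) by (simp add: eq_neg_iff_add_eq_0)
  have k: "k = ((Re lx)\<^sup>2 + (Im lx)\<^sup>2) * m" using re unfolding c by (simp add: algebra_simps power2_eq_square)
  show "2 * \<zeta> * \<omega> = - 2 * Re lx" using assms(3,5) c by simp
  show "\<omega>\<^sup>2 = (Re lx)\<^sup>2 + (Im lx)\<^sup>2" using assms(3,4) k by simp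
qed

lemma matrix_inv_solves:
  fixes L :: "real^'n^'n"
  assumes "invertible L"
  shows "L *v (matrix_inv L *v s) = s"
proof -
  have "L ** matrix_inv L = mat 1"
    using assms unfolding invertible_def matrix_inv_def by (metis (mono_tags, lifting) someI_ex)
  thus ?thesis by (simp add: matrix_vector_mul_assoc)
qed

text \<open>If \<open>\<Sigma> \<ge> 2\<close> this is the nonresonance condition for \<open>m1 = m2 = 1\<close>.  Otherwise the definition of \<open>\<Sigma>\<close>
  makes even the fastest mode decay more slowly than \<open>exp (2 Re lx1 t)\<close>.\<close>

lemma no_low_order_resonance:
  fixes ly :: "nat \<Rightarrow> complex" and lx1 lx2 :: complex
  assumes ordered: "\<And>i j. 1 \<le> i \<Longrightarrow> i \<le> j \<Longrightarrow> j \<le> N \<Longrightarrow> Re (ly j) \<le> Re (ly i)"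
    and slow: "Re lx2 = Re lx1" "Re lx1 < 0"
    and Sigma: "\<Sigma> = \<lfloor>Re (ly N) / Re lx1\<rfloor>"
    and nonresonance: "\<And>i (m1::nat) (m2::nat). i \<in> {1..N} \<Longrightarrow> 2 \<le> m1 + m2 \<Longrightarrow> int (m1 + m2) \<le> \<Sigma> \<Longrightarrow>
          Re (ly i) \<noteq> real m1 * Re lx1 + real m2 * Re lx2"
    and j: "j \<in> {1..N}"
  shows "Re (ly j) \<noteq> 2 * Re lx1"
proof (cases "2 \<le> \<Sigma>")
  case True
  thus ?thesis using nonresonance[OF j, of 1 1] slow by simp
next
  case False
  hence "Re (ly N) / Re lx1 < 2" unfolding Sigma by linarith
  hence "2 * Re lx1 < Re (ly N)" using slow by (simp add: field_simps)
  moreover have "Re (ly N) \<le> Re (ly j)" using ordered[of j N] j by simp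
  ultimately show ?thesis by linarith
qed

lemma graph_expansion:
  fixes Hg :: "real \<Rightarrow> real \<Rightarrow> real \<Rightarrow> real \<Rightarrow> real^'n"
  assumes modal: "modal_matrix M C K \<Phi> \<omega>s \<zeta>s"
    and le: "\<And>i. \<bar>modal_graph \<Phi> M Hg i x v \<phi> \<epsilon> - qform (a $ i) (2 * b $ i) (c $ i) x v\<bar> \<le> Y"
  shows "\<bar>(Hg x v \<phi> \<epsilon> - \<Phi> *v (\<chi> i. qform (a $ i) (2 * b $ i) (c $ i) x v)) $ j\<bar>
      \<le> (\<Sum>a\<in>UNIV. \<Sum>b\<in>UNIV. \<bar>\<Phi> $ a $ b\<bar>) * Y"
proof -
  define \<eta> where "\<eta> = transpose \<Phi> *v (M *v Hg x v \<phi> \<epsilon>)"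
  define w where "w = (\<chi> i. qform (a $ i) (2 * b $ i) (c $ i) x v)"
  have "Hg x v \<phi> \<epsilon> = \<Phi> *v \<eta>" unfolding \<eta>_def by (rule modal_inverse[OF modal, symmetric])
  hence "Hg x v \<phi> \<epsilon> - \<Phi> *v w = \<Phi> *v (\<eta> - w)" by (simp add: matrix_vector_mult_diff_distrib)
  moreover have "\<bar>(\<eta> - w) $ i\<bar> \<le> Y" for i
    using le[of i] by (simp add: \<eta>_def w_def modal_graph_def)
  ultimately show ?thesis unfolding w_def[symmetric] using abs_matrix_vector_le[of "\<eta> - w" Y \<Phi> j] by simp
qed

text \<open>The graph is multiplied by \<open>x\<close> or \<open>v\<close> in the leading terms, so its error \<open>O(amp\<^sup>3 + \<epsilon>)\<close> becomes
  \<open>O(amp\<^sup>4 + \<epsilon> amp)\<close>; the neglected terms contribute the square of \<open>O(amp\<^sup>2 + \<epsilon>)\<close>, hence \<open>\<epsilon>\<^sup>2\<close>.\<close>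

lemma reduced_force_expansion:
  fixes p :: "nat \<Rightarrow> nat \<Rightarrow> nat^'n \<Rightarrow> nat^'n \<Rightarrow> real"
    and g g' :: "real \<Rightarrow> real \<Rightarrow> real \<Rightarrow> real \<Rightarrow> real^'n" and y y' :: "real \<Rightarrow> real \<Rightarrow> real^'n"
  assumes \<sigma>: "0 < \<sigma>" "\<sigma> \<le> 1" and G: "0 \<le> G"
    and y: "\<And>x v j. amp x v \<le> \<sigma> \<Longrightarrow> \<bar>y x v $ j\<bar> \<le> G * (amp x v)\<^sup>2"
    and y': "\<And>x v j. amp x v \<le> \<sigma> \<Longrightarrow> \<bar>y' x v $ j\<bar> \<le> G * (amp x v)\<^sup>2"
    and g: "\<And>x v \<phi> \<epsilon> j. amp x v \<le> \<sigma> \<Longrightarrow> 0 < \<epsilon> \<Longrightarrow> \<epsilon> \<le> \<sigma> \<Longrightarrow>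
      \<bar>(g x v \<phi> \<epsilon> - y x v) $ j\<bar> \<le> G * ((amp x v) ^ 3 + \<epsilon>)"
    and g': "\<And>x v \<phi> \<epsilon> j. amp x v \<le> \<sigma> \<Longrightarrow> 0 < \<epsilon> \<Longrightarrow> \<epsilon> \<le> \<sigma> \<Longrightarrow>
      \<bar>(g' x v \<phi> \<epsilon> - y' x v) $ j\<bar> \<le> G * ((amp x v) ^ 3 + \<epsilon>)"
  shows "ssm_remainder (\<lambda>x v \<phi> \<epsilon>. mech_poly 3 p x v (g x v \<phi> \<epsilon>) (g' x v \<phi> \<epsilon>)
    - mech_leading p x v (y x v) (y' x v))"
proof -
  obtain C0 where C0: "0 \<le> C0" and L: "\<And>x v y y' Y. amp x v \<le> 1 \<Longrightarrow> Y \<le> 1 \<Longrightarrow>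
     (\<And>i. \<bar>y $ i\<bar> \<le> Y) \<Longrightarrow> (\<And>i. \<bar>y' $ i\<bar> \<le> Y) \<Longrightarrow>
     \<bar>mech_poly 3 p x v y y' - mech_leading p x v y y'\<bar> \<le> C0 * ((amp x v)\<^sup>2 * Y + Y\<^sup>2)"
    using mech_poly_leading[of p] by blast
  define U where "U = (\<Sum>i\<in>UNIV. \<bar>coeffs_y p 1 0 $ i\<bar> + \<bar>coeffs_y p 0 1 $ i\<bar>)
     + (\<Sum>i\<in>UNIV. \<bar>coeffs_y' p 1 0 $ i\<bar> + \<bar>coeffs_y' p 0 1 $ i\<bar>)"
  have U: "0 \<le> U" by (auto simp: U_def intro!: add_nonneg_nonneg sum_nonneg)
  define G2 where "G2 = 2 * G"
  have G2: "0 \<le> G2" using G by (simp add: G2_def)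
  (* Small enough for the graph to be bounded by 1, as the force expansion requires. *)
  define \<sigma>' where "\<sigma>' = min \<sigma> (1 / (2 * (G2 + 1)))"
  have \<sigma>': "0 < \<sigma>'" "\<sigma>' \<le> \<sigma>" "\<sigma>' \<le> 1" using \<sigma> G2 by (auto simp: \<sigma>'_def)
  have G2\<sigma>: "G2 * (2 * \<sigma>') \<le> 1"
  proof -
    have "2 * \<sigma>' \<le> 1 / (G2 + 1)" using G2 by (auto simp: \<sigma>'_def min_def field_simps)
    hence "G2 * (2 * \<sigma>') \<le> G2 * (1 / (G2 + 1))" using G2 by (intro mult_left_mono) auto
    also have "\<dots> \<le> 1" using G2 by simp
    finally show ?thesis .
  qed
  define D where "D = U * G + C0 * (G2 + 2 * G2\<^sup>2)"
  show ?thesis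
  proof (rule ssm_remainderI[OF \<sigma>'(1), of D])
    show "0 \<le> D" using U G C0 G2 by (simp add: D_def)
    fix x v \<phi> \<epsilon> :: real assume small: "amp x v \<le> \<sigma>'" "0 < \<epsilon>" "\<epsilon> \<le> \<sigma>'"
    let ?P = "mech_poly 3 p x v (g x v \<phi> \<epsilon>) (g' x v \<phi> \<epsilon>)"
    let ?L = "mech_leading p x v (g x v \<phi> \<epsilon>) (g' x v \<phi> \<epsilon>)"
    let ?Lead = "mech_leading p x v (y x v) (y' x v)"
    define N where "N = amp x v"
    have N: "0 \<le> N" "N \<le> \<sigma>'" "N \<le> 1" "\<epsilon> \<le> 1" using small \<sigma>' by (auto simp: N_def)
    have le: "amp x v \<le> \<sigma>" "\<epsilon> \<le> \<sigma>" using small \<sigma>' by auto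
    define Y where "Y = G2 * (N\<^sup>2 + \<epsilon>)"
    have N32: "N ^ 3 \<le> N\<^sup>2" "N\<^sup>2 \<le> N" using N power_decreasing[of 2 3 N] power_decreasing[of 1 2 N] by auto
    have Y1: "Y \<le> 1"
    proof -
      have "N\<^sup>2 + \<epsilon> \<le> 2 * \<sigma>'" using N N32 small by linarith
      hence "Y \<le> G2 * (2 * \<sigma>')" unfolding Y_def using G2 by (intro mult_left_mono)
      thus ?thesis using G2\<sigma> by linarith
    qed
    have size: "\<bar>z $ j\<bar> \<le> Y" if "\<bar>w $ j\<bar> \<le> G * (amp x v)\<^sup>2" "\<bar>(z - w) $ j\<bar> \<le> G * ((amp x v) ^ 3 + \<epsilon>)"
      for z w :: "real^'n" and j
    proof -
      have "\<bar>z $ j\<bar> \<le> G * N\<^sup>2 + G * (N ^ 3 + \<epsilon>)" using that unfolding N_def[symmetric] by simp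
      also have "\<dots> \<le> G * (N\<^sup>2 + \<epsilon>) + G * (N\<^sup>2 + \<epsilon>)"
        using G N32 small by (intro add_mono mult_left_mono) auto
      finally show ?thesis by (simp add: Y_def G2_def)
    qed
    have gY: "\<bar>g x v \<phi> \<epsilon> $ j\<bar> \<le> Y" and g'Y: "\<bar>g' x v \<phi> \<epsilon> $ j\<bar> \<le> Y" for j
      using size[OF y[OF le(1)] g[OF le(1) small(2) le(2)]] size[OF y'[OF le(1)] g'[OF le(1) small(2) le(2)]]
      by auto
    have "\<bar>?P - ?L\<bar>
        \<le> C0 * (N\<^sup>2 * Y + Y\<^sup>2)"
      unfolding N_def by (rule L) (use N Y1 gY g'Y in \<open>auto simp: N_def\<close>)
    moreover have "\<bar>?L - ?Lead\<bar>
        \<le> U * (N * (G * (N ^ 3 + \<epsilon>)))"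
    proof -
      have "?L - ?Lead
        = (x *\<^sub>R coeffs_y p 1 0 + v *\<^sub>R coeffs_y p 0 1) \<bullet> (g x v \<phi> \<epsilon> - y x v)
          + (x *\<^sub>R coeffs_y' p 1 0 + v *\<^sub>R coeffs_y' p 0 1) \<bullet> (g' x v \<phi> \<epsilon> - y' x v)"
        by (simp add: mech_leading_def inner_diff_right)
      also have "\<bar>\<dots>\<bar> \<le> U * (N * (G * (N ^ 3 + \<epsilon>)))"
        unfolding U_def distrib_right[of _ _ "N * _"]
        by (intro order_trans[OF abs_triangle_ineq] add_mono abs_inner_pencil_le[where x = x and v = v, folded N_def]
            g[OF le(1) small(2) le(2), folded N_def] g'[OF le(1) small(2) le(2), folded N_def])
      finally show ?thesis .
    qed
    ultimately have "\<bar>?P - ?Lead\<bar>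
        \<le> U * (N * (G * (N ^ 3 + \<epsilon>))) + C0 * (N\<^sup>2 * Y + Y\<^sup>2)" by linarith
    also have "U * (N * (G * (N ^ 3 + \<epsilon>))) = U * G * (N ^ 4 + \<epsilon> * N)"
      by (simp add: power3_eq_cube power4_eq_xxxx algebra_simps)
    also have "C0 * (N\<^sup>2 * Y + Y\<^sup>2) \<le> C0 * ((G2 + 2 * G2\<^sup>2) * (N ^ 4 + \<epsilon> * N + \<epsilon>\<^sup>2))"
    proof (intro mult_left_mono C0)
      have "\<epsilon> * N\<^sup>2 \<le> \<epsilon> * N" using N32 small by (intro mult_left_mono) auto
      hence "\<epsilon> * N\<^sup>2 \<le> \<epsilon> * N + \<epsilon>\<^sup>2" by (simp add: add_increasing2)
      hence "N\<^sup>2 * Y \<le> G2 * (N ^ 4 + \<epsilon> * N + \<epsilon>\<^sup>2)"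
        unfolding Y_def using G2
        by (subst mult.left_commute, intro mult_left_mono) (auto simp: power2_eq_square power4_eq_xxxx algebra_simps)
      moreover have "Y\<^sup>2 \<le> 2 * G2\<^sup>2 * (N ^ 4 + \<epsilon> * N + \<epsilon>\<^sup>2)"
      proof -
        have "(N\<^sup>2 + \<epsilon>)\<^sup>2 \<le> 2 * ((N\<^sup>2)\<^sup>2 + \<epsilon>\<^sup>2)" using sum_squares_bound[of "N\<^sup>2" \<epsilon>] by (simp add: power2_sum)
        also have "\<dots> \<le> 2 * (N ^ 4 + \<epsilon> * N + \<epsilon>\<^sup>2)" using N small by simp
        finally have "G2\<^sup>2 * (N\<^sup>2 + \<epsilon>)\<^sup>2 \<le> G2\<^sup>2 * (2 * (N ^ 4 + \<epsilon> * N + \<epsilon>\<^sup>2))"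
          by (intro mult_left_mono) auto
        thus ?thesis unfolding Y_def power_mult_distrib by (simp only: mult_ac)
      qed
      ultimately show "N\<^sup>2 * Y + Y\<^sup>2 \<le> (G2 + 2 * G2\<^sup>2) * (N ^ 4 + \<epsilon> * N + \<epsilon>\<^sup>2)"
        by (simp add: distrib_right)
    qed
    also have "U * G * (N ^ 4 + \<epsilon> * N) \<le> U * G * (N ^ 4 + \<epsilon> * N + \<epsilon>\<^sup>2)"
      using U G by (intro mult_left_mono) auto
    finally show "\<bar>?P - ?Lead\<bar>
        \<le> D * ((amp x v) ^ 4 + \<epsilon> * amp x v + \<epsilon>\<^sup>2)"
      unfolding N_def[symmetric] by (simp only: D_def distrib_right[of "U * G"] mult.assoc)
  qed
qed

theorem theorem3p1:
  fixes m c k \<omega> \<zeta> \<Omega> F1 \<alpha> \<beta> :: real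
    and M C K \<Phi> :: "real^'n^'n"
    and F2 :: "real^'n"
    and l :: nat
    and p :: "nat \<Rightarrow> nat \<Rightarrow> nat^'n \<Rightarrow> nat^'n \<Rightarrow> real"
    and q :: "nat \<Rightarrow> nat \<Rightarrow> nat^'n \<Rightarrow> nat^'n \<Rightarrow> real^'n"
    and P :: "real \<Rightarrow> real \<Rightarrow> real^'n \<Rightarrow> real^'n \<Rightarrow> real"
    and Q :: "real \<Rightarrow> real \<Rightarrow> real^'n \<Rightarrow> real^'n \<Rightarrow> real^'n"
    and lx1 lx2 :: complex
    and ly :: "nat \<Rightarrow> complex"
    and \<Sigma> :: int
    and \<omega>s \<zeta>s :: "'n \<Rightarrow> real"
    and s20 s11 s02 :: "real^'n"
    and h h' :: "real \<Rightarrow> real \<Rightarrow> real \<Rightarrow> real \<Rightarrow> real^'n"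
    and w11 w12 w22 wt11 wt12 wt22 :: "real^'n"
  assumes m_pos: "m > 0" and Omega_pos: "\<Omega> > 0"
    and l: "2 \<le> l" "l \<le> 3"
    and P: "P = mech_poly l p" and Q: "Q = mech_poly l q"
    and p_high: "\<And>i j u w. i + j + mdeg u + mdeg w > l \<Longrightarrow> p i j u w = 0"
    and q_high: "\<And>i j u w. i + j + mdeg u + mdeg w > l \<Longrightarrow> q i j u w = 0"
    and rayleigh: "C = \<alpha> *\<^sub>R M + \<beta> *\<^sub>R K"
    and modal: "modal_matrix M C K \<Phi> \<omega>s \<zeta>s"
    and omega: "\<omega>\<^sup>2 = k / m" and zeta: "2 * \<zeta> * \<omega> = c / m"
    and eigs_x: "proots [: of_real k, of_real c, of_real m :] = {# lx1, lx2 #}"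
    and underdamped: "lx1 = cnj lx2" "Im lx1 \<noteq> 0"
    and eigs_y: "proots (quad_charpoly M C K) = image_mset ly (mset_set {1..2 * CARD('n)})"
    and eigs_y_ordered: "\<And>i j. 1 \<le> i \<Longrightarrow> i \<le> j \<Longrightarrow> j \<le> 2 * CARD('n) \<Longrightarrow> Re (ly j) \<le> Re (ly i)"
    and slow: "Re (ly 1) < Re lx2" "Re lx2 = Re lx1" "Re lx1 < 0"
    and Sigma: "\<Sigma> = \<lfloor>Re (ly (2 * CARD('n))) / Re lx1\<rfloor>"
    and nonresonance: "\<And>i (m1::nat) (m2::nat).
          i \<in> {1..2 * CARD('n)} \<Longrightarrow> 2 \<le> m1 + m2 \<Longrightarrow> int (m1 + m2) \<le> \<Sigma> \<Longrightarrow>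
          Re (ly i) \<noteq> real m1 * Re lx1 + real m2 * Re lx2"
    and s: "\<And>i. has_quadratic_part (\<lambda>x v. modal_force \<Phi> Q x v 0 0 $ i) (s20 $ i) (s11 $ i) (s02 $ i)"
    and ssm: "slow_SSM m c k P F1 M C K Q F2 \<Omega> h h'"
    and w: "\<And>i. vector [w11 $ i, w12 $ i, w22 $ i] =
          matrix_inv (L_matrix \<omega> \<zeta> (\<omega>s i) (\<zeta>s i)) *v (vector [s20 $ i, s11 $ i, s02 $ i] :: real^3)"
    and wt11: "\<And>i. wt11 $ i = - 2 * \<omega>\<^sup>2 * w12 $ i"
    and wt12: "\<And>i. wt12 $ i = w11 $ i - 2 * \<zeta> * \<omega> * w12 $ i - \<omega>\<^sup>2 * w22 $ i"
    and wt22: "\<And>i. wt22 $ i = 2 * w12 $ i - 4 * \<zeta> * \<omega> * w22 $ i"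
  shows "(\<forall>i. invertible (L_matrix \<omega> \<zeta> (\<omega>s i) (\<zeta>s i))) \<and>
    (\<exists>R. ssm_remainder R \<and>
      (\<forall>x v a \<phi> \<epsilon>. ssm_reduced_model m c k P F1 h h' x v a \<phi> \<epsilon> \<longleftrightarrow>
        m * a + c * v + k * x
        + p 2 0 0 0 * x\<^sup>2 + p 1 1 0 0 * x * v + p 0 2 0 0 * v\<^sup>2
        + p 3 0 0 0 * x ^ 3 + p 2 1 0 0 * x\<^sup>2 * v + p 1 2 0 0 * x * v\<^sup>2 + p 0 3 0 0 * v ^ 3
        + (transpose (\<Phi> ** W_matrix w11 w12 w22)
             *v (x *\<^sub>R coeffs_y p 1 0 + v *\<^sub>R coeffs_y p 0 1)) \<bullet> tensor_square x v
        + (transpose (\<Phi> ** W_matrix wt11 wt12 wt22)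
             *v (x *\<^sub>R coeffs_y' p 1 0 + v *\<^sub>R coeffs_y' p 0 1)) \<bullet> tensor_square x v
        + R x v \<phi> \<epsilon>
        = \<epsilon> * F1 * sin \<phi>))"
proof -
  define \<alpha>x where "\<alpha>x = Re lx1"
  define \<beta>x where "\<beta>x = Im lx1"
  have P3: "P = mech_poly 3 p" unfolding P by (rule mech_poly_eq_cubic[OF l(2) p_high])
  have Q3: "Q = mech_poly 3 q" unfolding Q by (rule mech_poly_eq_cubic[OF l(2) q_high])
  have lin: "\<beta>x \<noteq> 0" "2 * \<zeta> * \<omega> = - 2 * \<alpha>x" "\<omega>\<^sup>2 = \<alpha>x\<^sup>2 + \<beta>x\<^sup>2"
  proof -
    have "[: complex_of_real k, of_real c, of_real m :] \<noteq> 0" using m_pos by simp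
    moreover have "lx1 \<in># proots [: complex_of_real k, of_real c, of_real m :]" unfolding eigs_x by simp
    ultimately have "poly [: complex_of_real k, of_real c, of_real m :] lx1 = 0"
      using set_count_proots by blast
    note params = slow_mode_parameters[OF this underdamped(2) m_pos omega zeta]
    show "\<beta>x \<noteq> 0" "2 * \<zeta> * \<omega> = - 2 * \<alpha>x" "\<omega>\<^sup>2 = \<alpha>x\<^sup>2 + \<beta>x\<^sup>2"
      unfolding \<alpha>x_def \<beta>x_def using params underdamped(2) by blast+
  qed
  have nonres: "Re r \<noteq> 2 * \<alpha>x"
    if "r\<^sup>2 + of_real (2 * \<zeta>s i * \<omega>s i) * r + of_real ((\<omega>s i)\<^sup>2) = 0" for r i
  proof -
    have "quad_charpoly M C K \<noteq> 0"
    proof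
      assume "quad_charpoly M C K = 0"
      hence "size (image_mset ly (mset_set {1..2 * CARD('n)})) = 0" using eigs_y by simp
      thus False by simp
    qed
    moreover have "poly (quad_charpoly M C K) r = 0" by (rule modal_root_is_eigenvalue[OF modal that])
    ultimately have "r \<in># proots (quad_charpoly M C K)" using set_count_proots by blast
    then obtain j where j: "j \<in> {1..2 * CARD('n)}" "r = ly j" unfolding eigs_y by auto
    have "Re (ly j) \<noteq> 2 * Re lx1"
      by (rule no_low_order_resonance[where N = "2 * CARD('n)" and \<Sigma> = \<Sigma> and ?lx2.0 = lx2])
        (fact eigs_y_ordered slow(2,3) Sigma nonresonance j(1))+
    thus ?thesis by (simp add: \<alpha>x_def j(2))
  qed
  have modes: "\<exists>r1 r2. r1 + r2 = - of_real (2 * \<zeta>s i * \<omega>s i) \<and> r1 * r2 = of_real ((\<omega>s i)\<^sup>2) \<and>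
      Re r1 \<noteq> 2 * \<alpha>x \<and> Re r2 \<noteq> 2 * \<alpha>x" for i
    using quadratic_roots[of "2 * \<zeta>s i * \<omega>s i" "(\<omega>s i)\<^sup>2"] nonres[where i = i] by metis
  have inv: "invertible (L_matrix \<omega> \<zeta> (\<omega>s i) (\<zeta>s i))" for i
    using modes[of i] L_matrix_invertible[OF lin] by blast
  obtain A \<rho> \<delta> where A: "0 \<le> A" and \<rho>: "0 < \<rho>" "\<rho> \<le> 1" "\<rho> < \<delta>"
    and jet: "\<And>i \<phi>. quad_jet (modal_graph \<Phi> M h i) \<phi> A \<rho>"
    and jet': "\<And>i \<phi>. quad_jet (modal_graph \<Phi> M h' i) \<phi> A \<rho>"
    and traj: "unforced_invariant m c k P F1 M C K Q F2 \<Omega> \<delta> h h'"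
    using slow_SSM_modal_jets[OF ssm] by blast
  have \<Omega>: "\<Omega> \<noteq> 0" using Omega_pos by simp
  obtain B \<sigma> where B: "A \<le> B" and \<sigma>: "0 < \<sigma>" "\<sigma> \<le> \<rho>"
    and dyn: "\<And>i. second_order_along_flow (c / m) (k / m) \<Omega>
      (2 * \<zeta>s i * \<omega>s i) ((\<omega>s i)\<^sup>2) (s20 $ i) (s11 $ i) (s02 $ i)
      (\<lambda>x v \<phi>. modal_graph \<Phi> M h i x v \<phi> 0) (\<lambda>x v \<phi>. modal_graph \<Phi> M h' i x v \<phi> 0) B \<sigma>"
    using modal_graph_dynamics[OF m_pos \<Omega> modal s[unfolded Q3] traj[unfolded P3 Q3] A \<rho> jet jet'] by blast
  have mode: "\<exists>K'\<ge>0. \<forall>\<phi> x v. amp x v \<le> \<sigma> \<longrightarrow>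
     \<bar>modal_graph \<Phi> M h i x v \<phi> 0 - qform (w11 $ i) (2 * w12 $ i) (w22 $ i) x v\<bar> \<le> K' * amp x v ^ 3 \<and>
     \<bar>modal_graph \<Phi> M h' i x v \<phi> 0 - qform (wt11 $ i) (2 * wt12 $ i) (wt22 $ i) x v\<bar> \<le> K' * amp x v ^ 3" for i
  proof -
    obtain r1 r2 :: complex where r: "r1 + r2 = - of_real (2 * \<zeta>s i * \<omega>s i)" "r1 * r2 = of_real ((\<omega>s i)\<^sup>2)"
      "Re r1 \<noteq> 2 * \<alpha>x" "Re r2 \<noteq> 2 * \<alpha>x" using modes[of i] by blast
    have L: "L_matrix \<omega> \<zeta> (\<omega>s i) (\<zeta>s i) *v vector [w11 $ i, w12 $ i, w22 $ i] = vector [s20 $ i, s11 $ i, s02 $ i]"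
      unfolding w by (rule matrix_inv_solves[OF inv])
    have B0: "0 \<le> B" using A B by linarith
    have weaken: "quad_expansion (\<lambda>x v. f x v \<phi> 0) B \<sigma>" if "quad_jet f \<phi> A \<rho>" for f \<phi>
      by (rule quad_jet_expansion[OF quad_jet_mono[OF that B \<sigma>(2)] B0]) (use \<sigma> \<rho> in linarith)
    show ?thesis
      by (rule modal_graph_leading[OF lin r B0 \<sigma>(1) weaken[OF jet] weaken[OF jet']
          dyn[of i, folded omega zeta] L wt11 wt12 wt22])
  qed
  then obtain K' where K': "\<And>i. 0 \<le> K' i" and exp0: "\<And>i \<phi> x v. amp x v \<le> \<sigma> \<Longrightarrow>
     \<bar>modal_graph \<Phi> M h i x v \<phi> 0 - qform (w11 $ i) (2 * w12 $ i) (w22 $ i) x v\<bar> \<le> K' i * amp x v ^ 3 \<and>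
     \<bar>modal_graph \<Phi> M h' i x v \<phi> 0 - qform (wt11 $ i) (2 * wt12 $ i) (wt22 $ i) x v\<bar> \<le> K' i * amp x v ^ 3"
    by metis
  define D where "D = (\<Sum>i\<in>UNIV. K' i) + A"
  have D: "K' i \<le> D" "A \<le> D" "0 \<le> D" for i
  proof -
    have "K' i \<le> (\<Sum>i\<in>UNIV. K' i)" by (rule member_le_sum) (auto simp: K')
    thus "K' i \<le> D" "A \<le> D" "0 \<le> D" using A K'[of i] by (auto simp: D_def)
  qed
  have expand: "\<bar>f x v \<phi> \<epsilon> - q x v\<bar> \<le> D * ((amp x v) ^ 3 + \<epsilon>)"
    if j: "quad_jet f \<phi> A \<rho>" and f: "\<bar>f x v \<phi> 0 - q x v\<bar> \<le> K' i * amp x v ^ 3"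
      and le: "amp x v \<le> \<sigma>" "0 < \<epsilon>" "\<epsilon> \<le> \<sigma>" for f q x v \<phi> \<epsilon> i
  proof -
    have "\<bar>f x v \<phi> \<epsilon> - f x v \<phi> 0\<bar> \<le> A * \<bar>\<epsilon>\<bar>"
      by (rule quad_jet_forcing[OF j A \<rho>(2)]) (use le \<sigma> in auto)
    also have "\<dots> \<le> D * \<epsilon>" using D le by (auto intro: mult_right_mono)
    finally have "\<bar>f x v \<phi> \<epsilon> - f x v \<phi> 0\<bar> \<le> D * \<epsilon>" .
    moreover have "K' i * amp x v ^ 3 \<le> D * amp x v ^ 3" using D by (intro mult_right_mono) auto
    ultimately have "\<bar>f x v \<phi> \<epsilon> - q x v\<bar> \<le> D * amp x v ^ 3 + D * \<epsilon>" using f by linarith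
    thus ?thesis by (simp add: distrib_left)
  qed
  define y where "y x v = \<Phi> *v (\<chi> i. qform (w11 $ i) (2 * w12 $ i) (w22 $ i) x v)" for x v
  define y' where "y' x v = \<Phi> *v (\<chi> i. qform (wt11 $ i) (2 * wt12 $ i) (wt22 $ i) x v)" for x v
  define n\<Phi> where "n\<Phi> = (\<Sum>a\<in>UNIV. \<Sum>b\<in>UNIV. \<bar>\<Phi> $ a $ b\<bar>)"
  have n\<Phi>: "0 \<le> n\<Phi>" by (auto simp: n\<Phi>_def intro!: sum_nonneg)
  define W where "W = (\<Sum>i\<in>UNIV. \<bar>w11 $ i\<bar> + \<bar>2 * w12 $ i\<bar> + \<bar>w22 $ i\<bar>
      + (\<bar>wt11 $ i\<bar> + \<bar>2 * wt12 $ i\<bar> + \<bar>wt22 $ i\<bar>))"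
  have W: "\<bar>w11 $ i\<bar> + \<bar>2 * w12 $ i\<bar> + \<bar>w22 $ i\<bar> + (\<bar>wt11 $ i\<bar> + \<bar>2 * wt12 $ i\<bar> + \<bar>wt22 $ i\<bar>) \<le> W" for i
    unfolding W_def by (rule member_le_sum) auto
  define G where "G = n\<Phi> * (D + W)"
  have W0: "0 \<le> W" unfolding W_def by (auto intro!: sum_nonneg)
  have G: "0 \<le> G" using n\<Phi> D W0 by (simp add: G_def)
  have G1: "n\<Phi> * (W * z) \<le> G * z" "n\<Phi> * (D * z) \<le> G * z" if "0 \<le> z" for z
    using mult_right_mono[OF mult_left_mono[OF _ n\<Phi>], of W "D + W" z]
      mult_right_mono[OF mult_left_mono[OF _ n\<Phi>], of D "D + W" z] that D(3) W0
    by (simp_all add: G_def mult.assoc)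
  define R where "R = (\<lambda>x v \<phi> \<epsilon>. mech_poly 3 p x v (h x v \<phi> \<epsilon>) (h' x v \<phi> \<epsilon>)
    - mech_leading p x v (y x v) (y' x v))"
  have "ssm_remainder R"
    unfolding R_def
  proof (rule reduced_force_expansion[OF \<sigma>(1) _ G])
    show "\<sigma> \<le> 1" using \<sigma> \<rho> by linarith
    fix x v \<phi> \<epsilon> :: real and j
    have graph: "\<bar>(\<Phi> *v (\<chi> i. qform (a $ i) (2 * b $ i) (c $ i) x v)) $ j\<bar> \<le> G * (amp x v)\<^sup>2"
      if abc: "\<And>i. \<bar>a $ i\<bar> \<le> W" "\<And>i. \<bar>2 * b $ i\<bar> \<le> W" "\<And>i. \<bar>c $ i\<bar> \<le> W" for a b c :: "real^'n"
    proof (rule order_trans[OF abs_matrix_vector_le])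
      show "\<bar>(\<chi> i. qform (a $ i) (2 * b $ i) (c $ i) x v) $ i\<bar> \<le> W * (amp x v)\<^sup>2" for i
        using qform_bound[of "a $ i" W "2 * b $ i" "c $ i" x v] abc[of i] by simp
      show "(\<Sum>a\<in>UNIV. \<Sum>b\<in>UNIV. \<bar>\<Phi> $ a $ b\<bar>) * (W * (amp x v)\<^sup>2) \<le> G * (amp x v)\<^sup>2"
        unfolding n\<Phi>_def[symmetric] by (rule G1(1)) simp
    qed
    have Wb: "\<bar>w11 $ i\<bar> \<le> W" "\<bar>2 * w12 $ i\<bar> \<le> W" "\<bar>w22 $ i\<bar> \<le> W"
      "\<bar>wt11 $ i\<bar> \<le> W" "\<bar>2 * wt12 $ i\<bar> \<le> W" "\<bar>wt22 $ i\<bar> \<le> W" for i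
      using W[of i] by linarith+
    show "\<bar>y x v $ j\<bar> \<le> G * (amp x v)\<^sup>2" unfolding y_def by (rule graph[OF Wb(1-3)])
    show "\<bar>y' x v $ j\<bar> \<le> G * (amp x v)\<^sup>2" unfolding y'_def by (rule graph[OF Wb(4-6)])
    assume le: "amp x v \<le> \<sigma>" "0 < \<epsilon>" "\<epsilon> \<le> \<sigma>"
    define z where "z = (amp x v) ^ 3 + \<epsilon>"
    have z: "0 \<le> z" using le by (simp add: z_def)
    have "\<bar>modal_graph \<Phi> M h i x v \<phi> \<epsilon> - qform (w11 $ i) (2 * w12 $ i) (w22 $ i) x v\<bar> \<le> D * z" for i
      unfolding z_def using jet exp0[OF le(1), of i \<phi>]
      by (intro expand[where q = "qform (w11 $ i) (2 * w12 $ i) (w22 $ i)" and i = i] le) auto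
    hence "\<bar>(h x v \<phi> \<epsilon> - y x v) $ j\<bar> \<le> n\<Phi> * (D * z)"
      unfolding y_def n\<Phi>_def by (rule graph_expansion[OF modal])
    thus "\<bar>(h x v \<phi> \<epsilon> - y x v) $ j\<bar> \<le> G * ((amp x v) ^ 3 + \<epsilon>)"
      using G1(2)[OF z] by (simp add: z_def)
    have "\<bar>modal_graph \<Phi> M h' i x v \<phi> \<epsilon> - qform (wt11 $ i) (2 * wt12 $ i) (wt22 $ i) x v\<bar> \<le> D * z" for i
      unfolding z_def using jet' exp0[OF le(1), of i \<phi>]
      by (intro expand[where q = "qform (wt11 $ i) (2 * wt12 $ i) (wt22 $ i)" and i = i] le) auto
    hence "\<bar>(h' x v \<phi> \<epsilon> - y' x v) $ j\<bar> \<le> n\<Phi> * (D * z)"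
      unfolding y'_def n\<Phi>_def by (rule graph_expansion[OF modal])
    thus "\<bar>(h' x v \<phi> \<epsilon> - y' x v) $ j\<bar> \<le> G * ((amp x v) ^ 3 + \<epsilon>)"
      using G1(2)[OF z] by (simp add: z_def)
  qed
  moreover have "ssm_reduced_model m c k P F1 h h' x v a \<phi> \<epsilon> \<longleftrightarrow>
        m * a + c * v + k * x
        + p 2 0 0 0 * x\<^sup>2 + p 1 1 0 0 * x * v + p 0 2 0 0 * v\<^sup>2
        + p 3 0 0 0 * x ^ 3 + p 2 1 0 0 * x\<^sup>2 * v + p 1 2 0 0 * x * v\<^sup>2 + p 0 3 0 0 * v ^ 3
        + (transpose (\<Phi> ** W_matrix w11 w12 w22)
             *v (x *\<^sub>R coeffs_y p 1 0 + v *\<^sub>R coeffs_y p 0 1)) \<bullet> tensor_square x v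
        + (transpose (\<Phi> ** W_matrix wt11 wt12 wt22)
             *v (x *\<^sub>R coeffs_y' p 1 0 + v *\<^sub>R coeffs_y' p 0 1)) \<bullet> tensor_square x v
        + R x v \<phi> \<epsilon>
        = \<epsilon> * F1 * sin \<phi>" for x v a \<phi> \<epsilon>
    unfolding ssm_reduced_model_def P3 R_def mech_leading_def inner_W_matrix y_def y'_def
    by (rule iffI; linarith)
  ultimately show ?thesis using inv by blast
qed

end
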